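(* Let $\theta_1<\theta_2$ be real and let $\underline\pi$ be a good measure on $\Omega$ with parameters $\theta_1<\theta_2$. Let the initial state $\underline\omega$ be distributed according to $\underline\pi$, and consider the $[\ell,\mathfrak r]$-monotone processes $\underline\omega^{[\ell,\mathfrak r]}(t)$, all started from the common initial configuration $\underline\omega$, together with the limiting height process $(h_i(t))_{i\in\mathbb Z,\,t\ge0}$. Then $$\mathbf E[h_i(t)-h_i(0)]\le t\cdot(e^{\theta_2}+e^{-\theta_1})\qquad\text{for all } i\in\mathbb Z\text{ and } t\ge0 .$$
   Context: Rate function: $r:\mathbb Z\to(0,\infty)$ is fixed, strictly increasing, satisfies $r(z)\,r(1-z)=1$ for all $z\in\mathbb Z$, $\lim_{z\to\infty}r(z)=\infty$, and there is $\beta>0$ with $r(z)<e^{\beta z}$ for all $z>0$. Configurations: for $\underline\omega\in\Omega=\mathbb Z^{\mathbb Z}$, $\underline\omega^{(i,i+1)}$ is obtained by replacing $\omega_i$ by $\omega_i-1$ and $\omega_{i+1}$ by $\omega_{i+1}+1$. Heights $(h_i)$ are related to increments by $\omega_i=h_{i-1}-h_i$; initially $h_0(0)=0$. Finite-volume processes: let $(N_i)_{i\in\mathbb Z}$ be i.i.d. rate-1 homogeneous Poisson point processes on $\mathbb R_+^2$, independent of the initial state. For integers $\ell<\mathfrak r$ the $[\ell,\mathfrak r]$-monotone process $\underline\omega^{[\ell,\mathfrak r]}(\cdot)$, with heights $h^{[\ell,\mathfrak r]}_i(\cdot)$, started from $\underline\omega$, is defined as follows: for $\ell\le i<\mathfrak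 r$, at each time $t$ such that $N_i$ has a point $(t,y)$ with $0<y<r(\omega_i(t-))+r(-\omega_{i+1}(t-))$, the jump $\underline\omega\to\underline\omega^{(i,i+1)}$, $h_i\to h_i+1$ takes place; no other changes occur. (This is a non-explosive Markov jump process in which the jump $\underline\omega\to\underline\omega^{(i,i+1)}$ has rate $r(\omega_i)+r(-\omega_{i+1})$ for $\ell\le i<\mathfrak r$.) All these processes use the same $(N_i)$. Limiting process: almost surely $h_i^{[\ell,\mathfrak r]}(t)$ is nondecreasing as the interval $[\ell,\mathfrak r]$ grows, and $h_i(t):=\lim_{[\ell,\mathfrak r]\nearrow\mathbb Z}h_i^{[\ell,\mathfrak r]}(t)\in(-\infty,\infty]$. Measures: $r(0)!:=1$, $r(n)!:=\prod_{y=1}^n r(y)$ for $n\ge1$; $Z(\theta):=\sum_{z\in\mathbb Z}e^{\theta z}/r(|z|)!$ (finite); $\mu^{(\theta)}(z):=\frac1{Z(\theta)}\frac{e^{\theta z}}{r(|z|)!}$ on $\mathbb Z$; $\underline\mu^{(\theta)}$ is the i.i.d. product measure on $\Omega$ with marginals $\mu^{(\theta)}$. A probability measure $\underline\pi$ on $\Omega$ is a good measure with parameters $\theta_1<\theta_2$ if there is a coupling of $\underline\eta\sim\underline\mu^{(\theta_1)}$, $\underline\zeta\sim\underline\pi$, $\underline\xi\sim\underline\mu^{(\theta_2)}$ with $\eta_i\le\zeta_i\le\xi_i$ almost surely for all $i\in\mathbb Z$. *)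

theory Defs
  imports "HOL-Probability.Probability"
begin

type_synonym config = "int \<Rightarrow> int"

section \<open>Heights, increments and the monotone dynamics\<close>

definition increments :: "(int \<Rightarrow> int) \<Rightarrow> config" where
  "increments h i = h (i - 1) - h i"

text \<open>The height function with increments \<open>\<omega>\<close> that vanishes at the origin.\<close>

definition heights :: "config \<Rightarrow> int \<Rightarrow> int" where
  "heights \<omega> i = (if 0 \<le> i then - (\<Sum>j\<in>{1..i}. \<omega> j) else (\<Sum>j\<in>{i+1..0}. \<omega> j))"

lemma heights_0: "heights \<omega> 0 = 0"
  by (simp add: heights_def)

lemma increments_heights: "increments (heights \<omega>) = \<omega>"
proof
  fix i :: int
  consider "1 \<le> i" | "i = 0" | "i < 0" by linarith
  then show "increments (heights \<omega>) i = \<omega> i"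
  proof cases
    case 1
    then have "{1..i} = insert i {1..i-1}" by auto
    with 1 show ?thesis by (simp add: increments_def heights_def)
  next
    case 2
    then show ?thesis by (simp add: increments_def heights_def)
  next
    case 3
    then have "{i..0} = insert i {i+1..0}" by auto
    with 3 show ?thesis by (simp add: increments_def heights_def)
  qed
qed

text \<open>Raising \<open>h\<^sub>i\<close> by one moves a unit of \<open>\<omega>\<close> from \<open>i\<close> to \<open>i + 1\<close>.\<close>

lemma increments_jump:
  "increments (h(i := h i + 1)) =
    (increments h)(i := increments h i - 1, i + 1 := increments h (i + 1) + 1)"
  by (auto simp: increments_def fun_eq_iff)

text \<open>
  The heights at time \<open>t\<close> when the heights just before \<open>t\<close> are \<open>g\<close>; \<open>N i\<close> is the set of points
  of the \<open>i\<close>-th point process.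
\<close>

definition monotone_step ::
    "(int \<Rightarrow> real) \<Rightarrow> (int \<Rightarrow> (real \<times> real) set) \<Rightarrow> int \<Rightarrow> int \<Rightarrow> real \<Rightarrow> (int \<Rightarrow> int) \<Rightarrow> int \<Rightarrow> int" where
  "monotone_step r N L R t g i =
    (if L \<le> i \<and> i < R \<and>
        (\<exists>y. (t, y) \<in> N i \<and> 0 < y \<and> y < r (increments g i) + r (- increments g (i + 1)))
     then g i + 1 else g i)"

text \<open>
  Paths are right-continuous with left limits in the discrete topology of the integers, so
  each height is piecewise constant in time. Negative times are fixed by convention, to make the
  path unique as a function on the whole real line.
\<close>

definition is_monotone_path ::
    "(int \<Rightarrow> real) \<Rightarrow> (int \<Rightarrow> (real \<times> real) set) \<Rightarrow> int \<Rightarrow> int \<Rightarrow> config \<Rightarrow> (real \<Rightarrow> int \<Rightarrow> int) \<Rightarrow> bool" where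
  "is_monotone_path r N L R \<omega> h \<longleftrightarrow>
    (\<forall>t\<le>0. h t = heights \<omega>) \<and>
    (\<forall>t\<ge>0. \<forall>i. ((\<lambda>s. h s i) \<longlongrightarrow> h t i) (at_right t)) \<and>
    (\<forall>t>0. \<exists>g. (\<forall>i. ((\<lambda>s. h s i) \<longlongrightarrow> g i) (at_left t)) \<and> h t = monotone_step r N L R t g)"

text \<open>
  \<open>monotone_heights r N L R \<omega> t i\<close> is the height \<open>h\<^sub>i(t)\<close> of the \<open>[L, R]\<close>-monotone process
  started from \<open>\<omega>\<close>. The description is proper (\<open>ex1_monotone_path\<close> below) whenever \<open>r\<close> is
  monotone and the point sets are locally finite.
\<close>

definition monotone_heights ::
    "(int \<Rightarrow> real) \<Rightarrow> (int \<Rightarrow> (real \<times> real) set) \<Rightarrow> int \<Rightarrow> int \<Rightarrow> config \<Rightarrow> real \<Rightarrow> int \<Rightarrow> int" where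
  "monotone_heights r N L R \<omega> = (THE h. is_monotone_path r N L R \<omega> h)"

definition limit_heights ::
    "(int \<Rightarrow> real) \<Rightarrow> (int \<Rightarrow> (real \<times> real) set) \<Rightarrow> config \<Rightarrow> real \<Rightarrow> int \<Rightarrow> ereal" where
  "limit_heights r N \<omega> t i =
    Lim (at_bot \<times>\<^sub>F at_top) (\<lambda>(L, R). ereal (of_int (monotone_heights r N L R \<omega> t i)))"

section \<open>Poisson point processes on the quadrant\<close>

definition quadrant :: "(real \<times> real) set" where
  "quadrant = {0..} \<times> {0..}"

definition locally_finite_sets :: "(real \<times> real) set set" where
  "locally_finite_sets = {S. S \<subseteq> quadrant \<and> (\<forall>B. bounded B \<longrightarrow> finite (S \<inter> B))}"

definition point_space :: "(real \<times> real) set measure" where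
  "point_space = sigma locally_finite_sets
    {{S \<in> locally_finite_sets. card (S \<inter> B) = k} | B k. B \<in> sets borel \<and> bounded B}"

text \<open>
  The intensity is Lebesgue measure, hence diffuse, so a rate-1 process is simple and can be
  represented by its random set of points.
\<close>

definition poisson_point_process :: "'a measure \<Rightarrow> ('a \<Rightarrow> (real \<times> real) set) \<Rightarrow> bool" where
  "poisson_point_process M X \<longleftrightarrow>
    X \<in> measurable M point_space \<and>
    (\<forall>B k. B \<in> sets borel \<and> bounded B \<and> B \<subseteq> quadrant \<longrightarrow>
      measure M {x \<in> space M. card (X x \<inter> B) = k}
        = measure lborel B ^ k / fact k * exp (- measure lborel B)) \<and>
    (\<forall>(n::nat) B.
      (\<forall>j<n. B j \<in> sets borel \<and> bounded (B j) \<and> B j \<subseteq> quadrant) \<and> disjoint_family_on B {..<n} \<longrightarrow>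
      prob_space.indep_vars M (\<lambda>_. count_space UNIV) (\<lambda>j x. card (X x \<inter> B j)) {..<n})"

section \<open>Measures on configurations\<close>

definition config_space :: "config measure" where
  "config_space = PiM UNIV (\<lambda>_. count_space UNIV)"

definition rate_fact :: "(int \<Rightarrow> real) \<Rightarrow> nat \<Rightarrow> real" where
  "rate_fact r n = (\<Prod>y=1..n. r (int y))"

definition partition_fun :: "(int \<Rightarrow> real) \<Rightarrow> real \<Rightarrow> real" where
  "partition_fun r \<theta> = (\<Sum>\<^sub>\<infinity>z\<in>(UNIV::int set). exp (\<theta> * of_int z) / rate_fact r (nat \<bar>z\<bar>))"

definition site_measure :: "(int \<Rightarrow> real) \<Rightarrow> real \<Rightarrow> int measure" where
  "site_measure r \<theta> = density (count_space UNIV)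
    (\<lambda>z. ennreal (1 / partition_fun r \<theta> * (exp (\<theta> * of_int z) / rate_fact r (nat \<bar>z\<bar>))))"

definition product_state :: "(int \<Rightarrow> real) \<Rightarrow> real \<Rightarrow> config measure" where
  "product_state r \<theta> = PiM UNIV (\<lambda>_. site_measure r \<theta>)"

text \<open>\<open>\<kappa>\<close> is the joint law of the coupled triple \<open>(\<eta>, \<zeta>, \<xi>)\<close>.\<close>

definition good_measure :: "(int \<Rightarrow> real) \<Rightarrow> real \<Rightarrow> real \<Rightarrow> config measure \<Rightarrow> bool" where
  "good_measure r \<theta>\<^sub>1 \<theta>\<^sub>2 \<pi> \<longleftrightarrow>
    prob_space \<pi> \<and> sets \<pi> = sets config_space \<and>
    (\<exists>\<kappa>. prob_space \<kappa> \<and>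
      sets \<kappa> = sets (config_space \<Otimes>\<^sub>M config_space \<Otimes>\<^sub>M config_space) \<and>
      distr \<kappa> config_space (\<lambda>(\<eta>, \<zeta>, \<xi>). \<eta>) = product_state r \<theta>\<^sub>1 \<and>
      distr \<kappa> config_space (\<lambda>(\<eta>, \<zeta>, \<xi>). \<zeta>) = \<pi> \<and>
      distr \<kappa> config_space (\<lambda>(\<eta>, \<zeta>, \<xi>). \<xi>) = product_state r \<theta>\<^sub>2 \<and>
      (AE (\<eta>, \<zeta>, \<xi>) in \<kappa>. \<forall>i. \<eta> i \<le> \<zeta> i \<and> \<zeta> i \<le> \<xi> i))"

section \<open>Existence and uniqueness of the monotone path\<close>

lemma real_interval_induct:
  fixes P :: "real \<Rightarrow> bool"
  assumes 0: "P 0"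
    and left: "\<And>t. 0 < t \<Longrightarrow> t \<le> T \<Longrightarrow> (\<And>s. 0 \<le> s \<Longrightarrow> s < t \<Longrightarrow> P s) \<Longrightarrow> P t"
    and right: "\<And>t. 0 \<le> t \<Longrightarrow> t < T \<Longrightarrow> P t \<Longrightarrow> \<exists>e>t. \<forall>s. t < s \<and> s < e \<and> s \<le> T \<longrightarrow> P s"
    and t: "0 \<le> t" "t \<le> T"
  shows "P t"
proof (rule ccontr)
  assume "\<not> P t"
  define S where "S = {s. 0 \<le> s \<and> s \<le> T \<and> \<not> P s}"
  have tS: "t \<in> S" using t \<open>\<not> P t\<close> by (simp add: S_def)
  have bdd: "bdd_below S" by (auto simp: S_def intro!: bdd_belowI[of _ 0])
  define u where "u = Inf S"
  have u0: "0 \<le> u" unfolding u_def using tS by (intro cInf_greatest) (auto simp: S_def)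
  have uT: "u \<le> T" using cInf_lower[OF tS bdd] t by (simp add: u_def)
  have below: "P s" if "0 \<le> s" "s < u" for s
  proof (rule ccontr)
    assume "\<not> P s"
    with that uT have "s \<in> S" by (simp add: S_def)
    from cInf_lower[OF this bdd] that show False by (simp add: u_def)
  qed
  have Pu: "P u"
    using 0 left[of u] below u0 uT by (cases "u = 0") auto
  have "u < T"
  proof (rule ccontr)
    assume "\<not> u < T"
    then have "u = T" using uT by simp
    moreover have "u \<le> t" using cInf_lower[OF tS bdd] by (simp add: u_def)
    ultimately show False using Pu t \<open>\<not> P t\<close> by auto
  qed
  from right[OF u0 this Pu] obtain e where e: "e > u" "\<forall>s. u < s \<and> s < e \<and> s \<le> T \<longrightarrow> P s" by blast
  have "Inf S < e" using e by (simp add: u_def)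
  then obtain s where s: "s \<in> S" "s < e" using cInf_lessD[of S e] tS by blast
  have "u \<le> s" using cInf_lower[OF s(1) bdd] by (simp add: u_def)
  with e(2) s Pu show False by (cases "s = u") (auto simp: S_def)
qed

definition path_upto where
  "path_upto r N L R \<omega> T h \<longleftrightarrow>
    (\<forall>t\<le>0. h t = heights \<omega>) \<and>
    (\<forall>t. 0 \<le> t \<and> t < T \<longrightarrow> (\<forall>i. ((\<lambda>s. h s i) \<longlongrightarrow> h t i) (at_right t))) \<and>
    (\<forall>t. 0 < t \<and> t \<le> T \<longrightarrow>
      (\<exists>g. (\<forall>i. ((\<lambda>s. h s i) \<longlongrightarrow> g i) (at_left t)) \<and> h t = monotone_step r N L R t g))"

lemma is_monotone_path_iff:
  "is_monotone_path r N L R \<omega> h \<longleftrightarrow> (\<forall>T. path_upto r N L R \<omega> T h)"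
  unfolding is_monotone_path_def path_upto_def by (meson gt_ex order_refl)

lemma path_upto_mono: "path_upto r N L R \<omega> T h \<Longrightarrow> S \<le> T \<Longrightarrow> path_upto r N L R \<omega> S h"
  unfolding path_upto_def by (meson order_trans less_le_trans)

lemma path_upto_right:
  assumes "path_upto r N L R \<omega> T h" "0 \<le> t" "t < T"
  shows "eventually (\<lambda>s. h s i = h t i) (at_right t)"
  using assms unfolding path_upto_def tendsto_discrete by blast

lemma path_upto_left_eq:
  assumes h: "path_upto r N L R \<omega> T h" and h': "path_upto r N L R \<omega> T h'"
    and t: "0 < t" "t \<le> T" and eq: "\<And>s. 0 \<le> s \<Longrightarrow> s < t \<Longrightarrow> h s = h' s"
  shows "h t = h' t"
proof -
  obtain g where g: "\<And>i. ((\<lambda>s. h s i) \<longlongrightarrow> g i) (at_left t)" "h t = monotone_step r N L R t g"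
    using h t unfolding path_upto_def by blast
  obtain g' where g': "\<And>i. ((\<lambda>s. h' s i) \<longlongrightarrow> g' i) (at_left t)" "h' t = monotone_step r N L R t g'"
    using h' t unfolding path_upto_def by blast
  have "g i = g' i" for i
  proof -
    have "eventually (\<lambda>s. h s i = h' s i) (at_left t)"
      unfolding eventually_at_left[OF t(1)] using eq t(1) by (intro exI[of _ 0]) auto
    then have "((\<lambda>s. h' s i) \<longlongrightarrow> g i) (at_left t)"
      using g(1)[of i] by (rule Lim_transform_eventually[rotated])
    then show ?thesis using g'(1)[of i] tendsto_unique trivial_limit_at_left_real by blast
  qed
  then have "g = g'" by auto
  with g(2) g'(2) show ?thesis by simp
qed

lemma path_upto_outside:
  assumes h: "path_upto r N L R \<omega> T h" and i: "\<not> (L \<le> i \<and> i < R)" and t: "t \<le> T"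
  shows "h t i = heights \<omega> i"
proof (cases "t \<le> 0")
  case True
  then show ?thesis using h by (simp add: path_upto_def)
next
  case False
  show ?thesis
  proof (rule real_interval_induct[where P="\<lambda>t. h t i = heights \<omega> i" and T=T])
    show "h 0 i = heights \<omega> i" using h by (simp add: path_upto_def)
  next
    fix t assume t: "0 < t" "t \<le> T" and IH: "\<And>s. 0 \<le> s \<Longrightarrow> s < t \<Longrightarrow> h s i = heights \<omega> i"
    obtain g where g: "\<And>i. ((\<lambda>s. h s i) \<longlongrightarrow> g i) (at_left t)" "h t = monotone_step r N L R t g"
      using h t unfolding path_upto_def by blast
    have ev: "eventually (\<lambda>s. h s i = heights \<omega> i) (at_left t)"
      unfolding eventually_at_left[OF t(1)] using IH t(1) by (intro exI[of _ 0]) auto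
    moreover have "eventually (\<lambda>s. h s i = g i) (at_left t)"
      using g(1)[of i] unfolding tendsto_discrete .
    ultimately have "eventually (\<lambda>s::real. g i = heights \<omega> i) (at_left t)"
      by eventually_elim simp
    then have "g i = heights \<omega> i" by simp
    then show "h t i = heights \<omega> i" using g(2) i by (auto simp: monotone_step_def)
  next
    fix t assume t: "0 \<le> t" "t < T" and eq: "h t i = heights \<omega> i"
    from path_upto_right[OF h t, of i] obtain b where "b > t" "\<forall>s>t. s < b \<longrightarrow> h s i = h t i"
      unfolding eventually_at_right[OF t(2)] by blast
    with eq show "\<exists>e>t. \<forall>s. t < s \<and> s < e \<and> s \<le> T \<longrightarrow> h s i = heights \<omega> i"
      by (intro exI[of _ b]) auto
  qed (use False t in auto)
qed

lemma path_upto_unique: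
  assumes h: "path_upto r N L R \<omega> T h" and h': "path_upto r N L R \<omega> T h'" and t: "t \<le> T"
  shows "h t = h' t"
proof (cases "t \<le> 0")
  case True
  then show ?thesis using h h' by (simp add: path_upto_def)
next
  case False
  show ?thesis
  proof (rule real_interval_induct[where P="\<lambda>t. h t = h' t" and T=T])
    show "h 0 = h' 0" using h h' by (simp add: path_upto_def)
  next
    fix t assume "0 < t" "t \<le> T" "\<And>s. 0 \<le> s \<Longrightarrow> s < t \<Longrightarrow> h s = h' s"
    then show "h t = h' t" using path_upto_left_eq[OF h h'] by blast
  next
    fix t assume t: "0 \<le> t" "t < T" and eq: "h t = h' t"
    have "eventually (\<lambda>s. \<forall>i\<in>{L..<R}. h s i = h t i \<and> h' s i = h' t i) (at_right t)"
      by (intro eventually_ball_finite finite_atLeastLessThan_int ballI eventually_conj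
          path_upto_right[OF h t] path_upto_right[OF h' t])
    then obtain b where b: "b > t" "\<And>s i. s > t \<Longrightarrow> s < b \<Longrightarrow> i \<in> {L..<R} \<Longrightarrow> h s i = h t i \<and> h' s i = h' t i"
      unfolding eventually_at_right[OF t(2)] by blast
    have "h s = h' s" if s: "t < s" "s < b" "s \<le> T" for s
    proof
      fix i
      show "h s i = h' s i"
        using b(2)[OF s(1,2), of i] eq path_upto_outside[OF h _ s(3), of i]
          path_upto_outside[OF h' _ s(3), of i]
        by (cases "L \<le> i \<and> i < R") auto
    qed
    with b(1) show "\<exists>e>t. \<forall>s. t < s \<and> s < e \<and> s \<le> T \<longrightarrow> h s = h' s" by blast
  qed (use False t in auto)
qed

lemma finite_jump_path:
  fixes F :: "real set" and U :: "real \<Rightarrow> 'b \<Rightarrow> 'b"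
  assumes "finite F" "\<forall>b\<in>F. 0 < b" and I0: "I 0 g\<^sub>0"
    and IU: "\<And>t b g. 0 \<le> t \<Longrightarrow> t < b \<Longrightarrow> I t g \<Longrightarrow> I b (U b g)"
  shows "\<exists>h. (\<forall>t\<le>0. h t = g\<^sub>0) \<and> (\<forall>t\<ge>0. \<exists>e>t. \<forall>s. t \<le> s \<and> s < e \<longrightarrow> h s = h t) \<and>
    (\<forall>t>0. \<exists>g d. 0 \<le> d \<and> d < t \<and> I d g \<and> (\<forall>s. d \<le> s \<and> s < t \<longrightarrow> h s = g) \<and>
      h t = (if t \<in> F then U t g else g))"
  using assms(1,2)
proof (induction F rule: finite_linorder_max_induct)
  case empty
  show ?case
  proof (intro exI[of _ "\<lambda>_. g\<^sub>0"] conjI allI impI)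
    show "\<exists>e>t. \<forall>s. t \<le> s \<and> s < e \<longrightarrow> g\<^sub>0 = g\<^sub>0" for t :: real
      by (intro exI[of _ "t + 1"]) simp
    show "\<exists>g d. 0 \<le> d \<and> d < t \<and> I d g \<and> (\<forall>s. d \<le> s \<and> s < t \<longrightarrow> g\<^sub>0 = g) \<and>
        g\<^sub>0 = (if t \<in> {} then U t g else g)" if "0 < t" for t
      using that I0 by (intro exI[of _ g\<^sub>0] exI[of _ 0]) simp
  qed simp
next
  case (insert b A)
  have b: "0 < b" "b \<notin> A" using insert.hyps(2) insert.prems by auto
  have "\<exists>h. (\<forall>t\<le>0. h t = g\<^sub>0) \<and> (\<forall>t\<ge>0. \<exists>e>t. \<forall>s. t \<le> s \<and> s < e \<longrightarrow> h s = h t) \<and>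
    (\<forall>t>0. \<exists>g d. 0 \<le> d \<and> d < t \<and> I d g \<and> (\<forall>s. d \<le> s \<and> s < t \<longrightarrow> h s = g) \<and>
      h t = (if t \<in> A then U t g else g))"
    using insert.prems by (intro insert.IH) simp
  then obtain h where h0: "\<And>t. t \<le> 0 \<Longrightarrow> h t = g\<^sub>0"
    and hr: "\<And>t. t \<ge> 0 \<Longrightarrow> \<exists>e>t. \<forall>s. t \<le> s \<and> s < e \<longrightarrow> h s = h t"
    and hl: "\<And>t. t > 0 \<Longrightarrow> \<exists>g d. 0 \<le> d \<and> d < t \<and> I d g \<and> (\<forall>s. d \<le> s \<and> s < t \<longrightarrow> h s = g) \<and>
      h t = (if t \<in> A then U t g else g)"
    by blast
  from hl[OF b(1)] obtain g d where gd: "0 \<le> d" "d < b" "I d g" "\<And>s. d \<le> s \<Longrightarrow> s < b \<Longrightarrow> h s = g"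
    by blast
  define h' where "h' = (\<lambda>t. if t < b then h t else U b g)"
  show ?case
  proof (intro exI[of _ h'] conjI allI impI)
    show "h' t = g\<^sub>0" if "t \<le> 0" for t using that b h0 by (simp add: h'_def)
  next
    fix t :: real assume t: "0 \<le> t"
    show "\<exists>e>t. \<forall>s. t \<le> s \<and> s < e \<longrightarrow> h' s = h' t"
    proof (cases "t < b")
      case True
      from hr[OF t] obtain e where e: "e > t" "\<forall>s. t \<le> s \<and> s < e \<longrightarrow> h s = h t" by blast
      have "h' s = h' t" if "t \<le> s" "s < min e b" for s
        using e(2)[rule_format, of s] that True unfolding h'_def by simp
      moreover have "min e b > t" using e(1) True by simp
      ultimately show ?thesis by blast
    next
      case False
      then show ?thesis by (intro exI[of _ "t + 1"]) (auto simp: h'_def)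
    qed
  next
    fix t :: real assume t: "0 < t"
    consider "t < b" | "t = b" | "b < t" by linarith
    then show "\<exists>g d. 0 \<le> d \<and> d < t \<and> I d g \<and> (\<forall>s. d \<le> s \<and> s < t \<longrightarrow> h' s = g) \<and>
      h' t = (if t \<in> insert b A then U t g else g)"
    proof cases
      case 1
      obtain g d where *: "0 \<le> d" "d < t" "I d g" "\<And>s. d \<le> s \<Longrightarrow> s < t \<Longrightarrow> h s = g"
        "h t = (if t \<in> A then U t g else g)" using hl[OF t] by blast
      have "h' s = g" if "d \<le> s" "s < t" for s using *(4)[of s] that 1 by (simp add: h'_def)
      moreover have "h' t = (if t \<in> insert b A then U t g else g)" using *(5) 1 by (simp add: h'_def)
      ultimately show ?thesis using *(1-3) by (intro exI[of _ g] exI[of _ d]) simp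
    next
      case 2
      have "h' s = g" if "d \<le> s" "s < t" for s using gd(4)[of s] that 2 by (simp add: h'_def)
      moreover have "h' t = U t g" using 2 by (simp add: h'_def)
      ultimately show ?thesis using gd(1-3) 2 by (intro exI[of _ g] exI[of _ d]) simp
    next
      case 3
      with insert.hyps have "t \<notin> insert b A" by auto
      with 3 IU[OF gd(1-3)] b show ?thesis
        by (intro exI[of _ "U b g"] exI[of _ b]) (auto simp: h'_def)
    qed
  qed
qed

lemma path_upto_exists:
  assumes r: "mono r" and N: "\<And>i. N i \<in> locally_finite_sets"
  shows "\<exists>h. path_upto r N L R \<omega> T h"
proof -
  define g0 where "g0 = heights \<omega>"
  define Q where "Q t = (SIGMA j:{L..<R}. {p \<in> N j. fst p \<le> t \<and> 0 < snd p \<and> snd p \<le> 2 * r 0})" for t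
  have nn: "0 \<le> fst p" "0 \<le> snd p" if "p \<in> N j" for p j
    using that N[of j] by (auto simp: locally_finite_sets_def quadrant_def)
  have fin: "finite (N j \<inter> ({0..a} \<times> {0..b}))" for j a b
  proof -
    have "bounded ({0..a} \<times> {0..b})" by (intro bounded_Times) auto
    with N[of j] show ?thesis by (simp add: locally_finite_sets_def)
  qed
  have finQ: "finite (Q t)" for t
    unfolding Q_def
    by (intro finite_SigmaI finite_atLeastLessThan_int finite_subset[OF _ fin[of _ t "2 * r 0"]])
      (auto dest: nn)
  have Qmono: "card (Q s) \<le> card (Q t)" if "s \<le> t" for s t
    using that by (intro card_mono finQ) (auto simp: Q_def)
  have "bdd_above (g0 ` {L-1..R})" "bdd_below (g0 ` {L-1..R})" by auto
  then obtain A B where "\<forall>i\<in>{L-1..R}. A \<le> g0 i" "\<forall>i\<in>{L-1..R}. g0 i \<le> B"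
    unfolding bdd_above_def bdd_below_def ball_simps by blast
  then have AB: "\<And>i. i \<in> {L-1..R} \<Longrightarrow> A \<le> g0 i \<and> g0 i \<le> B" by blast
  define D where "D = B + int (card (Q T)) - A"
  define C where "C = r D + r D"
  define F where "F = {t. 0 < t \<and> t \<le> T \<and> (\<exists>i\<in>{L..<R}. \<exists>y. (t, y) \<in> N i \<and> 0 < y \<and> y \<le> C)}"
  have "F \<subseteq> fst ` (\<Union>i\<in>{L..<R}. N i \<inter> ({0..T} \<times> {0..C}))"
    by (force simp: F_def image_iff)
  then have finF: "finite F"
    by (rule finite_subset) (intro finite_imageI finite_UN_I finite_atLeastLessThan_int fin)
  define I where "I t g \<longleftrightarrow> (\<forall>i\<in>{L-1..R}. A \<le> g i \<and> g i \<le> B + int (card (Q t)))" for t g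
  have "\<exists>h. (\<forall>t\<le>0. h t = g0) \<and> (\<forall>t\<ge>0. \<exists>e>t. \<forall>s. t \<le> s \<and> s < e \<longrightarrow> h s = h t) \<and>
    (\<forall>t>0. \<exists>g d. 0 \<le> d \<and> d < t \<and> I d g \<and> (\<forall>s. d \<le> s \<and> s < t \<longrightarrow> h s = g) \<and>
      h t = (if t \<in> F then monotone_step r N L R t g else g))"
  proof (rule finite_jump_path[OF finF])
    show "\<forall>b\<in>F. 0 < b" by (auto simp: F_def)
    show "I 0 g0" using AB by (fastforce simp: I_def)
  next
    fix t b :: real and g assume t: "0 \<le> t" "t < b" and I: "I t g"
    show "I b (monotone_step r N L R b g)"
      unfolding I_def
    proof
      fix i assume i: "i \<in> {L-1..R}"
      have gi: "A \<le> g i" "g i \<le> B + int (card (Q t))" using I i by (auto simp: I_def)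
      have QQ: "card (Q t) \<le> card (Q b)" using Qmono t by simp
      show "A \<le> monotone_step r N L R b g i \<and> monotone_step r N L R b g i \<le> B + int (card (Q b))"
      proof (cases "monotone_step r N L R b g i = g i")
        case True
        with gi QQ show ?thesis by auto
      next
        case False
        then have eq: "monotone_step r N L R b g i = g i + 1" and iL: "L \<le> i" "i < R"
          by (auto simp: monotone_step_def split: if_splits)
        from False obtain y where
          y: "(b, y) \<in> N i" "0 < y" "y < r (increments g i) + r (- increments g (i + 1))"
          by (auto simp: monotone_step_def split: if_splits)
        have "g i + 1 \<le> B + int (card (Q b))"
        proof (cases "g i < B + int (card (Q t))")
          case True
          with QQ show ?thesis by linarith
        next
          case False
          with gi have gi': "g i = B + int (card (Q t))" by simp
          have "g (i - 1) \<le> g i" "g (i + 1) \<le> g i"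
            using I iL unfolding gi' by (auto simp: I_def)
          then have "r (increments g i) \<le> r 0" "r (- increments g (i + 1)) \<le> r 0"
            by (auto intro!: monoD[OF r] simp: increments_def)
          with y iL t have "(i, (b, y)) \<in> Q b" "(i, (b, y)) \<notin> Q t" by (auto simp: Q_def)
          moreover have "Q t \<subseteq> Q b" using t by (auto simp: Q_def)
          ultimately have "card (Q t) < card (Q b)" by (intro psubset_card_mono finQ) auto
          with gi' show ?thesis by simp
        qed
        with eq gi show ?thesis by simp
      qed
    qed
  qed
  then obtain h where h0: "\<And>t. t \<le> 0 \<Longrightarrow> h t = g0"
    and hr: "\<And>t. t \<ge> 0 \<Longrightarrow> \<exists>e>t. \<forall>s. t \<le> s \<and> s < e \<longrightarrow> h s = h t"
    and hl: "\<And>t. t > 0 \<Longrightarrow> \<exists>g d. 0 \<le> d \<and> d < t \<and> I d g \<and> (\<forall>s. d \<le> s \<and> s < t \<longrightarrow> h s = g) \<and>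
      h t = (if t \<in> F then monotone_step r N L R t g else g)"
    by blast
  have "path_upto r N L R \<omega> T h"
    unfolding path_upto_def
  proof (intro conjI allI impI)
    show "h t = heights \<omega>" if "t \<le> 0" for t using h0 that by (simp add: g0_def)
  next
    fix t i assume t: "0 \<le> t \<and> t < T"
    with hr[of t] obtain e where e: "e > t" "\<forall>s. t \<le> s \<and> s < e \<longrightarrow> h s = h t" by blast
    have "h s i = h t i" if "t < s" "s < e" for s
      using e(2)[rule_format, of s] that by simp
    with e(1) show "((\<lambda>s. h s i) \<longlongrightarrow> h t i) (at_right t)"
      unfolding tendsto_discrete eventually_at_right[OF e(1)] by blast
  next
    fix t assume t: "0 < t \<and> t \<le> T"
    with hl[of t] obtain g d where gd: "0 \<le> d" "d < t" "I d g" "\<And>s. d \<le> s \<Longrightarrow> s < t \<Longrightarrow> h s = g"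
      "h t = (if t \<in> F then monotone_step r N L R t g else g)" by blast
    have "((\<lambda>s. h s i) \<longlongrightarrow> g i) (at_left t)" for i
      unfolding tendsto_discrete eventually_at_left[OF gd(2)] using gd(2,4)
      by (intro exI[of _ d]) auto
    moreover have "monotone_step r N L R t g = g" if "t \<notin> F"
    proof
      fix i
      show "monotone_step r N L R t g i = g i"
      proof (rule ccontr)
        assume *: "monotone_step r N L R t g i \<noteq> g i"
        then have i: "L \<le> i" "i < R" by (auto simp: monotone_step_def split: if_splits)
        from * obtain y where
          y: "(t, y) \<in> N i" "0 < y" "y < r (increments g i) + r (- increments g (i + 1))"
          by (auto simp: monotone_step_def split: if_splits)
        have bnd: "A \<le> g j" "g j \<le> B + int (card (Q T))" if "j \<in> {L-1..R}" for j
        proof -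
          have "A \<le> g j" "g j \<le> B + int (card (Q d))" using gd(3) that by (auto simp: I_def)
          moreover have "card (Q d) \<le> card (Q T)" using gd(2) t by (intro Qmono) simp
          ultimately show "A \<le> g j" "g j \<le> B + int (card (Q T))" by linarith+
        qed
        have "r (increments g i) \<le> r D" "r (- increments g (i + 1)) \<le> r D"
          using bnd[of "i - 1"] bnd[of i] bnd[of "i + 1"] i
          by (auto intro!: monoD[OF r] simp: increments_def D_def)
        with y have "y \<le> C" by (simp add: C_def)
        with y i t have "t \<in> F" by (auto simp: F_def)
        with that show False by simp
      qed
    qed
    ultimately show "\<exists>g. (\<forall>i. ((\<lambda>s. h s i) \<longlongrightarrow> g i) (at_left t)) \<and> h t = monotone_step r N L R t g"
      using gd(5) by (intro exI[of _ g]) auto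
  qed
  then show ?thesis by blast
qed

lemma ex1_monotone_path:
  assumes r: "mono r" and N: "\<And>i. N i \<in> locally_finite_sets"
  shows "\<exists>!h. is_monotone_path r N L R \<omega> h"
proof -
  have "\<forall>n::nat. \<exists>h. path_upto r N L R \<omega> (real n + 1) h"
    by (intro allI path_upto_exists r N)
  then obtain H where H: "\<And>n::nat. path_upto r N L R \<omega> (real n + 1) (H n)" by metis
  define h where "h t = H (nat \<lceil>t\<rceil>) t" for t
  have eq: "h s = H n s" if "s \<le> real n + 1" for s n
  proof -
    have "path_upto r N L R \<omega> s (H n)" "path_upto r N L R \<omega> s (H (nat \<lceil>s\<rceil>))"
      using that by (auto intro!: path_upto_mono[OF H] simp: of_nat_ceiling add_increasing2)
    then show ?thesis unfolding h_def using path_upto_unique by (metis order_refl)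
  qed
  have ex: "path_upto r N L R \<omega> T h" for T
  proof -
    obtain n :: nat where n: "T \<le> real n" using real_arch_simple by blast
    have right: "((\<lambda>s. h s i) \<longlongrightarrow> h t i) (at_right t)" if t: "0 \<le> t" "t < T" for t i
    proof -
      have "((\<lambda>s. H n s i) \<longlongrightarrow> H n t i) (at_right t)"
        using H[of n] t n unfolding path_upto_def by auto
      moreover have "eventually (\<lambda>s. H n s i = h s i) (at_right t)"
        unfolding eventually_at_right[OF t(2)]
        using t n eq by (intro exI[of _ T]) (auto simp: eq[symmetric])
      ultimately show ?thesis
        using eq[of t n] t n by (simp add: Lim_transform_eventually)
    qed
    have left: "\<exists>g. (\<forall>i. ((\<lambda>s. h s i) \<longlongrightarrow> g i) (at_left t)) \<and> h t = monotone_step r N L R t g"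
      if t: "0 < t" "t \<le> T" for t
    proof -
      have "0 < t \<and> t \<le> real n + 1" using t n by simp
      then obtain g where g: "\<And>i. ((\<lambda>s. H n s i) \<longlongrightarrow> g i) (at_left t)"
        "H n t = monotone_step r N L R t g"
        using H[of n] unfolding path_upto_def by blast
      have "eventually (\<lambda>s. H n s i = h s i) (at_left t)" for i
        unfolding eventually_at_left[OF t(1)]
        using t n by (intro exI[of _ 0]) (auto simp: eq[of _ n])
      with g(1) have "((\<lambda>s. h s i) \<longlongrightarrow> g i) (at_left t)" for i
        by (rule Lim_transform_eventually)
      with g(2) show ?thesis using eq[of t n] t n by auto
    qed
    have "h t = heights \<omega>" if "t \<le> 0" for t
      using eq[of t 0] H[of 0] that by (auto simp: path_upto_def)
    with right left show ?thesis unfolding path_upto_def by blast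
  qed
  show ?thesis
  proof (rule ex1I[of _ h])
    show "is_monotone_path r N L R \<omega> h" using ex by (simp add: is_monotone_path_iff)
    show "h' = h" if "is_monotone_path r N L R \<omega> h'" for h'
      using that ex path_upto_unique[of r N L R \<omega> _ h' h] by (metis is_monotone_path_iff ext order_refl)
  qed
qed

lemma is_monotone_path_monotone_heights:
  assumes "mono r" "\<And>i. N i \<in> locally_finite_sets"
  shows "is_monotone_path r N L R \<omega> (monotone_heights r N L R \<omega>)"
  unfolding monotone_heights_def by (rule theI'[OF ex1_monotone_path[OF assms]])

end

theory Submission
  imports Defs
begin

text \<open>
  Fix a finite window, divide \<open>[0, t]\<close> into short slabs, and drive several discrete chains by the same
  points: a slab without points changes nothing, a slab with exactly one relevant point makes the
  jumps that this point causes, and everything is killed as soon as a slab contains two relevant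
  points or some increment exceeds a cut-off \<open>K\<close>. One slab of this killed chain maps the stationary
  product measure to something below it, exactly and not only up to errors of second order, because
  the stationarity of the generator reduces to the shift identity \<open>r z \<mu>(z) = exp \<theta> \<mu>(z - 1)\<close>.

  The chain started from \<open>\<zeta>\<close> receives at the boundary the rate \<open>exp \<theta>\<^sub>2\<close> from the left and
  \<open>exp (- \<theta>\<^sub>1)\<close> from the right. It dominates the heights of the monotone process, and its increments
  stay between those of the stationary chains started from \<open>\<eta>\<close> and \<open>\<xi>\<close>. Its jump rate at a bond is
  therefore at most \<open>r (\<xi>\<^sub>j) + r (- \<eta>\<^sub>j\<^sub>+\<^sub>1)\<close>, whose expectation is at most
  \<open>exp \<theta>\<^sub>2 + exp (- \<theta>\<^sub>1)\<close> by sub-invariance.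

  For given locally finite point sets the heights of all chains are bounded uniformly in \<open>K\<close> and in
  the number of slabs, and almost surely the slabs can be chosen so fine that no two points share
  one. Hence the discrete chain eventually follows the monotone path, and Fatou's lemma gives the
  bound, first in a finite window and then in the limit.
\<close>

section \<open>Measurability on the configuration space\<close>

text \<open>The monotone process in a window has no stationary law at hand. Boundary rates equal to
  the means exp \<theta> of r (z) and exp (- \<theta>) of r (- z) under the marginal close the
  window and make the product measure stationary. The price is that boundary jumps disturb the
  increments, so one chain is compared through heights and two others through increments. Rates are
  unbounded; only after a cut-off K do finitely many points matter in a slab. Killing costs nothing
  because every loss has the favourable sign: it can only lower an expected count, so the killed
  mass is never estimated, and only the pointwise limit has to be exact. With at most one point per
  slab of length d the transition operator is affine in the generator: exp (- x) times (1 + x + d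
  times the generator), x being the mean number of points. Stationarity of the generator then leaves
  the factor (1 + x) exp (- x) \<le> 1. The limits are ordered accordingly: the number of slabs is
  chosen for each K so that the probabilities of a slab with several points are summable in K, and
  the window grows last.\<close>

lemma ennreal_mult_assoc: "0 \<le> a \<Longrightarrow> 0 \<le> b \<Longrightarrow> ennreal a * (ennreal b * c) = ennreal (a * b) * c"
  by (simp add: ennreal_mult mult.assoc)

lemma nn_integral_count_space_shift:
  fixes f :: "int \<Rightarrow> ennreal"
  shows "(\<integral>\<^sup>+z. f (z + a) \<partial>count_space UNIV) = (\<integral>\<^sup>+z. f z \<partial>count_space UNIV)"
proof -
  have "bij_betw (\<lambda>z::int. z + a) UNIV UNIV"
    by (rule bij_betwI[of _ _ _ "\<lambda>z. z - a"]) auto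
  then show ?thesis by (rule nn_integral_bij_count_space)
qed

lemma space_config_space [simp]: "space config_space = UNIV"
  by (simp add: config_space_def space_PiM)

lemma measurable_config_coord [measurable]: "(\<lambda>x. x i) \<in> measurable config_space (count_space UNIV)"
  unfolding config_space_def by measurable

lemma measurable_config_spaceI:
  assumes "\<And>i. (\<lambda>x. f x i) \<in> measurable M (count_space UNIV)"
  shows "f \<in> measurable M config_space"
  unfolding config_space_def using assms by (intro measurable_PiM_single') auto

text \<open>Both arguments are integers, hence countably valued, so an arbitrary \<open>F\<close> is
  measurable even for the full power set of its range. Rates and increments are handled this way
  without any Borel structure.\<close>

lemma measurable_int_op:
  fixes F :: "int \<Rightarrow> int \<Rightarrow> 'b"
  assumes u: "u \<in> measurable M (count_space UNIV)" and v: "v \<in> measurable M (count_space UNIV)"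
  shows "(\<lambda>x. F (u x) (v x)) \<in> measurable M (count_space UNIV)"
  using measurable_compose_countable[OF _ u, of "\<lambda>a x. F a (v x)"]
    measurable_compose[OF v, of "F _"] by simp

lemma measurable_sum_int:
  fixes f :: "'b \<Rightarrow> 'c \<Rightarrow> int"
  assumes "finite A" "\<And>j. j \<in> A \<Longrightarrow> f j \<in> measurable M (count_space UNIV)"
  shows "(\<lambda>x. \<Sum>j\<in>A. f j x) \<in> measurable M (count_space UNIV)"
  using assms
proof (induction A rule: finite_induct)
  case (insert a A)
  have "f a \<in> measurable M (count_space UNIV)" "(\<lambda>x. \<Sum>j\<in>A. f j x) \<in> measurable M (count_space UNIV)"
    using insert by simp_all
  from measurable_int_op[OF this, of "(+)"] insert.hyps show ?case by simp
qed simp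

lemma measurable_config_shift: "(\<lambda>x::config. x(i := x i + a)) \<in> measurable config_space config_space"
  by (intro measurable_config_spaceI)
    (auto simp: fun_upd_def intro: measurable_compose[of _ _ "count_space UNIV"])

lemma measurable_heights: "heights \<in> measurable config_space config_space"
proof (rule measurable_config_spaceI)
  fix i
  have s: "(\<lambda>\<omega>::config. \<Sum>j\<in>{a..b}. \<omega> j) \<in> measurable config_space (count_space UNIV)" for a b :: int
    by (intro measurable_sum_int finite_atLeastAtMost_int measurable_config_coord)
  have "(\<lambda>\<omega>::config. - (\<Sum>j\<in>{1..i}. \<omega> j)) \<in> measurable config_space (count_space UNIV)"
    using measurable_compose[OF s[of 1 i], of uminus "count_space UNIV"] by simp
  with s show "(\<lambda>\<omega>. heights \<omega> i) \<in> measurable config_space (count_space UNIV)"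
    unfolding heights_def by (cases "0 \<le> i") simp_all
qed

lemma measurable_increments: "increments \<in> measurable config_space config_space"
proof (rule measurable_config_spaceI)
  fix i
  show "(\<lambda>h. increments h i) \<in> measurable config_space (count_space UNIV)"
    unfolding increments_def
    by (rule measurable_int_op[OF measurable_config_coord measurable_config_coord])
qed

text \<open>The two variables may have values in different types, so independence is phrased through
  their preimage families. It is used on rectangles, which determine the product measure.\<close>

lemma (in prob_space) distr_pair_indep_set:
  assumes X: "X \<in> measurable M S" and Y: "Y \<in> measurable M T"
    and indep: "indep_set {X -` A \<inter> space M | A. A \<in> sets S} {Y -` B \<inter> space M | B. B \<in> sets T}"
  shows "distr M S X \<Otimes>\<^sub>M distr M T Y = distr M (S \<Otimes>\<^sub>M T) (\<lambda>x. (X x, Y x))"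
proof (rule pair_measure_eqI)
  show "sigma_finite_measure (distr M S X)" "sigma_finite_measure (distr M T Y)"
    using X Y prob_space_distr prob_space_imp_sigma_finite by blast+
  fix A B assume "A \<in> sets (distr M S X)" "B \<in> sets (distr M T Y)"
  then have AB: "A \<in> sets S" "B \<in> sets T" by simp_all
  have "(\<lambda>x. (X x, Y x)) -` (A \<times> B) \<inter> space M = (X -` A \<inter> space M) \<inter> (Y -` B \<inter> space M)" by auto
  moreover have "prob ((X -` A \<inter> space M) \<inter> (Y -` B \<inter> space M)) =
      prob (X -` A \<inter> space M) * prob (Y -` B \<inter> space M)"
    using indep AB unfolding indep_sets2_eq by blast
  ultimately show "emeasure (distr M S X) A * emeasure (distr M T Y) B =
      emeasure (distr M (S \<Otimes>\<^sub>M T) (\<lambda>x. (X x, Y x))) (A \<times> B)"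
    using AB X Y by (simp add: emeasure_distr emeasure_eq_measure ennreal_mult)
qed (use X Y in simp)

section \<open>The stationary product measure\<close>

locale rate_function =
  fixes r :: "int \<Rightarrow> real"
  assumes r_pos: "0 < r z"
    and r_strict_mono: "strict_mono r"
    and r_symm: "r z * r (1 - z) = 1"
    and r_lim: "filterlim r at_top at_top"
begin

lemma r_mono: "mono r"
  using r_strict_mono by (rule strict_mono_mono)

section \<open>Site weights and the shift identity\<close>

definition site_weight :: "real \<Rightarrow> int \<Rightarrow> real" where
  "site_weight \<theta> z = exp (\<theta> * of_int z) / rate_fact r (nat \<bar>z\<bar>)"

lemma rate_fact_Suc: "rate_fact r (Suc n) = rate_fact r n * r (int (Suc n))"
  by (simp add: rate_fact_def)

lemma rate_fact_pos: "0 < rate_fact r n"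
  by (simp add: rate_fact_def prod_pos r_pos)

lemma site_weight_pos: "0 < site_weight \<theta> z"
  by (simp add: site_weight_def rate_fact_pos)

lemma site_weight_uminus: "site_weight \<theta> (- z) = site_weight (- \<theta>) z"
  by (simp add: site_weight_def)

text \<open>For z \<ge> 1 the factorial at z has the extra factor r z. For z \<le> 0 the factorial
  at z - 1 has the extra factor r (1 - z), and by the symmetry of r dividing by it is multiplying by
  r z.\<close>

lemma site_weight_shift: "r z * site_weight \<theta> z = exp \<theta> * site_weight \<theta> (z - 1)"
proof -
  have e: "exp (\<theta> * of_int z) = exp \<theta> * exp (\<theta> * of_int (z - 1))"
    by (simp add: exp_add[symmetric] algebra_simps)
  show ?thesis
  proof (cases "1 \<le> z")
    case True
    then have "nat \<bar>z\<bar> = Suc (nat \<bar>z - 1\<bar>)" "int (Suc (nat \<bar>z - 1\<bar>)) = z" by auto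
    then have "rate_fact r (nat \<bar>z\<bar>) = rate_fact r (nat \<bar>z - 1\<bar>) * r z"
      using rate_fact_Suc by metis
    then show ?thesis
      using r_pos[of z] rate_fact_pos[of "nat \<bar>z - 1\<bar>"]
      by (simp only: site_weight_def e) simp
  next
    case False
    then have "nat \<bar>z - 1\<bar> = Suc (nat \<bar>z\<bar>)" "int (Suc (nat \<bar>z\<bar>)) = 1 - z" by auto
    then have "rate_fact r (nat \<bar>z - 1\<bar>) = rate_fact r (nat \<bar>z\<bar>) * r (1 - z)"
      using rate_fact_Suc by metis
    moreover have "r z = 1 / r (1 - z)"
      using r_symm[of z] r_pos[of "1 - z"] by (simp add: field_simps)
    ultimately show ?thesis
      using r_pos[of "1 - z"] rate_fact_pos[of "nat \<bar>z\<bar>"]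
      by (simp only: site_weight_def e) (simp add: field_simps)
  qed
qed

lemma summable_site_weight_nat: "summable (\<lambda>n. site_weight \<theta> (int n))"
proof -
  \<comment> \<open>By the shift identity consecutive weights have ratio exp \<theta> / r (n + 1),
    so this threshold gives the ratio 1/2.\<close>
  have "eventually (\<lambda>z. 2 * exp \<theta> \<le> r z) at_top"
    using r_lim by (simp add: filterlim_at_top)
  then obtain Z where Z: "\<And>z. Z \<le> z \<Longrightarrow> 2 * exp \<theta> \<le> r z"
    by (auto simp: eventually_at_top_linorder)
  show ?thesis
  proof (rule summable_ratio_test[where c="1/2" and N="nat Z"])
    fix n assume "nat Z \<le> n"
    then have "2 * exp \<theta> * site_weight \<theta> (int (Suc n)) \<le> r (int (Suc n)) * site_weight \<theta> (int (Suc n))"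
      using site_weight_pos[of \<theta>] by (intro mult_right_mono Z) (auto intro: less_imp_le)
    also have "\<dots> = exp \<theta> * site_weight \<theta> (int n)"
      by (subst site_weight_shift) simp
    finally have "2 * site_weight \<theta> (int (Suc n)) \<le> site_weight \<theta> (int n)"
      by (simp add: mult.assoc)
    then show "norm (site_weight \<theta> (int (Suc n))) \<le> 1/2 * norm (site_weight \<theta> (int n))"
      using site_weight_pos[of \<theta>] by (simp add: abs_of_pos)
  qed simp
qed

lemma summable_on_site_weight: "site_weight \<theta> summable_on UNIV"
proof -
  have nat: "site_weight \<theta> summable_on range int" for \<theta>
    using summable_site_weight_nat[of \<theta>] less_imp_le[OF site_weight_pos]
    by (subst summable_on_reindex)
      (auto simp: o_def intro!: norm_summable_imp_summable_on)
  have "site_weight \<theta> summable_on range (\<lambda>n. - int n)"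
    using nat[of "- \<theta>"] by (simp add: summable_on_reindex inj_def o_def site_weight_uminus)
  then have "site_weight \<theta> summable_on (UNIV - range int)"
    by (rule summable_on_subset_banach) (auto, metis int_cases2 rangeI)
  then have "site_weight \<theta> summable_on (range int \<union> (UNIV - range int))"
    using nat[of \<theta>] by (intro summable_on_Un_disjoint) auto
  then show ?thesis by simp
qed

lemma partition_fun_eq: "partition_fun r \<theta> = infsum (site_weight \<theta>) UNIV"
  unfolding partition_fun_def site_weight_def ..

lemma nn_integral_site_weight:
  "(\<integral>\<^sup>+z. ennreal (site_weight \<theta> z) \<partial>count_space UNIV) = ennreal (partition_fun r \<theta>)"
proof -
  have "Infinite_Set_Sum.abs_summable_on (site_weight \<theta>) UNIV"
    using summable_on_site_weight less_imp_le[OF site_weight_pos]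
    by (metis abs_summable_equivalent summable_on_iff_abs_summable_on_real)
  then show ?thesis
    using less_imp_le[OF site_weight_pos]
    by (simp add: nn_integral_conv_infsetsum infsetsum_infsum partition_fun_eq)
qed

lemma partition_fun_pos: "0 < partition_fun r \<theta>"
proof -
  have "ennreal (site_weight \<theta> 0) \<le> (\<integral>\<^sup>+z. ennreal (site_weight \<theta> z) \<partial>count_space UNIV)"
    using nn_integral_ge_point[of 0 UNIV "\<lambda>z. ennreal (site_weight \<theta> z)"] by simp
  then show ?thesis
    using site_weight_pos[of \<theta> 0] unfolding nn_integral_site_weight
    by (metis ennreal_le_iff2 le_less_trans linorder_not_less)
qed

lemma site_measure_eq:
  "site_measure r \<theta> = density (count_space UNIV) (\<lambda>z. ennreal (site_weight \<theta> z / partition_fun r \<theta>))"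
  by (simp add: site_measure_def site_weight_def mult.commute)

lemma sets_site_measure [simp, measurable_cong]: "sets (site_measure r \<theta>) = sets (count_space UNIV)"
  by (simp add: site_measure_def)

lemma space_site_measure [simp]: "space (site_measure r \<theta>) = UNIV"
  by (simp add: site_measure_def)

lemma nn_integral_site_measure:
  "(\<integral>\<^sup>+z. f z \<partial>site_measure r \<theta>) =
    (\<integral>\<^sup>+z. ennreal (site_weight \<theta> z / partition_fun r \<theta>) * f z \<partial>count_space UNIV)"
  unfolding site_measure_eq by (rule nn_integral_density) auto

lemma prob_space_site_measure: "prob_space (site_measure r \<theta>)"
proof
  have "emeasure (site_measure r \<theta>) (space (site_measure r \<theta>)) = (\<integral>\<^sup>+z. 1 \<partial>site_measure r \<theta>)"
    by simp
  also have "\<dots> = (\<integral>\<^sup>+z. ennreal (1 / partition_fun r \<theta>) * ennreal (site_weight \<theta> z) \<partial>count_space UNIV)"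
    unfolding nn_integral_site_measure
    using partition_fun_pos[of \<theta>] site_weight_pos[of \<theta>]
    by (intro nn_integral_cong) (simp add: ennreal_mult[symmetric] less_imp_le)
  also have "\<dots> = 1"
    using partition_fun_pos[of \<theta>]
    by (simp add: nn_integral_cmult nn_integral_site_weight ennreal_mult[symmetric])
  finally show "emeasure (site_measure r \<theta>) (space (site_measure r \<theta>)) = 1" .
qed

text \<open>A factor r z is traded for a shift of the argument. With f = 1 this says that exp
  \<theta> is the mean of r, the origin of the boundary rates.\<close>

lemma site_measure_shift_up:
  "(\<integral>\<^sup>+z. ennreal (r z) * f z \<partial>site_measure r \<theta>) = ennreal (exp \<theta>) * (\<integral>\<^sup>+z. f (z + 1) \<partial>site_measure r \<theta>)"
proof -
  have "(\<integral>\<^sup>+z. ennreal (r z) * f z \<partial>site_measure r \<theta>) =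
      (\<integral>\<^sup>+z. ennreal (r z * site_weight \<theta> z / partition_fun r \<theta>) * f z \<partial>count_space UNIV)"
    unfolding nn_integral_site_measure
    using partition_fun_pos[of \<theta>] site_weight_pos[of \<theta>] r_pos
    by (intro nn_integral_cong) (simp add: ennreal_mult_assoc less_imp_le mult.commute[of "r _"])
  also have "\<dots> = (\<integral>\<^sup>+z. ennreal (exp \<theta> * site_weight \<theta> (z + 1 - 1) / partition_fun r \<theta>) * f (z + 1)
      \<partial>count_space UNIV)"
    unfolding site_weight_shift
    using nn_integral_count_space_shift[where a=1 and
      f="\<lambda>z. ennreal (exp \<theta> * site_weight \<theta> (z - 1) / partition_fun r \<theta>) * f z"] by simp
  also have "\<dots> = (\<integral>\<^sup>+z. ennreal (exp \<theta>) * (ennreal (site_weight \<theta> z / partition_fun r \<theta>) * f (z + 1))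
      \<partial>count_space UNIV)"
    using partition_fun_pos[of \<theta>] site_weight_pos[of \<theta>]
    by (intro nn_integral_cong) (simp add: ennreal_mult_assoc less_imp_le)
  also have "\<dots> = ennreal (exp \<theta>) * (\<integral>\<^sup>+z. f (z + 1) \<partial>site_measure r \<theta>)"
    by (simp add: nn_integral_cmult nn_integral_site_measure)
  finally show ?thesis .
qed

text \<open>Apart from the exponential the weights depend only on the absolute value, so reflection
  exchanges \<theta> and - \<theta>. This derives the downward shift from the upward one.\<close>

lemma site_measure_uminus:
  "(\<integral>\<^sup>+z. f z \<partial>site_measure r \<theta>) = (\<integral>\<^sup>+z. f (- z) \<partial>site_measure r (- \<theta>))"
proof -
  have bij: "bij_betw (\<lambda>z::int. - z) UNIV UNIV"
    by (rule bij_betwI[of _ _ _ uminus]) auto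
  have Z: "partition_fun r (- \<theta>) = partition_fun r \<theta>"
    unfolding partition_fun_eq site_weight_uminus[symmetric]
    using infsum_reindex_bij_betw[OF bij, of "site_weight \<theta>"] by simp
  show ?thesis
    unfolding nn_integral_site_measure Z site_weight_uminus[symmetric]
    using nn_integral_bij_count_space[OF bij,
      of "\<lambda>z. ennreal (site_weight \<theta> z / partition_fun r \<theta>) * f z"] by simp
qed

lemma site_measure_shift_down:
  "(\<integral>\<^sup>+z. ennreal (r (- z)) * f z \<partial>site_measure r \<theta>) =
    ennreal (exp (- \<theta>)) * (\<integral>\<^sup>+z. f (z - 1) \<partial>site_measure r \<theta>)"
  by (subst (1 2) site_measure_uminus) (simp add: site_measure_shift_up)

section \<open>Shifting one coordinate of the product measure\<close>

lemma sets_product_state: "sets (product_state r \<theta>) = sets config_space"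
  unfolding product_state_def config_space_def by (intro sets_PiM_cong) auto

lemma prob_space_product_state: "prob_space (product_state r \<theta>)"
  unfolding product_state_def by (intro prob_space_PiM prob_space_site_measure)

text \<open>Fubini with coordinate i isolated, so that a one-site identity applies while all other
  sites are frozen.\<close>

lemma nn_integral_product_state_split:
  assumes f: "f \<in> borel_measurable config_space"
  shows "(\<integral>\<^sup>+x. f x \<partial>product_state r \<theta>) =
    (\<integral>\<^sup>+X. (\<integral>\<^sup>+z. f (X(i := z)) \<partial>site_measure r \<theta>) \<partial>PiM (UNIV - {i}) (\<lambda>_. site_measure r \<theta>))"
proof -
  let ?S = "site_measure r \<theta>"
  let ?P = "PiM (UNIV - {i}) (\<lambda>_. ?S)"
  interpret S: prob_space ?S by (rule prob_space_site_measure)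
  interpret P: prob_space ?P by (intro prob_space_PiM prob_space_site_measure)
  interpret SP: pair_sigma_finite ?S ?P ..
  have eq: "distr (?S \<Otimes>\<^sub>M ?P) (PiM (insert i (UNIV - {i})) (\<lambda>_. ?S)) (\<lambda>(x, X). X(i := x)) =
      PiM (insert i (UNIV - {i})) (\<lambda>_. ?S)"
    by (intro distr_pair_PiM_eq_PiM prob_space_site_measure)
  have ins: "insert i (UNIV - {i}) = UNIV" by auto
  have eq': "product_state r \<theta> = distr (?S \<Otimes>\<^sub>M ?P) (PiM UNIV (\<lambda>_. ?S)) (\<lambda>(x, X). X(i := x))"
    using eq unfolding ins product_state_def by simp
  have m: "(\<lambda>(x, X). X(i := x)) \<in> measurable (?S \<Otimes>\<^sub>M ?P) (PiM UNIV (\<lambda>_. ?S))"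
    using measurable_fun_upd[of UNIV "UNIV - {i}" i snd "?S \<Otimes>\<^sub>M ?P" "\<lambda>_. ?S" fst]
    by (auto simp: case_prod_beta')
  have f': "f \<in> borel_measurable (PiM UNIV (\<lambda>_. ?S))"
    using f sets_product_state[of \<theta>] unfolding product_state_def
    by (simp cong: measurable_cong_sets)
  have mm: "(\<lambda>(x, X). f (X(i := x))) \<in> borel_measurable (?S \<Otimes>\<^sub>M ?P)"
    using measurable_compose[OF m f'] by (simp add: case_prod_beta')
  have "(\<integral>\<^sup>+x. f x \<partial>product_state r \<theta>) = (\<integral>\<^sup>+p. (\<lambda>(x, X). f (X(i := x))) p \<partial>(?S \<Otimes>\<^sub>M ?P))"
    unfolding eq' using f' by (subst nn_integral_distr[OF m]) (simp_all add: case_prod_beta' cong: measurable_cong_sets)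
  also have "\<dots> = (\<integral>\<^sup>+X. (\<integral>\<^sup>+z. f (X(i := z)) \<partial>?S) \<partial>?P)"
    using SP.nn_integral_snd[of "\<lambda>(x, X). f (X(i := x))"] mm by (simp add: case_prod_beta')
  finally show ?thesis .
qed

text \<open>Generic in the weight and the shift: r z comes with a = 1 and c = exp \<theta>, and r (-
  z) with a = -1 and c = exp (- \<theta>).\<close>

lemma product_state_shift:
  assumes site: "\<And>h. (\<integral>\<^sup>+z. ennreal (g z) * h z \<partial>site_measure r \<theta>) = ennreal c * (\<integral>\<^sup>+z. h (z + a) \<partial>site_measure r \<theta>)"
    and f: "f \<in> borel_measurable config_space"
  shows "(\<integral>\<^sup>+x. ennreal (g (x i)) * f x \<partial>product_state r \<theta>) =
    ennreal c * (\<integral>\<^sup>+x. f (x(i := x i + a)) \<partial>product_state r \<theta>)"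
proof -
  have m1: "(\<lambda>x. ennreal (g (x i)) * f x) \<in> borel_measurable config_space"
    using f measurable_compose[OF measurable_config_coord, of "\<lambda>z. ennreal (g z)" borel i] by simp
  have m2: "(\<lambda>x. f (x(i := x i + a))) \<in> borel_measurable config_space"
    using measurable_compose[OF measurable_config_shift f] .
  \<comment> \<open>Measurability in the remaining coordinates lets the constant c leave the outer
    integral.\<close>
  have "(\<lambda>X. \<integral>\<^sup>+z. f (X(i := z + a)) \<partial>site_measure r \<theta>) \<in>
      borel_measurable (PiM (UNIV - {i}) (\<lambda>_. site_measure r \<theta>))"
  proof -
    interpret S: prob_space "site_measure r \<theta>" by (rule prob_space_site_measure)
    have "(\<lambda>p. (fst p)(i := snd p + a)) \<in>
      measurable (PiM (UNIV - {i}) (\<lambda>_. site_measure r \<theta>) \<Otimes>\<^sub>M site_measure r \<theta>) config_space"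
    proof (rule measurable_config_spaceI)
      fix j
      show "(\<lambda>p. ((fst p)(i := snd p + a)) j) \<in>
        measurable (PiM (UNIV - {i}) (\<lambda>_. site_measure r \<theta>) \<Otimes>\<^sub>M site_measure r \<theta>) (count_space UNIV)"
      proof (cases "j = i")
        case True
        have "snd \<in> measurable (PiM (UNIV - {i}) (\<lambda>_. site_measure r \<theta>) \<Otimes>\<^sub>M site_measure r \<theta>) (count_space UNIV)"
          using measurable_snd[of "PiM (UNIV - {i}) (\<lambda>_. site_measure r \<theta>)" "site_measure r \<theta>"]
          by (simp cong: measurable_cong_sets)
        from measurable_compose[OF this, of "\<lambda>z. z + a"] True show ?thesis by simp
      next
        case False
        have "(\<lambda>p. fst p j) \<in> measurable (PiM (UNIV - {i}) (\<lambda>_. site_measure r \<theta>) \<Otimes>\<^sub>M site_measure r \<theta>)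
          (site_measure r \<theta>)" using False by (intro measurable_compose[OF measurable_fst measurable_component_singleton]) auto
        with False show ?thesis by (simp cong: measurable_cong_sets)
      qed
    qed
    from measurable_compose[OF this f]
    show ?thesis by (intro S.borel_measurable_nn_integral) (simp add: case_prod_beta')
  qed
  then show ?thesis
    by (simp add: nn_integral_product_state_split[OF m1, of \<theta> i] nn_integral_product_state_split[OF m2, of \<theta> i]
      site nn_integral_cmult)
qed

lemmas product_state_shift_up = product_state_shift[OF site_measure_shift_up]

lemma product_state_shift_down:
  assumes "f \<in> borel_measurable config_space"
  shows "(\<integral>\<^sup>+x. ennreal (r (- x i)) * f x \<partial>product_state r \<theta>) =
    ennreal (exp (- \<theta>)) * (\<integral>\<^sup>+x. f (x(i := x i - 1)) \<partial>product_state r \<theta>)"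
  using product_state_shift[where g="\<lambda>z. r (- z)" and c="exp (- \<theta>)" and a="- 1" and \<theta>=\<theta> and f=f and i=i] assms
  by (simp add: site_measure_shift_down)

end

section \<open>Sub-invariance of the killed dynamics\<close>

definition jump :: "int \<Rightarrow> config \<Rightarrow> config" where
  "jump i c = c(i := c i - 1, i + 1 := c (i + 1) + 1)"

lemma measurable_coord_fun [measurable]:
  "(\<lambda>c. ennreal (g (c i))) \<in> borel_measurable config_space"
  using measurable_compose[OF measurable_config_coord, of "\<lambda>z. ennreal (g z)" borel i] by simp

lemma measurable_jump [measurable]: "jump i \<in> measurable config_space config_space"
proof -
  have "jump i c = (c(i := c i + -1))(i + 1 := (c(i := c i + -1)) (i + 1) + 1)" for c
    by (simp add: jump_def)
  then have eq: "jump i = (\<lambda>c. c(i + 1 := c (i + 1) + 1)) \<circ> (\<lambda>c. c(i := c i + -1))"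
    by (simp add: fun_eq_iff)
  show ?thesis unfolding eq by (rule measurable_comp[OF measurable_config_shift measurable_config_shift])
qed

text \<open>The change of variables at i cancels the unit that the jump removes there, leaving only
  the unit added at i + 1. A jump at a bond thus becomes a shift at one of its ends.\<close>

lemma jump_shift_up: "jump i (x(i := x i + 1)) = x(i + 1 := x (i + 1) + 1)"
  by (auto simp: jump_def)

lemma jump_shift_down: "jump i (x(i + 1 := x (i + 1) - 1)) = x(i := x i - 1)"
  by (auto simp: jump_def)

definition window_local :: "int \<Rightarrow> int \<Rightarrow> (config \<Rightarrow> 'b) \<Rightarrow> bool" where
  "window_local L R \<phi> \<longleftrightarrow> (\<forall>c c'. (\<forall>j\<in>{L..R}. c j = c' j) \<longrightarrow> \<phi> c = \<phi> c')"

lemma window_localD: "window_local L R \<phi> \<Longrightarrow> (\<And>j. j \<in> {L..R} \<Longrightarrow> c j = c' j) \<Longrightarrow> \<phi> c = \<phi> c'"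
  unfolding window_local_def by blast

text \<open>
  A point lies in \<open>level V v\<close> iff \<open>v\<close> is the least element of \<open>V\<close> above it. For \<open>w\<close> in \<open>V\<close> a point
  of \<open>level V v\<close> is thus below \<open>w\<close> iff \<open>v \<le> w\<close>.
\<close>

definition level :: "real set \<Rightarrow> real \<Rightarrow> real set" where
  "level V v = {0<..<v} - (\<Union>u\<in>{u \<in> V. u < v}. {0<..<u})"

definition level_mass :: "real set \<Rightarrow> real \<Rightarrow> real" where
  "level_mass V v = measure lborel (level V v)"

lemma sets_level [measurable]: "finite V \<Longrightarrow> level V v \<in> sets borel"
  unfolding level_def by (intro sets.Diff sets.finite_UN) auto

lemma disjoint_level: "disjoint_family_on (level V) V"
  unfolding disjoint_family_on_def level_def
proof (intro ballI impI)
  fix v w assume "v \<in> V" "w \<in> V" "v \<noteq> w"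
  then show "({0<..<v} - (\<Union>u\<in>{u \<in> V. u < v}. {0<..<u})) \<inter>
      ({0<..<w} - (\<Union>u\<in>{u \<in> V. u < w}. {0<..<u})) = {}"
    by (cases v w rule: linorder_cases) auto
qed

lemma Union_level:
  assumes V: "finite V" and w: "w \<in> V"
  shows "(\<Union>v\<in>{v \<in> V. v \<le> w}. level V v) = {0<..<w}"
proof
  show "(\<Union>v\<in>{v \<in> V. v \<le> w}. level V v) \<subseteq> {0<..<w}"
    by (auto simp: level_def)
  show "{0<..<w} \<subseteq> (\<Union>v\<in>{v \<in> V. v \<le> w}. level V v)"
  proof
    fix y assume y: "y \<in> {0<..<w}"
    define U where "U = {u \<in> V. y < u}"
    have U: "finite U" "w \<in> U" using V w y by (auto simp: U_def)
    then have "Min U \<in> U" by (intro Min_in) auto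
    moreover have "Min U \<le> w" using U by simp
    moreover have "\<not> y < u" if "u \<in> V" "u < Min U" for u
    proof
      assume "y < u"
      with that have "u \<in> U" by (simp add: U_def)
      from Min_le[OF U(1) this] that show False by simp
    qed
    ultimately have "y \<in> level V (Min U)" "Min U \<in> V" "Min U \<le> w"
      using y by (auto simp: U_def level_def)
    then show "y \<in> (\<Union>v\<in>{v \<in> V. v \<le> w}. level V v)" by blast
  qed
qed

lemma level_mass_nonneg: "0 \<le> level_mass V v"
  by (simp add: level_mass_def)

text \<open>The levels up to w tile the interval below w, so the masses of the accepted levels add
  up to the rate itself.\<close>

lemma sum_level_mass_le:
  assumes V: "finite V" and w: "w \<in> V" "0 < w"
  shows "(\<Sum>v\<in>{v \<in> V. v \<le> w}. level_mass V v) = w"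
proof -
  have fin: "emeasure lborel (level V v) \<noteq> \<infinity>" for v
  proof -
    have "emeasure lborel (level V v) \<le> emeasure lborel {0..max 0 v}"
      using V by (intro emeasure_mono) (auto simp: level_def)
    then show ?thesis by (auto simp: top_unique)
  qed
  have "w = measure lborel {0<..<w}" using w by simp
  also have "\<dots> = (\<Sum>v\<in>{v \<in> V. v \<le> w}. level_mass V v)"
    unfolding Union_level[OF V w(1), symmetric] level_mass_def
    using V fin disjoint_level[of V]
    by (intro measure_finite_Union) (auto simp: disjoint_family_on_def)
  finally show ?thesis ..
qed

text \<open>
  \<open>None\<close> is a slab without points, \<open>Some (i, v)\<close> a slab whose only point belongs to bond \<open>i\<close> and
  level \<open>v\<close>. The weights of the outcomes add up to less than 1, the defect being the probability of
  two or more points.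
\<close>

type_synonym outcome = "(int \<times> real) option"

definition outcomes :: "int set \<Rightarrow> real set \<Rightarrow> outcome set" where
  "outcomes I V = insert None (Some ` (I \<times> V))"

lemma finite_outcomes: "finite I \<Longrightarrow> finite V \<Longrightarrow> finite (outcomes I V)"
  by (simp add: outcomes_def)

lemma sum_outcomes:
  assumes "finite I" "finite V"
  shows "(\<Sum>a\<in>outcomes I V. f a) = f None + (\<Sum>i\<in>I. \<Sum>v\<in>V. f (Some (i, v)))"
proof -
  have "(\<Sum>a\<in>outcomes I V. f a) = f None + (\<Sum>a\<in>Some ` (I \<times> V). f a)"
    unfolding outcomes_def using assms by (subst sum.insert) auto
  also have "(\<Sum>a\<in>Some ` (I \<times> V). f a) = (\<Sum>p\<in>I \<times> V. f (Some p))"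
    by (subst sum.reindex) (auto simp: inj_on_def)
  finally show ?thesis by (simp add: sum.cartesian_product case_prod_beta')
qed

text \<open>\<open>sum (level_mass V) V\<close> is the length covered by all levels, so this is the
  probability that no point falls into a slab of length d at any bond.\<close>

definition empty_weight :: "int set \<Rightarrow> real set \<Rightarrow> real \<Rightarrow> real" where
  "empty_weight I V d = exp (- (d * (real (card I) * sum (level_mass V) V)))"

text \<open>The cells, bond times level, hold independent Poisson counts: the occupied cell
  contributes its mean times an exponential, the others only exponentials, and all exponentials
  multiply to \<open>empty_weight\<close>.\<close>

definition outcome_weight :: "int set \<Rightarrow> real set \<Rightarrow> real \<Rightarrow> outcome \<Rightarrow> real" where
  "outcome_weight I V d a =
    (case a of None \<Rightarrow> 1 | Some (i, v) \<Rightarrow> d * level_mass V v) * empty_weight I V d"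

lemma empty_weight_pos: "0 < empty_weight I V d"
  by (simp add: empty_weight_def)

lemma outcome_weight_nonneg: "0 \<le> d \<Longrightarrow> 0 \<le> outcome_weight I V d a"
  by (auto simp: outcome_weight_def level_mass_nonneg empty_weight_pos less_imp_le split: option.split)

lemma sum_outcome_weight:
  assumes "finite I" "finite V"
  shows "(\<Sum>a\<in>outcomes I V. outcome_weight I V d a) =
    (1 + d * (real (card I) * sum (level_mass V) V)) * empty_weight I V d"
  unfolding sum_outcomes[OF assms]
  by (simp add: outcome_weight_def sum_distrib_left[symmetric] sum_distrib_right[symmetric] algebra_simps)

text \<open>With x the mean number of points this is (1 + x) exp (- x), the probability of at most
  one point.\<close>

lemma one_plus_empty_weight_le:
  "(1 + d * (real (card I) * sum (level_mass V) V)) * empty_weight I V d \<le> 1"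
proof -
  let ?x = "d * (real (card I) * sum (level_mass V) V)"
  have "(1 + ?x) * exp (- ?x) \<le> exp ?x * exp (- ?x)"
    by (intro mult_right_mono) (auto intro: exp_ge_add_one_self)
  then show ?thesis by (simp add: empty_weight_def mult_exp_exp)
qed

text \<open>The same move is kept in two versions because stationarity lives on increments, whereas
  the comparison with the monotone process lives on heights.\<close>

definition config_bump :: "(int \<Rightarrow> config \<Rightarrow> real) \<Rightarrow> outcome \<Rightarrow> config \<Rightarrow> config" where
  "config_bump q a c = (case a of None \<Rightarrow> c | Some (i, v) \<Rightarrow> if v \<le> q i c then jump i c else c)"

definition height_bump :: "(int \<Rightarrow> config \<Rightarrow> real) \<Rightarrow> outcome \<Rightarrow> (int \<Rightarrow> int) \<Rightarrow> int \<Rightarrow> int" where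
  "height_bump q a h =
    (case a of None \<Rightarrow> h | Some (i, v) \<Rightarrow> if v \<le> q i (increments h) then h(i := h i + 1) else h)"

lemma increments_height_bump: "increments (height_bump q a h) = config_bump q a (increments h)"
  by (auto simp: height_bump_def config_bump_def increments_jump jump_def split: option.split)

text \<open>The backward operator of one slab. It is sub-Markov: mass is lost where
  \<open>bd\<close> fails, and to slabs with two or more points, which are not among the
  outcomes.\<close>

definition transition ::
    "(config \<Rightarrow> bool) \<Rightarrow> (int \<Rightarrow> config \<Rightarrow> real) \<Rightarrow> int set \<Rightarrow> real set \<Rightarrow> real \<Rightarrow>
      (config \<Rightarrow> ennreal) \<Rightarrow> config \<Rightarrow> ennreal" where
  "transition bd q I V d \<phi> c =
    (if bd c then \<Sum>a\<in>outcomes I V. ennreal (outcome_weight I V d a) * \<phi> (config_bump q a c) else 0)"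

lemma sum_split_pred:
  fixes g :: "'b \<Rightarrow> 'c::comm_monoid_add"
  assumes "finite V"
  shows "sum g V = sum g {v \<in> V. P v} + sum g {v \<in> V. \<not> P v}"
proof -
  have "V = {v \<in> V. P v} \<union> {v \<in> V. \<not> P v}" by auto
  then show ?thesis
    using sum.union_disjoint[of "{v \<in> V. P v}" "{v \<in> V. \<not> P v}" g] assms by auto
qed

text \<open>At each bond the accepted levels have total mass q and the refused ones C - q, where C
  is the mass of all levels. Up to the prefactor the operator is therefore affine in the generator,
  whose loss term is hidden in C - q; this keeps every term nonnegative.\<close>

lemma transition_eq:
  assumes I: "finite I" and V: "finite V" "\<And>v. v \<in> V \<Longrightarrow> 0 < v" and d: "0 \<le> d"
    and bd: "bd c" and q: "\<And>i. i \<in> I \<Longrightarrow> q i c \<in> V"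
  shows "transition bd q I V d \<phi> c = ennreal (empty_weight I V d) *
    (\<phi> c + (\<Sum>i\<in>I. ennreal (d * (sum (level_mass V) V - q i c)) * \<phi> c
      + ennreal d * (ennreal (q i c) * \<phi> (jump i c))))"
proof -
  let ?e = "ennreal (empty_weight I V d)"
  have "(\<Sum>v\<in>V. ennreal (outcome_weight I V d (Some (i, v))) * \<phi> (config_bump q (Some (i, v)) c)) =
      ?e * (ennreal (d * (sum (level_mass V) V - q i c)) * \<phi> c
      + ennreal d * (ennreal (q i c) * \<phi> (jump i c)))" if i: "i \<in> I" for i
  proof -
    have low: "(\<Sum>v\<in>{v \<in> V. v \<le> q i c}. level_mass V v) = q i c"
      using V q[OF i] by (intro sum_level_mass_le) auto
    note split = sum_split_pred[OF V(1), where P="\<lambda>v. v \<le> q i c"]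
    have high: "(\<Sum>v\<in>{v \<in> V. \<not> v \<le> q i c}. level_mass V v) = sum (level_mass V) V - q i c"
      using split[of "level_mass V"] low by simp
    have w: "ennreal (outcome_weight I V d (Some (i, v))) = ?e * (ennreal d * ennreal (level_mass V v))" for v
      using d by (simp add: outcome_weight_def ennreal_mult level_mass_nonneg empty_weight_pos less_imp_le mult.commute)
    have "(\<Sum>v\<in>V. ennreal (outcome_weight I V d (Some (i, v))) * \<phi> (config_bump q (Some (i, v)) c)) =
        (\<Sum>v\<in>{v \<in> V. v \<le> q i c}. ?e * (ennreal d * ennreal (level_mass V v)) * \<phi> (jump i c)) +
        (\<Sum>v\<in>{v \<in> V. \<not> v \<le> q i c}. ?e * (ennreal d * ennreal (level_mass V v)) * \<phi> c)"
      unfolding split[of "\<lambda>v. ennreal (outcome_weight I V d (Some (i, v))) * \<phi> (config_bump q (Some (i, v)) c)"]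
      by (intro arg_cong2[where f="(+)"] sum.cong) (auto simp: config_bump_def w)
    also have "\<dots> = ?e * (ennreal d * ennreal (q i c)) * \<phi> (jump i c) +
        ?e * (ennreal d * ennreal (sum (level_mass V) V - q i c)) * \<phi> c"
      unfolding sum_distrib_right[symmetric] sum_distrib_left[symmetric]
      by (simp add: sum_ennreal level_mass_nonneg low high)
    finally show ?thesis
      using d by (simp add: ennreal_mult' distrib_left mult.assoc add.commute)
  qed
  then show ?thesis
    using bd unfolding transition_def sum_outcomes[OF I V(1)]
    by (simp add: config_bump_def[of _ None] outcome_weight_def[of _ _ _ None] sum_distrib_left distrib_left)
qed

section \<open>Stationarity of the window with boundary rates\<close>

definition bounded_on :: "int \<Rightarrow> int \<Rightarrow> nat \<Rightarrow> config \<Rightarrow> bool" where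
  "bounded_on L R K c \<longleftrightarrow> (\<forall>j\<in>{L..R}. \<bar>c j\<bar> \<le> int K)"

context rate_function
begin

text \<open>
  The bonds of the window \<open>{L..R}\<close> of sites are \<open>{L-1..R}\<close>, bond \<open>i\<close> joining \<open>i\<close> and \<open>i + 1\<close>;
  \<open>\<alpha>\<close> and \<open>\<beta>\<close> replace the rates contributed by the sites outside the window.
\<close>

definition boundary_rate :: "int \<Rightarrow> int \<Rightarrow> real \<Rightarrow> real \<Rightarrow> int \<Rightarrow> config \<Rightarrow> real" where
  "boundary_rate L R \<alpha> \<beta> i c =
    (if i < L then \<alpha> else r (c i)) + (if R \<le> i then \<beta> else r (- c (i + 1)))"

text \<open>Flux balance. The shift identity turns the r (c i) part after a jump at bond i into the
  r (c (i + 1)) part without the jump, which belongs to bond i + 1; the r (- c (i + 1)) part moves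
  to bond i - 1 in the same way. Each family is displaced by one bond, and the term leaving the
  window at one end matches the boundary rate at the other.\<close>

lemma sum_jump_rates:
  assumes \<phi>: "\<phi> \<in> borel_measurable config_space" and loc: "window_local L R \<phi>" and LR: "L \<le> R"
    and q: "q = boundary_rate L R (exp \<theta>) (exp (- \<theta>))"
  shows "(\<Sum>i\<in>{L-1..R}. \<integral>\<^sup>+c. ennreal (q i c) * \<phi> (jump i c) \<partial>product_state r \<theta>) =
    (\<Sum>i\<in>{L-1..R}. \<integral>\<^sup>+c. ennreal (q i c) * \<phi> c \<partial>product_state r \<theta>)"
proof -
  let ?\<mu> = "product_state r \<theta>"
  note [measurable_cong] = sets_product_state
  note \<phi>[measurable]
  define A where "A i c = (if i < L then exp \<theta> else r (c i))" for i and c :: config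
  define B where "B i c = (if R \<le> i then exp (- \<theta>) else r (- c (i + 1)))" for i and c :: config
  have nn: "0 \<le> A i c" "0 \<le> B i c" for i c using r_pos by (auto simp: A_def B_def less_imp_le)
  have mA [measurable]: "(\<lambda>c. ennreal (A i c)) \<in> borel_measurable config_space" for i
    unfolding A_def by (cases "i < L") auto
  have mB [measurable]: "(\<lambda>c. ennreal (B i c)) \<in> borel_measurable config_space" for i
    unfolding B_def using measurable_coord_fun[of "\<lambda>z. r (- z)" "i + 1"] by (cases "R \<le> i") auto
  have mj [measurable]: "(\<lambda>c. \<phi> (jump i c)) \<in> borel_measurable config_space" for i
    using measurable_compose[OF measurable_jump \<phi>] .
  have qAB: "ennreal (q i c) = ennreal (A i c) + ennreal (B i c)" for i c
    unfolding q boundary_rate_def A_def[symmetric] B_def[symmetric] by (simp add: nn)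
  have split: "(\<integral>\<^sup>+c. ennreal (q i c) * \<psi> c \<partial>?\<mu>) =
      (\<integral>\<^sup>+c. ennreal (A i c) * \<psi> c \<partial>?\<mu>) + (\<integral>\<^sup>+c. ennreal (B i c) * \<psi> c \<partial>?\<mu>)"
    if [measurable]: "\<psi> \<in> borel_measurable config_space" for i \<psi>
    unfolding qAB distrib_right by (subst nn_integral_add) auto
  define X where "X = (\<integral>\<^sup>+c. \<phi> c \<partial>?\<mu>)"
  define u where "u j = (\<integral>\<^sup>+c. ennreal (r (c j)) * \<phi> c \<partial>?\<mu>)" for j
  define w where "w j = (\<integral>\<^sup>+c. ennreal (r (- c j)) * \<phi> c \<partial>?\<mu>)" for j
  \<comment> \<open>At j = R + 1 the observable does not see the shift, and only its integral X
    remains.\<close>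
  have up: "ennreal (exp \<theta>) * (\<integral>\<^sup>+c. \<phi> (c(j := c j + 1)) \<partial>?\<mu>) =
      (if j \<in> {L..R} then u j else ennreal (exp \<theta>) * X)" for j
  proof (cases "j \<in> {L..R}")
    case True
    then show ?thesis using product_state_shift_up[OF \<phi>, where i=j and \<theta>=\<theta>] by (simp add: u_def)
  next
    case False
    then have "\<phi> (c(j := c j + 1)) = \<phi> c" for c
      by (intro window_localD[OF loc]) auto
    then show ?thesis unfolding X_def using False by auto
  qed
  have down: "ennreal (exp (- \<theta>)) * (\<integral>\<^sup>+c. \<phi> (c(j := c j - 1)) \<partial>?\<mu>) =
      (if j \<in> {L..R} then w j else ennreal (exp (- \<theta>)) * X)" for j
  proof (cases "j \<in> {L..R}")
    case True
    then show ?thesis using product_state_shift_down[OF \<phi>, where i=j and \<theta>=\<theta>] by (simp add: w_def)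
  next
    case False
    then have "\<phi> (c(j := c j - 1)) = \<phi> c" for c
      by (intro window_localD[OF loc]) auto
    then show ?thesis unfolding X_def using False by auto
  qed
  have Aj: "(\<integral>\<^sup>+c. ennreal (A i c) * \<phi> (jump i c) \<partial>?\<mu>) =
      (if i + 1 \<in> {L..R} then u (i + 1) else ennreal (exp \<theta>) * X)" if "i \<in> {L-1..R}" for i
    unfolding up[symmetric]
  proof (cases "i < L")
    case True
    then have "\<phi> (jump i c) = \<phi> (c(i + 1 := c (i + 1) + 1))" for c
      by (intro window_localD[OF loc]) (auto simp: jump_def)
    with True show "(\<integral>\<^sup>+c. ennreal (A i c) * \<phi> (jump i c) \<partial>?\<mu>) =
        ennreal (exp \<theta>) * (\<integral>\<^sup>+c. \<phi> (c(i + 1 := c (i + 1) + 1)) \<partial>?\<mu>)"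
      using measurable_compose[OF measurable_config_shift[of "i + 1" 1] \<phi>]
      by (simp add: A_def nn_integral_cmult cong: measurable_cong_sets)
  next
    case False
    then show "(\<integral>\<^sup>+c. ennreal (A i c) * \<phi> (jump i c) \<partial>?\<mu>) =
        ennreal (exp \<theta>) * (\<integral>\<^sup>+c. \<phi> (c(i + 1 := c (i + 1) + 1)) \<partial>?\<mu>)"
      using product_state_shift_up[OF mj[of i], where i=i and \<theta>=\<theta>] by (simp add: A_def jump_shift_up)
  qed
  have Bj: "(\<integral>\<^sup>+c. ennreal (B i c) * \<phi> (jump i c) \<partial>?\<mu>) =
      (if i \<in> {L..R} then w i else ennreal (exp (- \<theta>)) * X)" if "i \<in> {L-1..R}" for i
    unfolding down[symmetric]
  proof (cases "R \<le> i")
    case True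
    then have "\<phi> (jump i c) = \<phi> (c(i := c i - 1))" for c
      by (intro window_localD[OF loc]) (auto simp: jump_def)
    with True show "(\<integral>\<^sup>+c. ennreal (B i c) * \<phi> (jump i c) \<partial>?\<mu>) =
        ennreal (exp (- \<theta>)) * (\<integral>\<^sup>+c. \<phi> (c(i := c i - 1)) \<partial>?\<mu>)"
      using measurable_compose[OF measurable_config_shift[of i "- 1"] \<phi>]
      by (simp add: B_def nn_integral_cmult cong: measurable_cong_sets)
  next
    case False
    then show "(\<integral>\<^sup>+c. ennreal (B i c) * \<phi> (jump i c) \<partial>?\<mu>) =
        ennreal (exp (- \<theta>)) * (\<integral>\<^sup>+c. \<phi> (c(i := c i - 1)) \<partial>?\<mu>)"
      using product_state_shift_down[OF mj[of i], where i="i + 1" and \<theta>=\<theta>] by (simp add: B_def jump_shift_down)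
  qed
  have lo: "{L-1..R} = insert (L - 1) {L..R}" using LR by auto
  \<comment> \<open>Bonds are indexed by their right end sites here, which exhibits the displacement
    by one bond.\<close>
  have hi: "sum g {L-1..R} = sum (\<lambda>j. g (j - 1)) (insert (R + 1) {L..R})" for g :: "int \<Rightarrow> ennreal"
  proof -
    have "insert (R + 1) {L..R} = (\<lambda>i. i + 1) ` {L-1..R}"
      using LR by (auto simp: image_iff)
    then show ?thesis by (simp only:) (subst sum.reindex, auto simp: o_def)
  qed
  have "(\<Sum>i\<in>{L-1..R}. \<integral>\<^sup>+c. ennreal (A i c) * \<phi> (jump i c) \<partial>?\<mu>) = ennreal (exp \<theta>) * X + sum u {L..R}"
  proof -
    have "(\<Sum>i\<in>{L-1..R}. \<integral>\<^sup>+c. ennreal (A i c) * \<phi> (jump i c) \<partial>?\<mu>) =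
        (\<Sum>i\<in>{L-1..R}. if i + 1 \<in> {L..R} then u (i + 1) else ennreal (exp \<theta>) * X)"
      by (intro sum.cong Aj refl)
    also have "\<dots> = ennreal (exp \<theta>) * X + sum u {L..R}"
      unfolding hi by (subst sum.insert) auto
    finally show ?thesis .
  qed
  also have "\<dots> = (\<Sum>i\<in>{L-1..R}. \<integral>\<^sup>+c. ennreal (A i c) * \<phi> c \<partial>?\<mu>)"
    unfolding lo by (subst sum.insert) (auto simp: A_def u_def X_def nn_integral_cmult cong: measurable_cong_sets)
  finally have 1: "(\<Sum>i\<in>{L-1..R}. \<integral>\<^sup>+c. ennreal (A i c) * \<phi> (jump i c) \<partial>?\<mu>) =
    (\<Sum>i\<in>{L-1..R}. \<integral>\<^sup>+c. ennreal (A i c) * \<phi> c \<partial>?\<mu>)" .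
  have "(\<Sum>i\<in>{L-1..R}. \<integral>\<^sup>+c. ennreal (B i c) * \<phi> (jump i c) \<partial>?\<mu>) =
      (\<Sum>i\<in>{L-1..R}. if i \<in> {L..R} then w i else ennreal (exp (- \<theta>)) * X)"
    by (intro sum.cong Bj refl)
  also have "\<dots> = ennreal (exp (- \<theta>)) * X + sum w {L..R}"
    unfolding lo by (subst sum.insert) auto
  also have "\<dots> = (\<Sum>i\<in>{L-1..R}. \<integral>\<^sup>+c. ennreal (B i c) * \<phi> c \<partial>?\<mu>)"
    unfolding hi by (subst sum.insert) (auto simp: B_def w_def X_def nn_integral_cmult cong: measurable_cong_sets)
  finally have 2: "(\<Sum>i\<in>{L-1..R}. \<integral>\<^sup>+c. ennreal (B i c) * \<phi> (jump i c) \<partial>?\<mu>) =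
    (\<Sum>i\<in>{L-1..R}. \<integral>\<^sup>+c. ennreal (B i c) * \<phi> c \<partial>?\<mu>)" .
  show ?thesis
    unfolding split[OF mj] split[OF \<phi>] sum.distrib 1 2 ..
qed

lemma measurable_boundary_rate [measurable]:
  "(\<lambda>c. ennreal (boundary_rate L R \<alpha> \<beta> i c)) \<in> borel_measurable config_space"
proof -
  have "(\<lambda>c. boundary_rate L R \<alpha> \<beta> i c) \<in> measurable config_space (count_space UNIV)"
    unfolding boundary_rate_def
    using measurable_int_op[OF measurable_config_coord[of i] measurable_config_coord[of "i + 1"],
      of "\<lambda>a b. (if i < L then \<alpha> else r a) + (if R \<le> i then \<beta> else r (- b))"] by simp
  from measurable_compose[OF this, of ennreal borel] show ?thesis by simp
qed

text \<open>On \<open>bd\<close> the weights C - q and q recombine to C, so after the flux balance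
  the integrand is (1 + d m C) \<phi>, with m the number of bonds, and the prefactor brings this
  below \<phi>. Off \<open>bd\<close> the difference C - q may be cut off at 0; there \<phi> is 0 by
  assumption.\<close>

lemma nn_integral_transition_le:
  assumes \<phi>: "\<phi> \<in> borel_measurable config_space" "window_local L R \<phi>" "\<And>c. \<not> bd c \<Longrightarrow> \<phi> c = 0"
    and LR: "L \<le> R" and q: "q = boundary_rate L R (exp \<theta>) (exp (- \<theta>))"
    and V: "finite V" "\<And>v. v \<in> V \<Longrightarrow> 0 < v" and d: "0 \<le> d"
    and qV: "\<And>i c. bd c \<Longrightarrow> i \<in> {L-1..R} \<Longrightarrow> q i c \<in> V"
  shows "(\<integral>\<^sup>+c. transition bd q {L-1..R} V d \<phi> c \<partial>product_state r \<theta>) \<le> (\<integral>\<^sup>+c. \<phi> c \<partial>product_state r \<theta>)"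
proof -
  let ?\<mu> = "product_state r \<theta>" and ?I = "{L-1..R}"
  let ?e = "ennreal (empty_weight ?I V d)" and ?C = "sum (level_mass V) V"
  let ?m = "real (card ?I)"
  note [measurable_cong] = sets_product_state
  note \<phi>(1)[measurable]
  have mj [measurable]: "(\<lambda>c. \<phi> (jump i c)) \<in> borel_measurable config_space" for i
    using measurable_compose[OF measurable_jump \<phi>(1)] .
  have [measurable]: "(\<lambda>c. ennreal (q i c)) \<in> borel_measurable config_space" for i
    unfolding q by (rule measurable_boundary_rate)
  have [measurable]: "(\<lambda>c. ennreal (d * (?C - q i c))) \<in> borel_measurable config_space" for i
  proof -
    have "(\<lambda>c. q i c) \<in> measurable config_space (count_space UNIV)"
      unfolding q boundary_rate_def
      using measurable_int_op[OF measurable_config_coord[of i] measurable_config_coord[of "i + 1"],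
        of "\<lambda>a b. (if i < L then exp \<theta> else r a) + (if R \<le> i then exp (- \<theta>) else r (- b))"] by simp
    from measurable_compose[OF this, of "\<lambda>x. ennreal (d * (?C - x))" borel] show ?thesis by simp
  qed
  have qC: "q i c \<le> ?C" if "bd c" "i \<in> ?I" for i c
  proof -
    have "q i c = (\<Sum>v\<in>{v \<in> V. v \<le> q i c}. level_mass V v)"
      using V qV[OF that] by (intro sum_level_mass_le[symmetric]) auto
    also have "\<dots> \<le> ?C"
      using V by (intro sum_mono2) (auto simp: level_mass_nonneg)
    finally show ?thesis .
  qed
  have q0: "0 \<le> q i c" for i c
    unfolding q boundary_rate_def using r_pos by (auto intro!: add_nonneg_nonneg simp: less_imp_le)
  have C0: "0 \<le> ?C" by (intro sum_nonneg level_mass_nonneg)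
  \<comment> \<open>The flux balance concerns integrals over all configurations, so the restriction
    to \<open>bd\<close> is dropped first, at the cost of an inequality.\<close>
  have "(\<integral>\<^sup>+c. transition bd q ?I V d \<phi> c \<partial>?\<mu>) \<le>
      (\<integral>\<^sup>+c. ?e * (\<phi> c + ((\<Sum>i\<in>?I. ennreal (d * (?C - q i c)) * \<phi> c)
        + ennreal d * (\<Sum>i\<in>?I. ennreal (q i c) * \<phi> (jump i c)))) \<partial>?\<mu>)"
  proof (rule nn_integral_mono)
    fix c
    show "transition bd q ?I V d \<phi> c \<le> ?e * (\<phi> c + ((\<Sum>i\<in>?I. ennreal (d * (?C - q i c)) * \<phi> c)
        + ennreal d * (\<Sum>i\<in>?I. ennreal (q i c) * \<phi> (jump i c))))"
    proof (cases "bd c")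
      case True
      then show ?thesis
        by (subst transition_eq[OF _ V d]) (auto simp: qV sum.distrib sum_distrib_left)
    qed (simp add: transition_def)
  qed
  also have "\<dots> = ?e * ((\<integral>\<^sup>+c. \<phi> c + (\<Sum>i\<in>?I. ennreal (d * (?C - q i c)) * \<phi> c) \<partial>?\<mu>)
      + ennreal d * (\<Sum>i\<in>?I. \<integral>\<^sup>+c. ennreal (q i c) * \<phi> (jump i c) \<partial>?\<mu>))"
    by (simp add: nn_integral_cmult nn_integral_add nn_integral_sum add.assoc)
  also have "\<dots> = ?e * ((\<integral>\<^sup>+c. \<phi> c + (\<Sum>i\<in>?I. ennreal (d * (?C - q i c)) * \<phi> c) \<partial>?\<mu>)
      + ennreal d * (\<Sum>i\<in>?I. \<integral>\<^sup>+c. ennreal (q i c) * \<phi> c \<partial>?\<mu>))"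
    using sum_jump_rates[OF \<phi>(1,2) LR q] by simp
  also have "\<dots> = ?e * (\<integral>\<^sup>+c. \<phi> c + (\<Sum>i\<in>?I. ennreal (d * (?C - q i c)) * \<phi> c)
      + ennreal d * (\<Sum>i\<in>?I. ennreal (q i c) * \<phi> c) \<partial>?\<mu>)"
    by (simp add: nn_integral_cmult nn_integral_add nn_integral_sum)
  also have "\<dots> \<le> ?e * (\<integral>\<^sup>+c. ennreal (1 + d * (?m * ?C)) * \<phi> c \<partial>?\<mu>)"
  proof (intro mult_left_mono nn_integral_mono)
    fix c
    show "\<phi> c + (\<Sum>i\<in>?I. ennreal (d * (?C - q i c)) * \<phi> c)
        + ennreal d * (\<Sum>i\<in>?I. ennreal (q i c) * \<phi> c) \<le> ennreal (1 + d * (?m * ?C)) * \<phi> c"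
    proof (cases "bd c")
      case True
      have "(\<Sum>i\<in>?I. ennreal (d * (?C - q i c)) * \<phi> c) + ennreal d * (\<Sum>i\<in>?I. ennreal (q i c) * \<phi> c) =
          (\<Sum>i\<in>?I. ennreal (d * (?C - q i c)) + ennreal (d * q i c)) * \<phi> c"
        using d q0 by (simp add: sum.distrib sum_distrib_left sum_distrib_right distrib_right ennreal_mult mult.assoc)
      also have "(\<Sum>i\<in>?I. ennreal (d * (?C - q i c)) + ennreal (d * q i c)) = (\<Sum>i\<in>?I. ennreal (d * ?C))"
        using d q0 qC[OF True]
        by (intro sum.cong refl) (simp add: ennreal_plus[symmetric] right_diff_distrib mult_left_mono del: ennreal_plus)
      also have "\<dots> = ennreal (d * (?m * ?C))"
        using d C0 by (simp add: ennreal_of_nat_eq_real_of_nat ennreal_mult[symmetric] mult.left_commute del: card_atLeastAtMost_int)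
      finally show ?thesis
        using d C0 by (simp add: distrib_right add.assoc del: card_atLeastAtMost_int)
    qed (simp add: \<phi>(3))
  qed simp
  also have "\<dots> = ennreal (empty_weight ?I V d * (1 + d * (?m * ?C))) * (\<integral>\<^sup>+c. \<phi> c \<partial>?\<mu>)"
    using d C0 empty_weight_pos[of ?I V d]
    by (subst nn_integral_cmult) (auto simp: ennreal_mult mult.assoc less_imp_le simp del: card_atLeastAtMost_int)
  also have "\<dots> \<le> 1 * (\<integral>\<^sup>+c. \<phi> c \<partial>?\<mu>)"
    using one_plus_empty_weight_le[of d ?I V]
    by (intro mult_right_mono) (auto simp: mult.commute simp del: card_atLeastAtMost_int)
  finally show ?thesis by simp
qed

end

section \<open>Coupled chains\<close>

text \<open>
  \<open>Lower\<close> and \<open>Upper\<close> are stationary with parameters \<open>\<theta>\<^sub>1\<close> and \<open>\<theta>\<^sub>2\<close>; \<open>Monotone\<close> and \<open>Middle\<close> start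
  from the same configuration, without and with jumps at the boundary of the window.
\<close>

datatype process = Lower | Monotone | Middle | Upper

type_synonym state = "process \<Rightarrow> int \<Rightarrow> int"

locale coupled_processes = rate_function +
  fixes L R :: int and \<theta>\<^sub>1 \<theta>\<^sub>2 :: real
  assumes L_less_R: "L < R" and \<theta>_le: "\<theta>\<^sub>1 \<le> \<theta>\<^sub>2"
begin

abbreviation "bonds \<equiv> {L-1..R}"

text \<open>\<open>Middle\<close> mixes the parameters. The order of increments survives if its left
  boundary rate lies between \<open>exp \<theta>\<^sub>1\<close> and
  \<open>exp \<theta>\<^sub>2\<close> and its right one between
  \<open>exp (- \<theta>\<^sub>2)\<close> and \<open>exp (- \<theta>\<^sub>1)\<close>; the largest
  such values are taken.\<close>

fun rate :: "process \<Rightarrow> int \<Rightarrow> config \<Rightarrow> real" where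
  "rate Lower = boundary_rate L R (exp \<theta>\<^sub>1) (exp (- \<theta>\<^sub>1))"
| "rate Monotone = (\<lambda>i c. if L \<le> i \<and> i < R then r (c i) + r (- c (i + 1)) else 0)"
| "rate Middle = boundary_rate L R (exp \<theta>\<^sub>2) (exp (- \<theta>\<^sub>1))"
| "rate Upper = boundary_rate L R (exp \<theta>\<^sub>2) (exp (- \<theta>\<^sub>2))"

text \<open>Every positive rate at a configuration bounded by K is a left plus a right contribution
  from these finite sets, so one family of levels serves all four chains. The rate 0 of
  \<open>Monotone\<close> at the boundary bonds lies below all thresholds, hence no outcome is
  accepted there.\<close>

definition thresholds :: "nat \<Rightarrow> real set" where
  "thresholds K = (\<lambda>(a, b). a + b) `
    (({exp \<theta>\<^sub>1, exp \<theta>\<^sub>2} \<union> r ` {- int K..int K}) \<times> ({exp (- \<theta>\<^sub>1), exp (- \<theta>\<^sub>2)} \<union> r ` {- int K..int K}))"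

lemma finite_thresholds: "finite (thresholds K)"
  unfolding thresholds_def by (intro finite_imageI finite_SigmaI) auto

lemma thresholds_pos: "v \<in> thresholds K \<Longrightarrow> 0 < v"
  unfolding thresholds_def using r_pos by (auto intro!: add_pos_pos)

lemma thresholdsI:
  assumes "a \<in> {exp \<theta>\<^sub>1, exp \<theta>\<^sub>2} \<union> r ` {- int K..int K}"
    and "b \<in> {exp (- \<theta>\<^sub>1), exp (- \<theta>\<^sub>2)} \<union> r ` {- int K..int K}"
  shows "a + b \<in> thresholds K"
  unfolding thresholds_def using assms by (intro image_eqI[where x="(a, b)"]) auto

lemma rate_in_thresholds:
  assumes c: "bounded_on L R K c" and i: "i \<in> bonds" and p: "p = Monotone \<Longrightarrow> L \<le> i \<and> i < R"
  shows "rate p i c \<in> thresholds K"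
proof -
  have 1: "r (c i) \<in> r ` {- int K..int K}" if "\<not> i < L"
    using c that i by (intro imageI) (auto simp: bounded_on_def abs_le_iff dest!: bspec[where x=i])
  have 2: "r (- c (i + 1)) \<in> r ` {- int K..int K}" if "\<not> R \<le> i"
    using c that i by (intro imageI) (auto simp: bounded_on_def abs_le_iff dest!: bspec[where x="i + 1"])
  have 3: "boundary_rate L R \<alpha> \<beta> i c \<in> thresholds K"
    if "\<alpha> \<in> {exp \<theta>\<^sub>1, exp \<theta>\<^sub>2}" "\<beta> \<in> {exp (- \<theta>\<^sub>1), exp (- \<theta>\<^sub>2)}" for \<alpha> \<beta>
    unfolding boundary_rate_def by (rule thresholdsI) (use 1 2 that in auto)
  show ?thesis
  proof (cases "p = Monotone")
    case True
    then have "\<not> i < L" "\<not> R \<le> i" using p by auto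
    with 1 2 have "r (c i) + r (- c (i + 1)) \<in> thresholds K" by (intro thresholdsI UnI2)
    with True p show ?thesis by simp
  next
    case False
    then show ?thesis by (cases p) (auto intro!: 3)
  qed
qed

section \<open>Joint evolution of the four chains and its order\<close>

definition alive :: "nat \<Rightarrow> state \<Rightarrow> bool" where
  "alive K s \<longleftrightarrow> (\<forall>p. bounded_on L R K (increments (s p)))"

definition step :: "outcome \<Rightarrow> state \<Rightarrow> state" where
  "step a s p = height_bump (rate p) a (s p)"

definition jumped :: "process \<Rightarrow> int \<Rightarrow> outcome \<Rightarrow> state \<Rightarrow> bool" where
  "jumped p j a s \<longleftrightarrow> (\<exists>v. a = Some (j, v) \<and> v \<le> rate p j (increments (s p)))"

text \<open>Aliveness concerns all four processes at once, so their counts stop at the same slab and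
  remain comparable. A jump that leads out of the cut-off is still counted.\<close>

fun jumps :: "nat \<Rightarrow> process \<Rightarrow> int \<Rightarrow> state \<Rightarrow> outcome list \<Rightarrow> nat" where
  "jumps K p j s [] = 0"
| "jumps K p j s (a # as) =
    (if alive K s then of_bool (jumped p j a s) + jumps K p j (step a s) as else 0)"

text \<open>The increments of \<open>Monotone\<close> and \<open>Middle\<close> are not comparable:
  without boundary jumps, \<open>Monotone\<close> gains nothing at L and loses nothing at R. Only
  their heights are compared, and these can be, since additional jumps nearby raise the
  rates.\<close>

definition ordered :: "state \<Rightarrow> bool" where
  "ordered s \<longleftrightarrow> (\<forall>i. s Monotone i \<le> s Middle i) \<and>
    (\<forall>j\<in>{L..R}. increments (s Lower) j \<le> increments (s Middle) j \<and>
      increments (s Middle) j \<le> increments (s Upper) j)"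

lemma ordered_heightD: "ordered s \<Longrightarrow> s Monotone i \<le> s Middle i"
  unfolding ordered_def by blast

lemma ordered_incrementsD:
  assumes "ordered s" "j \<in> {L..R}"
  shows "increments (s Lower) j \<le> increments (s Middle) j"
    "increments (s Middle) j \<le> increments (s Upper) j"
  using assms unfolding ordered_def by blast+

lemma step_apply: "step a s p j = s p j + of_bool (jumped p j a s)"
  by (auto simp: step_def jumped_def height_bump_def split: option.split)

text \<open>
  If only one of two ordered configurations jumps, attractivity makes the ordering strict at the
  site where it could be lost.
\<close>

lemma config_bump_mono:
  assumes le: "\<And>j. j \<in> {L..R} \<Longrightarrow> c j \<le> c' j" and ab: "\<alpha> \<le> \<alpha>'" "\<beta>' \<le> \<beta>"
    and a: "\<And>i v. a = Some (i, v) \<Longrightarrow> i \<in> bonds" and j: "j \<in> {L..R}"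
  shows "config_bump (boundary_rate L R \<alpha> \<beta>) a c j \<le> config_bump (boundary_rate L R \<alpha>' \<beta>') a c' j"
proof (cases a)
  case None
  then show ?thesis using le[OF j] by (simp add: config_bump_def)
next
  case (Some q)
  then obtain i v where iv: "a = Some (i, v)" by (cases q) auto
  then have i: "i \<in> bonds" using a by blast
  have m: "r x \<le> r y" if "x \<le> y" for x y using monoD[OF r_mono that] .
  have 1: "boundary_rate L R \<alpha> \<beta> i c \<le> boundary_rate L R \<alpha>' \<beta>' i c'"
    if eq: "j = i + 1" "c j = c' j"
  proof -
    have "(if i < L then \<alpha> else r (c i)) \<le> (if i < L then \<alpha>' else r (c' i))"
      using ab(1) m[OF le[of i]] i by simp
    moreover have "\<not> R \<le> i" "c (i + 1) = c' (i + 1)" using eq j by auto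
    ultimately show ?thesis by (simp add: boundary_rate_def)
  qed
  have 2: "boundary_rate L R \<alpha>' \<beta>' i c' \<le> boundary_rate L R \<alpha> \<beta> i c"
    if eq: "j = i" "c j = c' j"
  proof -
    have "(if R \<le> i then \<beta>' else r (- c' (i + 1))) \<le> (if R \<le> i then \<beta> else r (- c (i + 1)))"
      using ab(2) m[of "- c' (i + 1)" "- c (i + 1)"] le[of "i + 1"] i by simp
    moreover have "\<not> i < L" "c i = c' i" using eq j by auto
    ultimately show ?thesis by (simp add: boundary_rate_def)
  qed
  have bump: "config_bump q a c j =
      c j - of_bool (j = i \<and> v \<le> q i c) + of_bool (j = i + 1 \<and> v \<le> q i c)" for q c
    by (simp add: iv config_bump_def jump_def)
  show ?thesis
  proof (cases "c j = c' j")
    case True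
    with 1 2 show ?thesis unfolding bump by (auto simp: of_bool_def)
  next
    case False
    with le[OF j] show ?thesis unfolding bump by (auto simp: of_bool_def)
  qed
qed

lemma ordered_step:
  assumes s: "ordered s" and a: "\<And>i v. a = Some (i, v) \<Longrightarrow> i \<in> bonds \<and> 0 < v"
  shows "ordered (step a s)"
  unfolding ordered_def
proof (intro conjI allI ballI)
  fix i
  have le: "s Monotone j \<le> s Middle j" for j using s by (simp add: ordered_def)
  show "step a s Monotone i \<le> step a s Middle i"
  proof (cases "s Monotone i = s Middle i \<and> jumped Monotone i a s")
    case True
    then obtain v where v: "a = Some (i, v)" "v \<le> rate Monotone i (increments (s Monotone))"
      by (auto simp: jumped_def)
    with a have "0 < v" by blast
    \<comment> \<open>At the two boundary bonds the rate of \<open>Monotone\<close> is 0, and no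
      positive level is accepted.\<close>
    with v have i: "L \<le> i" "i < R" by (auto split: if_splits)
    \<comment> \<open>Where the heights agree, the neighbours in \<open>Middle\<close> are at least
      as high, which makes both arguments of r at least as large.\<close>
    have "rate Monotone i (increments (s Monotone)) \<le> rate Middle i (increments (s Middle))"
      using i True le[of "i - 1"] le[of "i + 1"]
      by (auto simp: boundary_rate_def increments_def intro!: add_mono monoD[OF r_mono])
    with v have "jumped Middle i a s" by (auto simp: jumped_def)
    with True show ?thesis by (simp add: step_apply)
  next
    case False
    with le[of i] show ?thesis by (auto simp: step_apply)
  qed
next
  fix j assume j: "j \<in> {L..R}"
  show "increments (step a s Lower) j \<le> increments (step a s Middle) j"
    unfolding step_def increments_height_bump rate.simps
    using s a j \<theta>_le by (intro config_bump_mono) (auto simp: ordered_def)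
  show "increments (step a s Middle) j \<le> increments (step a s Upper) j"
    unfolding step_def increments_height_bump rate.simps
    using s a j \<theta>_le by (intro config_bump_mono) (auto simp: ordered_def)
qed

section \<open>Histories of outcomes and their weights\<close>

definition histories :: "nat \<Rightarrow> nat \<Rightarrow> outcome list set" where
  "histories K n = {as. set as \<subseteq> outcomes bonds (thresholds K) \<and> length as = n}"

lemma finite_histories: "finite (histories K n)"
  unfolding histories_def by (rule finite_lists_length_eq[OF finite_outcomes[OF _ finite_thresholds]]) simp

lemma outcomes_thresholdsD:
  "a \<in> outcomes bonds (thresholds K) \<Longrightarrow> a = Some (i, v) \<Longrightarrow> i \<in> bonds \<and> 0 < v"
  by (auto simp: outcomes_def thresholds_pos)

lemma ordered_step_outcome:
  assumes "ordered s" "a \<in> outcomes bonds (thresholds K)"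
  shows "ordered (step a s)"
  by (rule ordered_step[OF assms(1) outcomes_thresholdsD[OF assms(2)]])

text \<open>The heights enter so that the induction can move the starting state; from equal initial
  heights the inequality compares the counts themselves.\<close>

lemma jumps_Monotone_le_Middle:
  assumes "ordered s" "set as \<subseteq> outcomes bonds (thresholds K)"
  shows "s Monotone j + int (jumps K Monotone j s as) \<le> s Middle j + int (jumps K Middle j s as)"
  using assms
proof (induction as arbitrary: s)
  case Nil
  then show ?case using ordered_heightD[of s j] by simp
next
  case (Cons a as)
  have "ordered (step a s)"
    using Cons.prems(2) by (intro ordered_step_outcome[OF Cons.prems(1)]) auto
  from Cons.IH[OF this] Cons.prems(2)
  have "step a s Monotone j + int (jumps K Monotone j (step a s) as) \<le>
      step a s Middle j + int (jumps K Middle j (step a s) as)" by simp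
  moreover have "s Monotone j \<le> s Middle j" using Cons.prems(1) by (rule ordered_heightD)
  ultimately show ?case unfolding step_apply jumps.simps by (cases "alive K s") simp_all
qed

lemma sum_histories_Suc:
  "(\<Sum>as\<in>histories K (Suc n). f as) =
    (\<Sum>a\<in>outcomes bonds (thresholds K). \<Sum>as\<in>histories K n. f (a # as))"
proof -
  let ?O = "outcomes bonds (thresholds K)"
  have "inj_on (\<lambda>(as, a). a # as) (histories K n \<times> ?O)" by (auto simp: inj_on_def)
  then have "(\<Sum>as\<in>histories K (Suc n). f as) = (\<Sum>(as, a)\<in>histories K n \<times> ?O. f (a # as))"
    unfolding histories_def lists_length_Suc_eq
    by (subst sum.reindex) (auto simp: o_def case_prod_beta' intro!: sum.cong)
  then show ?thesis
    unfolding sum.cartesian_product[symmetric] by (simp only:) (rule sum.swap)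
qed

definition history_weight :: "nat \<Rightarrow> real \<Rightarrow> outcome list \<Rightarrow> real" where
  "history_weight K d as = prod_list (map (outcome_weight bonds (thresholds K) d) as)"

lemma history_weight_simps [simp]:
  "history_weight K d [] = 1"
  "history_weight K d (a # as) = outcome_weight bonds (thresholds K) d a * history_weight K d as"
  by (simp_all add: history_weight_def)

lemma history_weight_nonneg: "0 \<le> d \<Longrightarrow> 0 \<le> history_weight K d as"
  by (induction as) (auto simp: outcome_weight_nonneg)

lemma sum_history_weight:
  "(\<Sum>as\<in>histories K n. history_weight K d as) = (\<Sum>a\<in>outcomes bonds (thresholds K). outcome_weight bonds (thresholds K) d a) ^ n"
proof (induction n)
  case 0
  have "histories K 0 = {[]}" by (auto simp: histories_def)
  then show ?case by simp
next
  case (Suc n)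
  then show ?case
    by (simp add: sum_histories_Suc sum_distrib_left[symmetric] sum_distrib_right[symmetric])
qed

lemma sum_outcome_weight_le_1: "(\<Sum>a\<in>outcomes bonds (thresholds K). outcome_weight bonds (thresholds K) d a) \<le> 1"
  using one_plus_empty_weight_le[of d bonds "thresholds K"]
  by (subst sum_outcome_weight) (auto simp: finite_thresholds)

lemma sum_history_weight_le_1:
  assumes d: "0 \<le> d"
  shows "(\<Sum>as\<in>histories K n. ennreal (history_weight K d as)) \<le> 1"
proof -
  have "(\<Sum>a\<in>outcomes bonds (thresholds K). outcome_weight bonds (thresholds K) d a) ^ n \<le> 1"
    using d by (intro power_le_one sum_nonneg outcome_weight_nonneg sum_outcome_weight_le_1)
  then show ?thesis
    using d by (subst sum_ennreal) (auto simp: history_weight_nonneg sum_history_weight ennreal_le_1)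
qed

abbreviation transfer :: "nat \<Rightarrow> real \<Rightarrow> process \<Rightarrow> (config \<Rightarrow> ennreal) \<Rightarrow> config \<Rightarrow> ennreal" where
  "transfer K d p \<equiv> transition (bounded_on L R K) (rate p) bonds (thresholds K) d"

text \<open>The part of the bond rate decreasing in the configuration, times the slab length. It is
  evaluated along \<open>Lower\<close>, and its increasing counterpart \<open>right_rate\<close>
  along \<open>Upper\<close>; together they bound the rate of \<open>Middle\<close>.\<close>

definition left_rate :: "nat \<Rightarrow> real \<Rightarrow> int \<Rightarrow> config \<Rightarrow> ennreal" where
  "left_rate K d j c = (if bounded_on L R K c then ennreal (d * r (- c (j + 1))) else 0)"

definition right_rate :: "nat \<Rightarrow> real \<Rightarrow> int \<Rightarrow> config \<Rightarrow> ennreal" where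
  "right_rate K d j c = (if bounded_on L R K c then ennreal (d * r (c j)) else 0)"

lemma sum_weight_jumped:
  assumes "alive K s" and d: "0 \<le> d" and j: "L \<le> j" "j < R"
  shows "(\<Sum>a\<in>outcomes bonds (thresholds K). outcome_weight bonds (thresholds K) d a * of_bool (jumped Middle j a s))
    \<le> d * rate Middle j (increments (s Middle))"
proof -
  let ?V = "thresholds K" and ?q = "rate Middle j (increments (s Middle))"
  have q: "?q \<in> ?V"
    using assms by (intro rate_in_thresholds) (auto simp: alive_def)
  have jb: "j \<in> bonds" using j by auto
  have "(\<Sum>a\<in>outcomes bonds ?V. outcome_weight bonds ?V d a * of_bool (jumped Middle j a s)) =
      (\<Sum>i\<in>bonds. \<Sum>v\<in>?V. outcome_weight bonds ?V d (Some (i, v)) * of_bool (jumped Middle j (Some (i, v)) s))"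
    by (subst sum_outcomes) (auto simp: finite_thresholds jumped_def)
  also have "\<dots> = (\<Sum>v\<in>?V. outcome_weight bonds ?V d (Some (j, v)) * of_bool (v \<le> ?q))"
  proof -
    have "(\<Sum>v\<in>?V. outcome_weight bonds ?V d (Some (i, v)) * of_bool (jumped Middle j (Some (i, v)) s)) =
        (if i = j then \<Sum>v\<in>?V. outcome_weight bonds ?V d (Some (j, v)) * of_bool (v \<le> ?q) else 0)" for i
      by (auto simp: jumped_def intro!: sum.cong sum.neutral)
    then show ?thesis using jb by simp
  qed
  also have "\<dots> = (\<Sum>v\<in>{v \<in> ?V. v \<le> ?q}. level_mass ?V v) * (d * empty_weight bonds ?V d)"
    unfolding sum.inter_filter[OF finite_thresholds] sum_distrib_right
    by (intro sum.cong refl) (simp add: outcome_weight_def)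
  also have "\<dots> = ?q * (d * empty_weight bonds ?V d)"
    using q finite_thresholds thresholds_pos by (subst sum_level_mass_le) auto
  also have "\<dots> \<le> ?q * (d * 1)"
    using d thresholds_pos[OF q] sum_nonneg[of ?V "level_mass ?V"]
    by (intro mult_left_mono) (auto simp: empty_weight_def level_mass_nonneg intro!: mult_nonneg_nonneg)
  finally show ?thesis by (simp add: mult.commute)
qed

text \<open>Markov property by peeling off the first slab: a jump in it gives the term k = 0 through
  the order of increments, and the remaining n slabs start from another ordered state and give the
  terms with k raised by one.\<close>

lemma expected_jumps_le:
  assumes d: "0 \<le> d" and j: "L \<le> j" "j < R" and s: "ordered s"
  shows "(\<Sum>as\<in>histories K n. ennreal (history_weight K d as) * of_nat (jumps K Middle j s as)) \<le>
    (\<Sum>k<n. (transfer K d Lower ^^ k) (left_rate K d j) (increments (s Lower)) +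
      (transfer K d Upper ^^ k) (right_rate K d j) (increments (s Upper)))"
  using s
proof (induction n arbitrary: s)
  case 0
  have "histories K 0 = {[]}" by (auto simp: histories_def)
  then show ?case by simp
next
  case (Suc n)
  let ?O = "outcomes bonds (thresholds K)"
  let ?w = "\<lambda>a. ennreal (outcome_weight bonds (thresholds K) d a)"
  let ?h = "\<lambda>as. ennreal (history_weight K d as)"
  let ?F = "\<lambda>k s. (transfer K d Lower ^^ k) (left_rate K d j) (increments (s Lower)) +
      (transfer K d Upper ^^ k) (right_rate K d j) (increments (s Upper))"
  have eq: "(\<Sum>as\<in>histories K (Suc n). ?h as * of_nat (jumps K Middle j s as)) =
      (\<Sum>a\<in>?O. \<Sum>as\<in>histories K n. ?w a * ?h as * of_nat (jumps K Middle j s (a # as)))"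
    unfolding sum_histories_Suc using d
    by (simp add: ennreal_mult outcome_weight_nonneg history_weight_nonneg)
  show ?case
  proof (cases "alive K s")
    case False
    then show ?thesis unfolding eq by simp
  next
    case True
    then have bd: "bounded_on L R K (increments (s p))" for p by (simp add: alive_def)
    have "(\<Sum>as\<in>histories K (Suc n). ?h as * of_nat (jumps K Middle j s as)) =
        (\<Sum>a\<in>?O. ?w a * of_bool (jumped Middle j a s) * (\<Sum>as\<in>histories K n. ?h as) +
          ?w a * (\<Sum>as\<in>histories K n. ?h as * of_nat (jumps K Middle j (step a s) as)))"
      unfolding eq
    proof (rule sum.cong[OF refl])
      fix a
      have "(\<Sum>as\<in>histories K n. ?w a * ?h as * of_nat (jumps K Middle j s (a # as))) =
          (\<Sum>as\<in>histories K n. ?w a * of_bool (jumped Middle j a s) * ?h as +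
            ?w a * (?h as * of_nat (jumps K Middle j (step a s) as)))"
        using True by (intro sum.cong refl) (simp add: distrib_left mult.assoc mult.commute[of "?h _"])
      then show "(\<Sum>as\<in>histories K n. ?w a * ?h as * of_nat (jumps K Middle j s (a # as))) =
          ?w a * of_bool (jumped Middle j a s) * (\<Sum>as\<in>histories K n. ?h as) +
          ?w a * (\<Sum>as\<in>histories K n. ?h as * of_nat (jumps K Middle j (step a s) as))"
        by (simp only: sum.distrib sum_distrib_left)
    qed
    \<comment> \<open>For a jump in the first slab the later outcomes are summed out; their weights
      add up to at most 1.\<close>
    also have "\<dots> \<le> (\<Sum>a\<in>?O. ?w a * of_bool (jumped Middle j a s) * 1 + ?w a * (\<Sum>k<n. ?F k (step a s)))"
    proof (intro sum_mono add_mono mult_left_mono)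
      show "(\<Sum>as\<in>histories K n. ?h as) \<le> 1" using sum_history_weight_le_1[OF d] .
      fix a assume "a \<in> ?O"
      then have "ordered (step a s)"
        by (rule ordered_step_outcome[OF Suc.prems])
      then show "(\<Sum>as\<in>histories K n. ?h as * of_nat (jumps K Middle j (step a s) as)) \<le> (\<Sum>k<n. ?F k (step a s))"
        by (rule Suc.IH)
    qed auto
    also have "\<dots> = (\<Sum>a\<in>?O. ?w a * of_bool (jumped Middle j a s)) + (\<Sum>k<n. \<Sum>a\<in>?O. ?w a * ?F k (step a s))"
    proof -
      have "(\<Sum>a\<in>?O. ?w a * (\<Sum>k<n. ?F k (step a s))) = (\<Sum>k<n. \<Sum>a\<in>?O. ?w a * ?F k (step a s))"
        unfolding sum_distrib_left by (rule sum.swap)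
      then show ?thesis by (subst sum.distrib) (simp only: mult_1_right)
    qed
    \<comment> \<open>The increments of each process evolve autonomously, so averaging over the
      first outcome is one more application of its transfer operator.\<close>
    also have "(\<Sum>k<n. \<Sum>a\<in>?O. ?w a * ?F k (step a s)) = (\<Sum>k<n. ?F (Suc k) s)"
      using bd by (intro sum.cong refl)
        (simp add: transition_def step_def increments_height_bump distrib_left sum.distrib del: rate.simps)
    also have "(\<Sum>a\<in>?O. ?w a * of_bool (jumped Middle j a s)) \<le> ?F 0 s"
    proof -
      have "(\<Sum>a\<in>?O. ?w a * of_bool (jumped Middle j a s)) =
          (\<Sum>a\<in>?O. ennreal (outcome_weight bonds (thresholds K) d a * of_bool (jumped Middle j a s)))"
        by (intro sum.cong) auto
      also have "\<dots> = ennreal (\<Sum>a\<in>?O. outcome_weight bonds (thresholds K) d a * of_bool (jumped Middle j a s))"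
        using d by (intro sum_ennreal) (auto simp: outcome_weight_nonneg)
      also have "\<dots> \<le> ennreal (d * rate Middle j (increments (s Middle)))"
        by (intro ennreal_leI sum_weight_jumped True d j)
      also have "\<dots> \<le> ennreal (d * r (- increments (s Lower) (j + 1)) + d * r (increments (s Upper) j))"
      proof -
        have "increments (s Lower) (j + 1) \<le> increments (s Middle) (j + 1)"
          "increments (s Middle) j \<le> increments (s Upper) j"
          using j by (auto intro!: ordered_incrementsD[OF Suc.prems])
        then have "r (- increments (s Middle) (j + 1)) \<le> r (- increments (s Lower) (j + 1))"
          "r (increments (s Middle) j) \<le> r (increments (s Upper) j)"
          by (auto intro!: monoD[OF r_mono])
        then have "d * rate Middle j (increments (s Middle)) \<le>
            d * (r (- increments (s Lower) (j + 1)) + r (increments (s Upper) j))"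
          using d j by (intro mult_left_mono) (auto simp: boundary_rate_def)
        then show ?thesis by (intro ennreal_leI) (simp add: distrib_left)
      qed
      also have "\<dots> = ?F 0 s"
        using d bd r_pos by (simp add: left_rate_def right_rate_def less_imp_le)
      finally show ?thesis .
    qed
    finally show ?thesis
      by (subst sum.lessThan_Suc_shift) (simp add: add_right_mono)
  qed
qed

section \<open>Observables of the window under iterated transfer\<close>

lemma measurable_rate: "rate p i \<in> measurable config_space (count_space UNIV)"
proof -
  \<comment> \<open>A rate reads only the two sites of its bond; the rewriting makes it a function
    of two integers.\<close>
  have eq: "rate p i = (\<lambda>c. rate p i (\<lambda>j. if j = i then c i else c (i + 1)))"
    by (cases p) (auto simp: boundary_rate_def fun_eq_iff)
  show ?thesis
    by (subst eq) (rule measurable_int_op[OF measurable_config_coord[of i] measurable_config_coord[of "i + 1"],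
      of "\<lambda>a b. rate p i (\<lambda>j. if j = i then a else b)"])
qed

lemma measurable_bounded_on [measurable]: "Measurable.pred config_space (bounded_on L R K)"
  unfolding bounded_on_def by measurable

lemma measurable_config_bump [measurable]: "config_bump (rate p) a \<in> measurable config_space config_space"
proof (cases a)
  case None
  then show ?thesis by (simp add: config_bump_def[abs_def])
next
  case (Some q)
  have "Measurable.pred config_space (\<lambda>c. snd q \<le> rate p (fst q) c)"
    using measurable_compose[OF measurable_rate, of "\<lambda>x. snd q \<le> x" "count_space UNIV"] by simp
  then show ?thesis
    using Some by (auto simp: config_bump_def[abs_def] case_prod_beta' intro!: measurable_If)
qed

lemma window_local_config_bump:
  assumes "\<And>j. j \<in> {L..R} \<Longrightarrow> c j = c' j" and a: "a \<in> outcomes bonds V" and p: "p \<noteq> Monotone" and j: "j \<in> {L..R}"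
  shows "config_bump (rate p) a c j = config_bump (rate p) a c' j"
proof -
  have "rate p i c = rate p i c'" if "i \<in> bonds" for i
    using that p assms(1) by (cases p) (auto simp: boundary_rate_def)
  then show ?thesis
    using a assms(1)[OF j] by (auto simp: config_bump_def jump_def outcomes_def)
qed

text \<open>These are the conditions on the observable in \<open>nn_integral_transition_le\<close>,
  bundled because \<open>transfer\<close> preserves them and can then be iterated.\<close>

definition window_observable :: "nat \<Rightarrow> (config \<Rightarrow> ennreal) \<Rightarrow> bool" where
  "window_observable K \<phi> \<longleftrightarrow> \<phi> \<in> borel_measurable config_space \<and> window_local L R \<phi> \<and>
    (\<forall>c. \<not> bounded_on L R K c \<longrightarrow> \<phi> c = 0)"

lemma window_observable_transfer:
  assumes "window_observable K \<phi>" and p: "p \<noteq> Monotone"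
  shows "window_observable K (transfer K d p \<phi>)"
proof -
  have [measurable]: "\<phi> \<in> borel_measurable config_space" and loc: "window_local L R \<phi>"
    using assms by (auto simp: window_observable_def)
  have "transfer K d p \<phi> \<in> borel_measurable config_space"
    unfolding transition_def[abs_def] by measurable
  moreover have "window_local L R (transfer K d p \<phi>)"
    unfolding window_local_def
  proof (intro allI impI)
    fix c c' :: config assume eq: "\<forall>j\<in>{L..R}. c j = c' j"
    have "bounded_on L R K c = bounded_on L R K c'" using eq by (auto simp: bounded_on_def)
    moreover have "\<phi> (config_bump (rate p) a c) = \<phi> (config_bump (rate p) a c')"
      if "a \<in> outcomes bonds (thresholds K)" for a
      using eq by (intro window_localD[OF loc] window_local_config_bump[OF _ that p]) auto
    ultimately show "transfer K d p \<phi> c = transfer K d p \<phi> c'"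
      by (simp add: transition_def)
  qed
  ultimately show ?thesis by (simp add: window_observable_def transition_def)
qed

lemma window_observable_power:
  assumes "window_observable K \<phi>" "p \<noteq> Monotone"
  shows "window_observable K ((transfer K d p ^^ k) \<phi>)"
  using assms by (induction k) (auto intro: window_observable_transfer)

lemma nn_integral_transfer_power_le:
  assumes \<phi>: "window_observable K \<phi>" and d: "0 \<le> d" and p: "p \<noteq> Monotone"
    and \<theta>: "rate p = boundary_rate L R (exp \<theta>) (exp (- \<theta>))"
  shows "(\<integral>\<^sup>+c. (transfer K d p ^^ k) \<phi> c \<partial>product_state r \<theta>) \<le> (\<integral>\<^sup>+c. \<phi> c \<partial>product_state r \<theta>)"
proof (induction k)
  case (Suc k)
  have obs: "window_observable K ((transfer K d p ^^ k) \<phi>)"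
    by (rule window_observable_power[OF \<phi> p])
  have "(\<integral>\<^sup>+c. transfer K d p ((transfer K d p ^^ k) \<phi>) c \<partial>product_state r \<theta>) \<le>
      (\<integral>\<^sup>+c. (transfer K d p ^^ k) \<phi> c \<partial>product_state r \<theta>)"
    using obs L_less_R finite_thresholds thresholds_pos d p
    by (intro nn_integral_transition_le[OF _ _ _ _ \<theta>])
      (auto simp: window_observable_def intro!: rate_in_thresholds)
  with Suc show ?case by simp
qed simp

lemma window_observable_left_rate:
  assumes "L \<le> j" "j < R"
  shows "window_observable K (left_rate K d j)"
proof -
  have m: "(\<lambda>c. ennreal (d * r (- c (j + 1)))) \<in> borel_measurable config_space"
    using measurable_coord_fun[of "\<lambda>z. d * r (- z)" "j + 1"] by simp
  have "left_rate K d j \<in> borel_measurable config_space"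
    unfolding left_rate_def[abs_def] using m by measurable
  moreover have "window_local L R (left_rate K d j)"
    using assms by (auto simp: window_local_def left_rate_def bounded_on_def)
  ultimately show ?thesis by (simp add: window_observable_def left_rate_def)
qed

lemma window_observable_right_rate:
  assumes "L \<le> j" "j < R"
  shows "window_observable K (right_rate K d j)"
proof -
  have m: "(\<lambda>c. ennreal (d * r (c j))) \<in> borel_measurable config_space"
    using measurable_coord_fun[of "\<lambda>z. d * r z" j] by simp
  have "right_rate K d j \<in> borel_measurable config_space"
    unfolding right_rate_def[abs_def] using m by measurable
  moreover have "window_local L R (right_rate K d j)"
    using assms by (auto simp: window_local_def right_rate_def bounded_on_def)
  ultimately show ?thesis by (simp add: window_observable_def right_rate_def)
qed

lemma nn_integral_left_rate_le:
  assumes "0 \<le> d"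
  shows "(\<integral>\<^sup>+c. left_rate K d j c \<partial>product_state r \<theta>) \<le> ennreal (d * exp (- \<theta>))"
proof -
  interpret prob_space "product_state r \<theta>" by (rule prob_space_product_state)
  note [measurable_cong] = sets_product_state
  have m [measurable]: "(\<lambda>c. ennreal (r (- c (j + 1)))) \<in> borel_measurable config_space"
    using measurable_coord_fun[of "\<lambda>z. r (- z)" "j + 1"] by simp
  have "(\<integral>\<^sup>+c. left_rate K d j c \<partial>product_state r \<theta>) \<le>
      (\<integral>\<^sup>+c. ennreal d * ennreal (r (- c (j + 1))) \<partial>product_state r \<theta>)"
    using assms by (intro nn_integral_mono) (auto simp: left_rate_def ennreal_mult')
  also have "\<dots> = ennreal d * ennreal (exp (- \<theta>))"
    using product_state_shift_down[where f="\<lambda>_. 1" and i="j + 1" and \<theta>=\<theta>] emeasure_space_1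
    by (subst nn_integral_cmult) auto
  finally show ?thesis using assms by (simp add: ennreal_mult')
qed

lemma nn_integral_right_rate_le:
  assumes "0 \<le> d"
  shows "(\<integral>\<^sup>+c. right_rate K d j c \<partial>product_state r \<theta>) \<le> ennreal (d * exp \<theta>)"
proof -
  interpret prob_space "product_state r \<theta>" by (rule prob_space_product_state)
  note [measurable_cong] = sets_product_state
  have m [measurable]: "(\<lambda>c. ennreal (r (c j))) \<in> borel_measurable config_space"
    using measurable_coord_fun[of r j] by simp
  have "(\<integral>\<^sup>+c. right_rate K d j c \<partial>product_state r \<theta>) \<le>
      (\<integral>\<^sup>+c. ennreal d * ennreal (r (c j)) \<partial>product_state r \<theta>)"
    using assms by (intro nn_integral_mono) (auto simp: right_rate_def ennreal_mult')
  also have "\<dots> = ennreal d * ennreal (exp \<theta>)"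
    using product_state_shift_up[where f="\<lambda>_. 1" and i=j and \<theta>=\<theta>] emeasure_space_1
    by (subst nn_integral_cmult) auto
  finally show ?thesis using assms by (simp add: ennreal_mult')
qed

section \<open>Averaging over the coupled triple\<close>

fun initial_state :: "config \<times> config \<times> config \<Rightarrow> state" where
  "initial_state (\<eta>, \<zeta>, \<xi>) p = heights (case p of Lower \<Rightarrow> \<eta> | Monotone \<Rightarrow> \<zeta> | Middle \<Rightarrow> \<zeta> | Upper \<Rightarrow> \<xi>)"

lemma ordered_initial_state:
  assumes "\<And>i. \<eta> i \<le> \<zeta> i \<and> \<zeta> i \<le> \<xi> i"
  shows "ordered (initial_state (\<eta>, \<zeta>, \<xi>))"
  using assms by (simp add: ordered_def increments_heights)

definition expected_jumps :: "nat \<Rightarrow> real \<Rightarrow> nat \<Rightarrow> int \<Rightarrow> state \<Rightarrow> ennreal" where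
  "expected_jumps K d n j s =
    (\<Sum>as\<in>histories K n. ennreal (history_weight K d as) * of_nat (jumps K Monotone j s as))"

text \<open>The pointwise bound is a function of \<eta> plus a function of \<xi>. Hence only the two
  stationary marginals of \<kappa> are integrated, and the joint law enters just through the almost
  sure order. Sub-invariance removes the iterates, so every slab costs the same.\<close>

lemma nn_integral_expected_jumps_le:
  assumes d: "0 \<le> d" and j: "L \<le> j" "j < R"
    and sets: "sets \<kappa> = sets (config_space \<Otimes>\<^sub>M config_space \<Otimes>\<^sub>M config_space)"
    and lower: "distr \<kappa> config_space (\<lambda>(\<eta>, \<zeta>, \<xi>). \<eta>) = product_state r \<theta>\<^sub>1"
    and upper: "distr \<kappa> config_space (\<lambda>(\<eta>, \<zeta>, \<xi>). \<xi>) = product_state r \<theta>\<^sub>2"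
    and AE: "AE (\<eta>, \<zeta>, \<xi>) in \<kappa>. \<forall>i. \<eta> i \<le> \<zeta> i \<and> \<zeta> i \<le> \<xi> i"
  shows "(\<integral>\<^sup>+x. expected_jumps K d n j (initial_state x) \<partial>\<kappa>) \<le>
    ennreal (real n * d * (exp \<theta>\<^sub>2 + exp (- \<theta>\<^sub>1)))"
proof -
  note [measurable_cong] = sets
  let ?F = "\<lambda>k. (transfer K d Lower ^^ k) (left_rate K d j)"
  let ?G = "\<lambda>k. (transfer K d Upper ^^ k) (right_rate K d j)"
  have F: "window_observable K (?F k)" for k
    by (rule window_observable_power[OF window_observable_left_rate[OF j]]) simp
  have G: "window_observable K (?G k)" for k
    by (rule window_observable_power[OF window_observable_right_rate[OF j]]) simp
  have mF [measurable]: "?F k \<in> borel_measurable config_space" and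
    mG [measurable]: "?G k \<in> borel_measurable config_space" for k
    using F G by (auto simp: window_observable_def)
  have m1 [measurable]: "(\<lambda>(\<eta>, \<zeta>, \<xi>). \<eta>) \<in> measurable \<kappa> config_space"
    and m2 [measurable]: "(\<lambda>(\<eta>, \<zeta>, \<xi>). \<xi>) \<in> measurable \<kappa> config_space" by measurable
  have "(\<integral>\<^sup>+x. expected_jumps K d n j (initial_state x) \<partial>\<kappa>) \<le>
      (\<integral>\<^sup>+x. (\<Sum>k<n. ?F k ((\<lambda>(\<eta>, \<zeta>, \<xi>). \<eta>) x) + ?G k ((\<lambda>(\<eta>, \<zeta>, \<xi>). \<xi>) x)) \<partial>\<kappa>)"
  proof (rule nn_integral_mono_AE, use AE in eventually_elim)
    fix x :: "config \<times> config \<times> config"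
    assume *: "case x of (\<eta>, \<zeta>, \<xi>) \<Rightarrow> \<forall>i. \<eta> i \<le> \<zeta> i \<and> \<zeta> i \<le> \<xi> i"
    obtain \<eta> \<zeta> \<xi> where x: "x = (\<eta>, \<zeta>, \<xi>)" by (cases x)
    have ord: "ordered (initial_state x)" unfolding x using * x by (intro ordered_initial_state) simp
    have "expected_jumps K d n j (initial_state x) \<le>
        (\<Sum>as\<in>histories K n. ennreal (history_weight K d as) * of_nat (jumps K Middle j (initial_state x) as))"
      unfolding expected_jumps_def
    proof (intro sum_mono mult_left_mono)
      fix as assume "as \<in> histories K n"
      then have "initial_state x Monotone j + int (jumps K Monotone j (initial_state x) as) \<le>
          initial_state x Middle j + int (jumps K Middle j (initial_state x) as)"
        by (intro jumps_Monotone_le_Middle[OF ord]) (auto simp: histories_def)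
      then show "(of_nat (jumps K Monotone j (initial_state x) as) :: ennreal) \<le>
          of_nat (jumps K Middle j (initial_state x) as)"
        by (simp add: x)
    qed simp
    also have "\<dots> \<le> (\<Sum>k<n. ?F k (increments (initial_state x Lower)) + ?G k (increments (initial_state x Upper)))"
      by (rule expected_jumps_le[OF d j ord])
    finally show "expected_jumps K d n j (initial_state x) \<le>
        (\<Sum>k<n. ?F k ((\<lambda>(\<eta>, \<zeta>, \<xi>). \<eta>) x) + ?G k ((\<lambda>(\<eta>, \<zeta>, \<xi>). \<xi>) x))"
      by (simp add: x increments_heights)
  qed
  also have "\<dots> = (\<Sum>k<n. (\<integral>\<^sup>+x. ?F k ((\<lambda>(\<eta>, \<zeta>, \<xi>). \<eta>) x) \<partial>\<kappa>) + (\<integral>\<^sup>+x. ?G k ((\<lambda>(\<eta>, \<zeta>, \<xi>). \<xi>) x) \<partial>\<kappa>))"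
    using measurable_compose[OF m1 mF] measurable_compose[OF m2 mG]
    by (simp add: nn_integral_sum nn_integral_add)
  also have "\<dots> = (\<Sum>k<n. (\<integral>\<^sup>+c. ?F k c \<partial>product_state r \<theta>\<^sub>1) + (\<integral>\<^sup>+c. ?G k c \<partial>product_state r \<theta>\<^sub>2))"
    unfolding lower[symmetric] upper[symmetric]
    by (subst (1 2) nn_integral_distr) (use m1 m2 mF mG in auto)
  also have "\<dots> \<le> (\<Sum>k<n. ennreal (d * exp (- \<theta>\<^sub>1)) + ennreal (d * exp \<theta>\<^sub>2))"
  proof (intro sum_mono add_mono)
    fix k
    show "(\<integral>\<^sup>+c. ?F k c \<partial>product_state r \<theta>\<^sub>1) \<le> ennreal (d * exp (- \<theta>\<^sub>1))"
      by (rule order_trans[OF nn_integral_transfer_power_le[OF window_observable_left_rate[OF j] d]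
        nn_integral_left_rate_le[OF d]]) simp_all
    show "(\<integral>\<^sup>+c. ?G k c \<partial>product_state r \<theta>\<^sub>2) \<le> ennreal (d * exp \<theta>\<^sub>2)"
      by (rule order_trans[OF nn_integral_transfer_power_le[OF window_observable_right_rate[OF j] d]
        nn_integral_right_rate_le[OF d]]) simp_all
  qed
  also have "\<dots> = ennreal (real n * d * (exp \<theta>\<^sub>2 + exp (- \<theta>\<^sub>1)))"
    using d by (simp add: ennreal_plus[symmetric] ennreal_of_nat_eq_real_of_nat ennreal_mult[symmetric]
      algebra_simps del: ennreal_plus)
  finally show ?thesis .
qed

end

section \<open>The monotone path and its discretisation\<close>

context rate_function
begin

lemma monotone_path_outside:
  assumes "is_monotone_path r S L R \<omega> h" "\<not> (L \<le> i \<and> i < R)"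
  shows "h t i = heights \<omega> i"
  using assms path_upto_outside[of r S L R \<omega> t h i t] by (simp add: is_monotone_path_iff)

lemma monotone_path_left_limit:
  assumes path: "is_monotone_path r S L R \<omega> h" and t: "0 \<le> t\<^sub>0" "t\<^sub>0 < t"
    and const: "\<And>s. t\<^sub>0 \<le> s \<Longrightarrow> s < t \<Longrightarrow> h s = g"
  shows "h t = monotone_step r S L R t g"
proof -
  from path t obtain g' where g': "\<And>i. ((\<lambda>s. h s i) \<longlongrightarrow> g' i) (at_left t)"
    "h t = monotone_step r S L R t g'"
    unfolding is_monotone_path_def by (meson le_less_trans)
  have "g' i = g i" for i
  proof -
    have "eventually (\<lambda>s. h s i = g i) (at_left t)"
      unfolding eventually_at_left[OF t(2)] using const t(2) by (intro exI[of _ t\<^sub>0]) auto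
    moreover have "eventually (\<lambda>s. h s i = g' i) (at_left t)"
      using g'(1)[of i] unfolding tendsto_discrete .
    ultimately have "eventually (\<lambda>s::real. g' i = g i) (at_left t)"
      by eventually_elim simp
    then show ?thesis by simp
  qed
  then have "g' = g" by auto
  with g'(2) show ?thesis by simp
qed

text \<open>Right-continuity is given height by height; since only the finitely many heights of the
  window can move, one interval serves them all.\<close>

lemma monotone_path_right:
  assumes path: "is_monotone_path r S L R \<omega> h" and t: "0 \<le> t"
  shows "\<exists>e>t. \<forall>s. t < s \<and> s < e \<longrightarrow> h s = h t"
proof -
  have "eventually (\<lambda>s. \<forall>i\<in>{L..<R}. h s i = h t i) (at_right t)"
    using path t unfolding is_monotone_path_def tendsto_discrete
    by (intro eventually_ball_finite) auto
  then obtain e where e: "e > t" "\<And>s i. t < s \<Longrightarrow> s < e \<Longrightarrow> i \<in> {L..<R} \<Longrightarrow> h s i = h t i"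
    unfolding eventually_at_right[OF less_add_one] by blast
  have "h s = h t" if "t < s" "s < e" for s
  proof
    fix i
    show "h s i = h t i"
      using e(2)[OF that, of i] monotone_path_outside[OF path, of i] by (cases "L \<le> i \<and> i < R") auto
  qed
  with e(1) show ?thesis by blast
qed

lemma monotone_path_const:
  assumes path: "is_monotone_path r S L R \<omega> h" and t: "0 \<le> t\<^sub>0" "h t\<^sub>0 = g"
    and none: "\<And>i s y. L \<le> i \<Longrightarrow> i < R \<Longrightarrow> t\<^sub>0 < s \<Longrightarrow> s \<le> t\<^sub>1 \<Longrightarrow> (s, y) \<in> S i \<Longrightarrow> 0 < y \<Longrightarrow>
      \<not> y < r (increments g i) + r (- increments g (i + 1))"
    and s: "t\<^sub>0 \<le> s" "s \<le> t\<^sub>1"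
  shows "h s = g"
proof -
  have "t\<^sub>0 \<le> s \<longrightarrow> h s = g"
  proof (rule real_interval_induct[where P="\<lambda>s. t\<^sub>0 \<le> s \<longrightarrow> h s = g" and T=t\<^sub>1])
    show "t\<^sub>0 \<le> 0 \<longrightarrow> h 0 = g" using t by auto
  next
    fix s assume s: "0 < s" "s \<le> t\<^sub>1" and IH: "\<And>u. 0 \<le> u \<Longrightarrow> u < s \<Longrightarrow> t\<^sub>0 \<le> u \<longrightarrow> h u = g"
    show "t\<^sub>0 \<le> s \<longrightarrow> h s = g"
    proof
      assume "t\<^sub>0 \<le> s"
      then consider "s = t\<^sub>0" | "t\<^sub>0 < s" by linarith
      then show "h s = g"
      proof cases
        case 2
        then have "h s = monotone_step r S L R s g"
          using IH t by (intro monotone_path_left_limit[OF path t(1)]) auto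
        also have "\<dots> = g"
          using none[OF _ _ 2 s(2)] by (fastforce simp: monotone_step_def)
        finally show ?thesis .
      qed (simp add: t)
    qed
  next
    fix s assume s: "0 \<le> s" "s < t\<^sub>1" and hs: "t\<^sub>0 \<le> s \<longrightarrow> h s = g"
    show "\<exists>e>s. \<forall>u. s < u \<and> u < e \<and> u \<le> t\<^sub>1 \<longrightarrow> t\<^sub>0 \<le> u \<longrightarrow> h u = g"
    proof (cases "t\<^sub>0 \<le> s")
      case True
      with hs monotone_path_right[OF path s(1)] show ?thesis by metis
    next
      case False
      then show ?thesis by (intro exI[of _ t\<^sub>0]) auto
    qed
  qed (use s t in auto)
  with s show ?thesis by simp
qed

text \<open>Both paths see the same points. Where the heights agree, the larger window has the
  larger rate and accepts every point that the smaller one accepts; where they differ, the gap of at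
  least 1 absorbs a single jump.\<close>

lemma monotone_path_mono_interval:
  assumes h: "is_monotone_path r S L R \<omega> h" and h': "is_monotone_path r S L' R' \<omega> h'"
    and sub: "L' \<le> L" "R \<le> R'" and T: "0 \<le> T"
  shows "h T i \<le> h' T i"
proof -
  have "\<forall>i. h T i \<le> h' T i"
  proof (rule real_interval_induct[where P="\<lambda>t. \<forall>i. h t i \<le> h' t i" and T=T])
    show "\<forall>i. h 0 i \<le> h' 0 i" using h h' by (simp add: is_monotone_path_def)
  next
    fix t assume t: "0 < t" and IH: "\<And>s. 0 \<le> s \<Longrightarrow> s < t \<Longrightarrow> \<forall>i. h s i \<le> h' s i"
    obtain g where g: "\<And>i. ((\<lambda>s. h s i) \<longlongrightarrow> g i) (at_left t)" "h t = monotone_step r S L R t g"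
      using h t unfolding is_monotone_path_def by blast
    obtain g' where g': "\<And>i. ((\<lambda>s. h' s i) \<longlongrightarrow> g' i) (at_left t)" "h' t = monotone_step r S L' R' t g'"
      using h' t unfolding is_monotone_path_def by blast
    have le: "g i \<le> g' i" for i
    proof -
      have "eventually (\<lambda>s. h s i \<le> h' s i) (at_left t)"
        unfolding eventually_at_left[OF t] using IH t by (intro exI[of _ 0]) auto
      moreover have "eventually (\<lambda>s. h s i = g i) (at_left t)" "eventually (\<lambda>s. h' s i = g' i) (at_left t)"
        using g(1)[of i] g'(1)[of i] unfolding tendsto_discrete by auto
      ultimately have "eventually (\<lambda>s::real. g i \<le> g' i) (at_left t)"
        by eventually_elim simp
      then show ?thesis by simp
    qed
    show "\<forall>i. h t i \<le> h' t i"
    proof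
      fix i
      show "h t i \<le> h' t i"
      proof (cases "g i = g' i")
        case True
        have "increments g i \<le> increments g' i" "- increments g (i + 1) \<le> - increments g' (i + 1)"
          using le[of "i - 1"] le[of "i + 1"] True by (auto simp: increments_def)
        then have "r (increments g i) + r (- increments g (i + 1)) \<le>
            r (increments g' i) + r (- increments g' (i + 1))"
          by (intro add_mono monoD[OF r_mono])
        with True sub show ?thesis
          unfolding g(2) g'(2) monotone_step_def by (auto intro: less_le_trans)
      next
        case False
        with le[of i] have "g i + 1 \<le> g' i" by simp
        then show ?thesis unfolding g(2) g'(2) monotone_step_def by auto
      qed
    qed
  next
    fix t assume t: "0 \<le> t" and le: "\<forall>i. h t i \<le> h' t i"
    from monotone_path_right[OF h t] obtain e where e: "e > t" "\<And>s. t < s \<Longrightarrow> s < e \<Longrightarrow> h s = h t" by blast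
    from monotone_path_right[OF h' t] obtain e' where e': "e' > t" "\<And>s. t < s \<Longrightarrow> s < e' \<Longrightarrow> h' s = h' t" by blast
    show "\<exists>e>t. \<forall>s. t < s \<and> s < e \<and> s \<le> T \<longrightarrow> (\<forall>i. h s i \<le> h' s i)"
      using e e' le by (intro exI[of _ "min e e'"]) auto
  qed (use T in auto)
  then show ?thesis by blast
qed

end

section \<open>Following the path slab by slab\<close>

context coupled_processes
begin

text \<open>Slabs are half-open in time, so consecutive ones are disjoint. Points above every
  threshold are ignored, since no rate within the cut-off exceeds the thresholds.\<close>

definition slab_outcome :: "nat \<Rightarrow> (int \<Rightarrow> (real \<times> real) set) \<Rightarrow> real \<Rightarrow> real \<Rightarrow> outcome \<Rightarrow> bool" where
  "slab_outcome K S t d a \<longleftrightarrow> (\<forall>i\<in>bonds. \<forall>v\<in>thresholds K.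
    card (S i \<inter> ({t<..t + d} \<times> level (thresholds K) v)) = of_bool (a = Some (i, v)))"

lemma finite_slab:
  assumes "S i \<in> locally_finite_sets"
  shows "finite (S i \<inter> ({t<..u} \<times> level V v))"
proof -
  have "bounded ({t..u} \<times> {0..v})" by (intro bounded_Times) auto
  then have "finite (S i \<inter> ({t..u} \<times> {0..v}))"
    using assms by (simp add: locally_finite_sets_def)
  then show ?thesis by (rule finite_subset[rotated]) (auto simp: level_def)
qed

text \<open>A point below the current rate lies in one of the levels that tile the interval up to
  this rate, and that cell is occupied only if it is the recorded outcome.\<close>

lemma slab_point:
  assumes S: "\<And>i. S i \<in> locally_finite_sets" and out: "slab_outcome K S t d a"
    and g: "bounded_on L R K (increments g)" and i: "L \<le> i" "i < R"
    and y: "(s, y) \<in> S i" "t < s" "s \<le> t + d" "0 < y" "y < r (increments g i) + r (- increments g (i + 1))"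
  shows "\<exists>v. a = Some (i, v) \<and> v \<le> rate Monotone i (increments g) \<and>
    (s, y) \<in> S i \<inter> ({t<..t + d} \<times> level (thresholds K) v)"
proof -
  let ?q = "rate Monotone i (increments g)"
  have q: "?q \<in> thresholds K" using i by (intro rate_in_thresholds g) auto
  have "y \<in> {0<..<?q}" using y i by simp
  then obtain v where v: "v \<in> thresholds K" "v \<le> ?q" "y \<in> level (thresholds K) v"
    unfolding Union_level[OF finite_thresholds q, symmetric] by blast
  let ?A = "S i \<inter> ({t<..t + d} \<times> level (thresholds K) v)"
  have mem: "(s, y) \<in> ?A" using y v by auto
  \<comment> \<open>Local finiteness matters here, because the cardinality of an infinite set is 0
    by convention.\<close>
  then have "card ?A \<noteq> 0" using finite_slab[of S i, OF S] by (auto simp: card_eq_0_iff)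
  moreover have "card ?A = of_bool (a = Some (i, v))"
    using out v(1) i unfolding slab_outcome_def by auto
  ultimately have "a = Some (i, v)" by (auto split: if_splits)
  with v mem show ?thesis by blast
qed

text \<open>The cut-off is imposed after the jump as well: the rest of the slab is tested against
  the new rates, which must again be thresholds for the recorded outcome to exclude further
  points.\<close>

lemma slab_step:
  assumes S: "\<And>i. S i \<in> locally_finite_sets" and path: "is_monotone_path r S L R \<omega> h"
    and t: "0 \<le> t" "0 < d" and g: "h t = g" "bounded_on L R K (increments g)"
    and out: "slab_outcome K S t d a" and a: "a \<in> outcomes bonds (thresholds K)"
    and g': "bounded_on L R K (increments (height_bump (rate Monotone) a g))"
  shows "h (t + d) = height_bump (rate Monotone) a g"
proof (cases "\<exists>i v. a = Some (i, v) \<and> v \<le> rate Monotone i (increments g)")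
  case False
  have "h (t + d) = g"
  proof (rule monotone_path_const[OF path t(1) g(1)])
    show "\<not> y < r (increments g i) + r (- increments g (i + 1))"
      if "L \<le> i" "i < R" "t < s" "s \<le> t + d" "(s, y) \<in> S i" "0 < y" for i s y
      using slab_point[OF S out g(2), of i s y] that False by blast
  qed (use t in auto)
  with False show ?thesis by (auto simp: height_bump_def split: option.split)
next
  case True
  then obtain i v where iv: "a = Some (i, v)" "v \<le> rate Monotone i (increments g)" by blast
  then have i: "i \<in> bonds" and v: "v \<in> thresholds K" using a by (auto simp: outcomes_def)
  have LR: "L \<le> i" "i < R"
    using iv(2) thresholds_pos[OF v] by (auto split: if_splits)
  let ?A = "S i \<inter> ({t<..t + d} \<times> level (thresholds K) v)" and ?g = "g(i := g i + 1)"
  have bump: "height_bump (rate Monotone) a g = ?g" using iv by (simp add: height_bump_def del: rate.simps)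
  have "card ?A = 1" using out i v iv(1) unfolding slab_outcome_def by simp
  then obtain \<tau> y where A: "?A = {(\<tau>, y)}" by (metis card_1_singletonE surj_pair)
  then have "(\<tau>, y) \<in> ?A" by blast
  then have \<tau>: "t < \<tau>" "\<tau> \<le> t + d" "(\<tau>, y) \<in> S i" and y: "0 < y" "y < v"
    by (auto simp: level_def)
  \<comment> \<open>Stated for arbitrary heights f because it serves twice, before the jump and
    after it.\<close>
  have only: "j = i \<and> s = \<tau>"
    if "bounded_on L R K (increments f)" "L \<le> j" "j < R" "(s, z) \<in> S j" "t < s" "s \<le> t + d" "0 < z"
      "z < r (increments f j) + r (- increments f (j + 1))" for f j s z
  proof -
    from slab_point[OF S out that]
    obtain v' where v': "a = Some (j, v')" "(s, z) \<in> S j \<inter> ({t<..t + d} \<times> level (thresholds K) v')"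
      by blast
    then have eq: "j = i" "v' = v" using iv(1) by auto
    have "(s, z) \<in> {(\<tau>, y)}" using v'(2) unfolding eq A .
    with eq show ?thesis by simp
  qed
  have const: "h s = g" if s: "t \<le> s" "s < \<tau>" for s
  proof (rule monotone_path_const[OF path t(1) g(1) _ s(1) order_refl])
    fix j u z assume j: "L \<le> j" "j < R" and u: "t < u" "u \<le> s" and z: "(u, z) \<in> S j" "0 < z"
    show "\<not> z < r (increments g j) + r (- increments g (j + 1))"
    proof
      assume "z < r (increments g j) + r (- increments g (j + 1))"
      moreover have "u \<le> t + d" using u s \<tau>(2) by linarith
      ultimately have "u = \<tau>" using only[OF g(2) j z(1) u(1) _ z(2)] by blast
      with u s show False by simp
    qed
  qed
  have "h \<tau> = monotone_step r S L R \<tau> g"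
    by (rule monotone_path_left_limit[OF path t(1) \<tau>(1) const])
  also have "\<dots> = ?g"
  proof
    fix j
    show "monotone_step r S L R \<tau> g j = ?g j"
    proof (cases "j = i")
      case True
      moreover have "y < r (increments g i) + r (- increments g (i + 1))"
        using y iv(2) LR by simp
      ultimately show ?thesis using \<tau> y LR by (auto simp: monotone_step_def)
    next
      case False
      then have "\<not> (L \<le> j \<and> j < R \<and> (\<exists>z. (\<tau>, z) \<in> S j \<and> 0 < z \<and>
          z < r (increments g j) + r (- increments g (j + 1))))"
        using only[OF g(2), of j \<tau>] \<tau>(1,2) by blast
      with False show ?thesis unfolding monotone_step_def by simp
    qed
  qed
  finally have h\<tau>: "h \<tau> = ?g" .
  have "h (t + d) = ?g"
  proof (rule monotone_path_const[OF path _ h\<tau> _ \<tau>(2) order_refl])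
    show "0 \<le> \<tau>" using t \<tau> by simp
    fix j u z assume j: "L \<le> j" "j < R" and u: "\<tau> < u" "u \<le> t + d" and z: "(u, z) \<in> S j" "0 < z"
    show "\<not> z < r (increments ?g j) + r (- increments ?g (j + 1))"
    proof
      assume "z < r (increments ?g j) + r (- increments ?g (j + 1))"
      moreover have "t < u" using u \<tau>(1) by linarith
      ultimately have "u = \<tau>" using only[OF g'[unfolded bump] j z(1) _ u(2) z(2)] by blast
      with u show False by simp
    qed
  qed
  with bump show ?thesis by simp
qed

text \<open>
  A bond of maximal height jumps at most at this rate, so the maximal height grows only at points
  below it. This bounds the heights independently of \<open>K\<close> and of the number of slabs.
\<close>

definition peak_rate :: real where
  "peak_rate = max (r 0) (exp \<theta>\<^sub>2) + max (r 0) (exp (- \<theta>\<^sub>1))"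

definition low :: "outcome \<Rightarrow> bool" where
  "low a \<longleftrightarrow> (\<exists>i v. a = Some (i, v) \<and> v \<le> peak_rate)"

definition low_points :: "(int \<Rightarrow> (real \<times> real) set) \<Rightarrow> real \<Rightarrow> real \<Rightarrow> nat" where
  "low_points S t u = (\<Sum>i\<in>bonds. card (S i \<inter> ({t<..u} \<times> {0<..<peak_rate})))"

lemma height_bump_bounds:
  assumes h: "\<And>j. j \<in> bonds \<Longrightarrow> A \<le> h j \<and> h j \<le> B" and a: "a \<in> outcomes bonds V" and V: "\<And>v. v \<in> V \<Longrightarrow> 0 < v"
    and j: "j \<in> bonds"
  shows "A \<le> height_bump (rate p) a h j \<and> height_bump (rate p) a h j \<le> B + of_bool (low a)"
proof (cases "height_bump (rate p) a h j = h j")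
  case True
  with h[OF j] show ?thesis by auto
next
  case False
  then obtain v where v: "a = Some (j, v)" "v \<le> rate p j (increments h)"
    and eq: "height_bump (rate p) a h j = h j + 1"
    by (auto simp: height_bump_def split: option.splits if_splits)
  have "h j + 1 \<le> B + of_bool (low a)"
  proof (cases "h j < B")
    case False
    with h[OF j] have hB: "h j = B" by simp
    \<comment> \<open>The neighbours of a maximal height are not higher, so the argument of r is at
      most 0.\<close>
    have r1: "r (increments h j) \<le> r 0" if "L \<le> j"
      using h[of "j - 1"] that j hB by (intro monoD[OF r_mono]) (auto simp: increments_def)
    have r2: "r (- increments h (j + 1)) \<le> r 0" if "j < R"
      using h[of "j + 1"] that j hB by (intro monoD[OF r_mono]) (auto simp: increments_def)
    have bd: "boundary_rate L R \<alpha> \<beta> j (increments h) \<le> peak_rate"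
      if "\<alpha> \<le> exp \<theta>\<^sub>2" "\<beta> \<le> exp (- \<theta>\<^sub>1)" for \<alpha> \<beta>
      unfolding boundary_rate_def peak_rate_def using that r1 r2 by (intro add_mono) auto
    have pk: "0 < peak_rate" unfolding peak_rate_def using r_pos[of 0] by (intro add_pos_pos) auto
    have mono: "r (increments h j) + r (- increments h (j + 1)) \<le> peak_rate" if "L \<le> j" "j < R"
      unfolding peak_rate_def using r1 r2 that by (intro add_mono) auto
    have "rate p j (increments h) \<le> peak_rate"
      using \<theta>_le pk mono by (cases p) (auto intro!: bd)
    with v have "low a" by (auto simp: low_def)
    with hB show ?thesis by simp
  qed auto
  with eq h[OF j] show ?thesis by simp
qed

lemma bounded_on_increments:
  assumes "\<And>j. j \<in> bonds \<Longrightarrow> A \<le> h j \<and> h j \<le> B" "B - A \<le> int K"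
  shows "bounded_on L R K (increments h)"
  unfolding bounded_on_def
proof
  fix j assume "j \<in> {L..R}"
  then have "j - 1 \<in> bonds" "j \<in> bonds" by auto
  with assms(1)[of "j - 1"] assms(1)[of j] assms(2) show "\<bar>increments h j\<bar> \<le> int K"
    by (simp add: increments_def abs_le_iff)
qed

lemma finite_low: "S i \<in> locally_finite_sets \<Longrightarrow> finite (S i \<inter> ({t<..u} \<times> {0<..<peak_rate}))"
  \<comment> \<open>With the empty set of thresholds a level is a full interval.\<close>
  using finite_slab[of S i t u "{}" peak_rate] by (simp add: level_def)

lemma low_points_split:
  assumes S: "\<And>i. S i \<in> locally_finite_sets" and "t \<le> u" "u \<le> v"
  shows "low_points S t v = low_points S t u + low_points S u v"
  unfolding low_points_def sum.distrib[symmetric]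
proof (rule sum.cong[OF refl])
  fix i
  have "S i \<inter> ({t<..v} \<times> {0<..<peak_rate}) =
      (S i \<inter> ({t<..u} \<times> {0<..<peak_rate})) \<union> (S i \<inter> ({u<..v} \<times> {0<..<peak_rate}))"
    using assms by auto
  then show "card (S i \<inter> ({t<..v} \<times> {0<..<peak_rate})) =
      card (S i \<inter> ({t<..u} \<times> {0<..<peak_rate})) + card (S i \<inter> ({u<..v} \<times> {0<..<peak_rate}))"
    by (simp only:) (rule card_Un_disjoint[OF finite_low[of S i t u, OF S] finite_low[of S i u v, OF S]], auto)
qed

lemma low_points_ge_1:
  assumes S: "\<And>i. S i \<in> locally_finite_sets" and out: "slab_outcome K S t d a"
    and a: "a \<in> outcomes bonds (thresholds K)" and low: "low a"
  shows "1 \<le> low_points S t (t + d)"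
proof -
  obtain i v where iv: "a = Some (i, v)" "v \<le> peak_rate" using low by (auto simp: low_def)
  then have i: "i \<in> bonds" and v: "v \<in> thresholds K" using a by (auto simp: outcomes_def)
  have "1 = card (S i \<inter> ({t<..t + d} \<times> level (thresholds K) v))"
    using out i v iv(1) unfolding slab_outcome_def by simp
  also have "\<dots> \<le> card (S i \<inter> ({t<..t + d} \<times> {0<..<peak_rate}))"
    using iv(2) by (intro card_mono finite_low S) (auto simp: level_def)
  also have "\<dots> \<le> low_points S t (t + d)"
    unfolding low_points_def using i by (intro member_le_sum) auto
  finally show ?thesis .
qed

definition matches :: "nat \<Rightarrow> (int \<Rightarrow> (real \<times> real) set) \<Rightarrow> real \<Rightarrow> real \<Rightarrow> outcome list \<Rightarrow> bool" where
  "matches K S t d as \<longleftrightarrow> (\<forall>k<length as. slab_outcome K S (t + real k * d) d (as ! k))"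

lemma matches_Cons:
  "matches K S t d (a # as) \<longleftrightarrow> slab_outcome K S t d a \<and> matches K S (t + d) d as"
  unfolding matches_def by (simp add: All_less_Suc2 algebra_simps)

text \<open>The budget, spread of the heights plus number of low points still to come, never grows:
  an outcome that raises the bound B by one uses up at least one low point. So the increments stay
  within K, killing never happens, and the chain follows the path.\<close>

lemma jumps_eq_path:
  assumes S: "\<And>i. S i \<in> locally_finite_sets" and path: "is_monotone_path r S L R \<omega> h"
    and d: "0 < d" and "0 \<le> t" "s Monotone = h t"
    and "\<And>p j. j \<in> bonds \<Longrightarrow> A \<le> s p j \<and> s p j \<le> B"
    and "B - A + int (low_points S t (t + real (length as) * d)) \<le> int K"
    and "matches K S t d as" "set as \<subseteq> outcomes bonds (thresholds K)"
  shows "h (t + real (length as) * d) j = h t j + int (jumps K Monotone j s as)"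
  using assms(4-)
proof (induction as arbitrary: t s B)
  case (Cons a as)
  let ?u = "t + d" and ?B = "B + of_bool (low a)" and ?g = "height_bump (rate Monotone) a (s Monotone)"
  have a: "a \<in> outcomes bonds (thresholds K)" and out: "slab_outcome K S t d a"
    and rest: "matches K S ?u d as" "set as \<subseteq> outcomes bonds (thresholds K)"
    using Cons.prems(5,6) by (auto simp: matches_Cons)
  have len: "t + real (length (a # as)) * d = ?u + real (length as) * d" by (simp add: algebra_simps)
  have lp: "low_points S t (t + real (length (a # as)) * d) =
      low_points S t ?u + low_points S ?u (?u + real (length as) * d)"
    unfolding len using d by (intro low_points_split S) auto
  have lowa: "of_bool (low a) \<le> int (low_points S t ?u)"
    using low_points_ge_1[OF S out a] by auto
  have bnd: "A \<le> step a s p j \<and> step a s p j \<le> ?B" if "j \<in> bonds" for p j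
    unfolding step_def by (intro height_bump_bounds[OF Cons.prems(3) a thresholds_pos that])
  have BK: "?B - A + int (low_points S ?u (?u + real (length as) * d)) \<le> int K"
    using Cons.prems(4) lowa unfolding lp by simp
  have "B - A \<le> int K" using Cons.prems(4) by linarith
  then have bd: "bounded_on L R K (increments (s p))" for p
    by (intro bounded_on_increments[OF Cons.prems(3)])
  have "?B - A \<le> int K" using BK by linarith
  then have "bounded_on L R K (increments (step a s Monotone))"
    by (intro bounded_on_increments[OF bnd])
  then have hu: "h ?u = ?g"
    using Cons.prems(1) d bd[of Monotone] a out Cons.prems(2)
    by (intro slab_step[OF S path]) (auto simp: step_def simp del: rate.simps)
  then have st: "step a s Monotone = h ?u" by (simp add: step_def)
  have "0 \<le> ?u" using Cons.prems(1) d by simp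
  from Cons.IH[of ?u "step a s" ?B, OF this st bnd BK rest]
  have "h (?u + real (length as) * d) j = h ?u j + int (jumps K Monotone j (step a s) as)" .
  also have "h ?u j = h t j + of_bool (jumped Monotone j a s)"
    unfolding st[symmetric] step_apply Cons.prems(2) ..
  finally show ?case
    using bd unfolding len by (simp add: alive_def)
qed simp

text \<open>The order of quantifiers is essential: the cut-off is fixed before the number of slabs,
  which may later depend on K.\<close>

lemma jumps_eq_monotone_heights:
  assumes S: "\<And>i. S i \<in> locally_finite_sets" and t: "0 < t"
  shows "\<exists>K\<^sub>0. \<forall>K\<ge>K\<^sub>0. \<forall>n>0. \<forall>as\<in>histories K n. matches K S 0 (t / real n) as \<longrightarrow>
    int (jumps K Monotone j (initial_state (\<eta>, \<zeta>, \<xi>)) as) = monotone_heights r S L R \<zeta> t j - heights \<zeta> j"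
proof -
  let ?s = "initial_state (\<eta>, \<zeta>, \<xi>)" and ?h = "monotone_heights r S L R \<zeta>"
  have path: "is_monotone_path r S L R \<zeta> ?h"
    by (intro is_monotone_path_monotone_heights r_mono S)
  then have h0: "?h 0 = heights \<zeta>" by (simp add: is_monotone_path_def)
  define H where "H = (\<lambda>(p, j). ?s p j) ` ({Lower, Monotone, Middle, Upper} \<times> bonds)"
  have fin: "finite H" unfolding H_def by (intro finite_imageI finite_cartesian_product) auto
  have mem: "?s p j \<in> H" if "j \<in> bonds" for p j
    unfolding H_def using that by (intro image_eqI[of _ _ "(p, j)"]) (cases p; auto)+
  have bnd: "Min H \<le> ?s p j \<and> ?s p j \<le> Max H" if "j \<in> bonds" for p j
    using mem[OF that] fin by simp
  show ?thesis
  \<comment> \<open>The initial spread of all heights at the bonds plus the low points up to time t,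
    that is, the initial budget.\<close>
  proof (intro exI[of _ "nat (Max H - Min H + int (low_points S 0 t))"] allI impI ballI)
    fix K n :: nat and as
    assume K: "nat (Max H - Min H + int (low_points S 0 t)) \<le> K" and n: "0 < n"
      and as: "as \<in> histories K n" and m: "matches K S 0 (t / real n) as"
    have len: "0 + real (length as) * (t / real n) = t" using as n by (simp add: histories_def)
    have d: "0 < t / real n" using t n by simp
    have "?h (0 + real (length as) * (t / real n)) j = ?h 0 j + int (jumps K Monotone j ?s as)"
    proof (rule jumps_eq_path[OF S path d order_refl _ bnd _ m])
      show "?s Monotone = ?h 0" by (simp add: h0 fun_eq_iff)
      show "Max H - Min H + int (low_points S 0 (0 + real (length as) * (t / real n))) \<le> int K"
        unfolding len using K by linarith
      show "set as \<subseteq> outcomes bonds (thresholds K)" using as by (simp add: histories_def)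
    qed
    then show "int (jumps K Monotone j ?s as) = ?h t j - heights \<zeta> j"
      unfolding len h0 by simp
  qed
qed

end

section \<open>Probabilities of slab outcomes\<close>

lemma space_point_space: "space point_space = locally_finite_sets"
  unfolding point_space_def by (rule space_measure_of) auto

lemma measurable_card_point_space:
  assumes "B \<in> sets borel" "bounded B"
  shows "Measurable.pred point_space (\<lambda>S. card (S \<inter> B) = k)"
proof -
  have "{S \<in> locally_finite_sets. card (S \<inter> B) = k} \<in> sets point_space"
    unfolding point_space_def using assms by (subst sets_measure_of) auto
  then show ?thesis by (simp add: pred_def space_point_space)
qed

lemma sets_slab_level [measurable]:
  assumes "finite V"
  shows "{t<..t + d} \<times> level V v \<in> sets (borel :: (real \<times> real) measure)"
  using assms by (simp add: borel_prod[symmetric] sets_level)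

lemma bounded_slab_level: "bounded ({t<..t + d} \<times> level V (v::real) :: (real \<times> real) set)"
proof -
  have "bounded ({t..t + d} \<times> {0..v})" by (intro bounded_Times) auto
  then show ?thesis by (rule bounded_subset) (auto simp: level_def)
qed

lemma measure_slab_level:
  assumes "finite V" "0 \<le> d"
  shows "measure lborel ({t<..t + d} \<times> level V v) = d * level_mass V v"
proof -
  have "emeasure lborel ({t<..t + d} \<times> level V v) =
      emeasure (lborel \<Otimes>\<^sub>M lborel) ({t<..t + d} \<times> level V v)"
    by (simp only: lborel_prod)
  also have "\<dots> = emeasure lborel {t<..t + d} * emeasure lborel (level V v)"
    using assms by (intro sigma_finite_measure.emeasure_pair_measure_Times sigma_finite_lborel) (auto simp: sets_level)
  finally show ?thesis
    using assms(2) by (simp add: measure_def level_mass_def enn2real_mult)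
qed

text \<open>The probability that a Poisson variable of mean \<open>x\<close> equals 1 or 0.\<close>

definition indicator_poisson :: "real \<Rightarrow> bool \<Rightarrow> real" where
  "indicator_poisson x b = (if b then x else 1) * exp (- x)"

lemma prod_indicator_poisson:
  assumes I: "finite I" and V: "finite V" and a: "a \<in> outcomes I V"
  shows "(\<Prod>i\<in>I. \<Prod>v\<in>V. indicator_poisson (d * level_mass V v) (a = Some (i, v))) = outcome_weight I V d a"
proof -
  have e: "(\<Prod>i\<in>I. \<Prod>v\<in>V. exp (- (d * level_mass V v))) = empty_weight I V d"
  proof -
    have "(\<Prod>v\<in>V. exp (- (d * level_mass V v))) = exp (- (d * sum (level_mass V) V))"
      using V by (simp add: exp_sum[symmetric] sum_negf sum_distrib_left)
    then show ?thesis
      by (simp add: empty_weight_def exp_of_nat_mult[symmetric] mult.left_commute)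
  qed
  have "(\<Prod>i\<in>I. \<Prod>v\<in>V. if a = Some (i, v) then d * level_mass V v else 1) =
      (\<Prod>p\<in>I \<times> V. if a = Some p then d * level_mass V (snd p) else 1)"
    by (simp add: prod.cartesian_product case_prod_beta')
  also have "\<dots> = (case a of None \<Rightarrow> 1 | Some (i, v) \<Rightarrow> d * level_mass V v)"
  proof (cases a)
    case (Some p)
    then have "p \<in> I \<times> V" using a by (auto simp: outcomes_def)
    with Some assms show ?thesis by (auto simp: prod.delta)
  qed simp
  finally show ?thesis
    unfolding indicator_poisson_def prod.distrib e outcome_weight_def by (simp only:)
qed

lemma outcomes_eqI:
  assumes "a \<in> outcomes I V" "a' \<in> outcomes I V"
    and eq: "\<And>i v. i \<in> I \<Longrightarrow> v \<in> V \<Longrightarrow> (a = Some (i, v)) = (a' = Some (i, v))"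
  shows "a = a'"
proof -
  have "a = Some p \<longleftrightarrow> a' = Some p" for p
  proof (cases "p \<in> I \<times> V")
    case True
    then show ?thesis using eq by (cases p) blast
  next
    case False
    with assms(1,2) show ?thesis unfolding outcomes_def by blast
  qed
  then show ?thesis by (metis option.exhaust)
qed

section \<open>Counts of Poisson points in finitely many cells\<close>

locale point_processes = prob_space M for M :: "'a measure" +
  fixes N :: "int \<Rightarrow> 'a \<Rightarrow> (real \<times> real) set"
  assumes N_poisson: "\<And>j. poisson_point_process M (N j)"
    and N_indep: "indep_vars (\<lambda>_. point_space) N UNIV"
begin

lemma N_measurable [measurable]: "N j \<in> measurable M point_space"
  using N_poisson[of j] by (simp add: poisson_point_process_def)

lemma N_locally_finite: "x \<in> space M \<Longrightarrow> N j x \<in> locally_finite_sets"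
  using measurable_space[OF N_measurable] by (simp add: space_point_space)

lemma N_PiM_measurable: "(\<lambda>x j. N j x) \<in> measurable M (PiM UNIV (\<lambda>_. point_space))"
  using measurable_space[OF N_measurable] by (intro measurable_PiM_single') auto

lemma prob_card_of_bool:
  assumes "B \<in> sets borel" "bounded B" "B \<subseteq> quadrant"
  shows "prob {x \<in> space M. card (N i x \<inter> B) = of_bool b} = indicator_poisson (measure lborel B) b"
  using N_poisson[of i] assms by (cases b) (auto simp: poisson_point_process_def indicator_poisson_def)

text \<open>Independence of counts is given for sets numbered by an initial segment of the naturals,
  so J is enumerated first and the product reindexed back at the end.\<close>

lemma prob_counts:
  assumes J: "finite J" "J \<noteq> {}" and B: "\<And>p. p \<in> J \<Longrightarrow> B p \<in> sets borel \<and> bounded (B p) \<and> B p \<subseteq> quadrant"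
    and disj: "disjoint_family_on B J"
  shows "prob {x \<in> space M. \<forall>p\<in>J. card (N i x \<inter> B p) = of_bool (b p)} =
    (\<Prod>p\<in>J. indicator_poisson (measure lborel (B p)) (b p))"
proof -
  obtain f where f: "bij_betw f {0..<card J} J" using ex_bij_betw_nat_finite[OF J(1)] by blast
  let ?I = "{..<card J}"
  have f: "bij_betw f ?I J" using f by (simp add: atLeast0LessThan)
  have fJ: "f j \<in> J" if "j < card J" for j using f that by (auto simp: bij_betw_def)
  have "disjoint_family_on (\<lambda>j. B (f j)) ?I"
    unfolding disjoint_family_on_def
  proof (intro ballI impI)
    fix m n assume "m \<in> ?I" "n \<in> ?I" "m \<noteq> n"
    then have "f m \<noteq> f n" using bij_betw_imp_inj_on[OF f] by (auto dest: inj_onD)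
    then show "B (f m) \<inter> B (f n) = {}"
      using disj fJ \<open>m \<in> ?I\<close> \<open>n \<in> ?I\<close> by (auto simp: disjoint_family_on_def)
  qed
  then have ind: "indep_vars (\<lambda>_. count_space UNIV) (\<lambda>j x. card (N i x \<inter> B (f j))) ?I"
    using N_poisson[of i, unfolded poisson_point_process_def, THEN conjunct2, THEN conjunct2,
      rule_format, of "card J" "\<lambda>j. B (f j)"] B fJ by simp
  have "{x \<in> space M. \<forall>p\<in>J. card (N i x \<inter> B p) = of_bool (b p)} =
      (\<Inter>j\<in>?I. (\<lambda>x. card (N i x \<inter> B (f j))) -` {of_bool (b (f j))} \<inter> space M)"
  proof -
    have "(\<forall>p\<in>A. P p) \<longleftrightarrow> (\<forall>j\<in>B. P (f j))" if "A = f ` B" for A P and B :: "nat set"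
      unfolding that by simp
    then have *: "(\<forall>p\<in>J. P p) \<longleftrightarrow> (\<forall>j\<in>?I. P (f j))" for P
      using bij_betw_imp_surj_on[OF f] by metis
    have "?I \<noteq> {}" using J by (simp add: lessThan_empty_iff)
    then show ?thesis unfolding * by auto
  qed
  also have "prob \<dots> = (\<Prod>j\<in>?I. prob ((\<lambda>x. card (N i x \<inter> B (f j))) -` {of_bool (b (f j))} \<inter> space M))"
    using J by (intro indep_varsD_finite[OF ind]) (auto simp: card_gt_0_iff lessThan_empty_iff)
  also have "\<dots> = (\<Prod>j\<in>?I. indicator_poisson (measure lborel (B (f j))) (b (f j)))"
  proof (rule prod.cong[OF refl])
    fix j assume "j \<in> ?I"
    then have "B (f j) \<in> sets borel \<and> bounded (B (f j)) \<and> B (f j) \<subseteq> quadrant" using B fJ by simp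
    moreover have "(\<lambda>x. card (N i x \<inter> B (f j))) -` {of_bool (b (f j))} \<inter> space M =
        {x \<in> space M. card (N i x \<inter> B (f j)) = of_bool (b (f j))}" by auto
    ultimately show "prob ((\<lambda>x. card (N i x \<inter> B (f j))) -` {of_bool (b (f j))} \<inter> space M) =
        indicator_poisson (measure lborel (B (f j))) (b (f j))"
      by (simp add: prob_card_of_bool)
  qed
  also have "\<dots> = (\<Prod>p\<in>J. indicator_poisson (measure lborel (B p)) (b p))"
    by (rule prod.reindex_bij_betw[OF f])
  finally show ?thesis .
qed

end

locale poisson_coupling = coupled_processes r L R \<theta>\<^sub>1 \<theta>\<^sub>2 + point_processes M N
  for r L R \<theta>\<^sub>1 \<theta>\<^sub>2 and M :: "'a measure" and N
begin

section \<open>The law of the matching history\<close>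

lemma thresholds_nonempty: "thresholds K \<noteq> {}"
  by (simp add: thresholds_def)

lemma measurable_matches [measurable]:
  "Measurable.pred (PiM UNIV (\<lambda>_. point_space)) (\<lambda>S. matches K S t d as)"
  unfolding matches_def slab_outcome_def lessThan_iff[symmetric] Ball_def[of "{..<length as}", symmetric]
proof (intro pred_intros_finite finite_lessThan)
  fix k i v
  have "Measurable.pred point_space (\<lambda>S. card (S \<inter> ({t + real k * d<..t + real k * d + d} \<times> level (thresholds K) v)) =
      of_bool (as ! k = Some (i, v)))"
    by (intro measurable_card_point_space sets_slab_level bounded_slab_level finite_thresholds)
  from measurable_compose[OF measurable_component_singleton[of i UNIV "\<lambda>_. point_space"] this]
  show "Measurable.pred (PiM UNIV (\<lambda>_. point_space))
      (\<lambda>S. card (S i \<inter> ({t + real k * d<..t + real k * d + d} \<times> level (thresholds K) v)) =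
        of_bool (as ! k = Some (i, v)))"
    by simp
qed (auto simp: finite_thresholds)

lemma matches_event [measurable]: "Measurable.pred M (\<lambda>x. matches K (\<lambda>j. N j x) t d as)"
  using measurable_compose[OF N_PiM_measurable measurable_matches] .

text \<open>The rectangles slab times level are disjoint, so within one bond the counts are
  independent by the Poisson property; different bonds are independent by \<open>N_indep\<close>.
  Exchanging the products regroups the factors slab by slab.\<close>

lemma prob_matches:
  assumes as: "as \<in> histories K n" and n: "0 < n" and d: "0 \<le> d"
  shows "prob {x \<in> space M. matches K (\<lambda>j. N j x) 0 d as} = history_weight K d as"
proof -
  let ?V = "thresholds K"
  let ?J = "{..<n} \<times> ?V"
  define B where "B = (\<lambda>(k, v). {real k * d<..real k * d + d} \<times> level ?V v)"
  define b where "b i = (\<lambda>(k, v). as ! k = Some (i, v))" for i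
  have len: "length as = n" using as by (simp add: histories_def)
  have Bp: "B p \<in> sets borel \<and> bounded (B p) \<and> B p \<subseteq> quadrant" for p
  proof -
    obtain k v where p: "p = (k, v)" by (cases p)
    have "0 \<le> real k * d" using d by simp
    then have "B p \<subseteq> quadrant"
      unfolding p B_def quadrant_def by (auto simp: level_def)
    then show ?thesis
      unfolding p B_def using sets_slab_level[OF finite_thresholds] bounded_slab_level by simp
  qed
  have disj: "disjoint_family_on B ?J"
    unfolding disjoint_family_on_def
  proof (intro ballI impI)
    fix p q assume pq: "p \<in> ?J" "q \<in> ?J" "p \<noteq> q"
    obtain k v where p: "p = (k, v)" by (cases p)
    obtain l w where q: "q = (l, w)" by (cases q)
    show "B p \<inter> B q = {}"
    proof (cases "v = w")
      case False
      then have "level ?V v \<inter> level ?V w = {}"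
        using disjoint_level[of ?V] pq p q by (auto simp: disjoint_family_on_def)
      then show ?thesis unfolding p q B_def by auto
    next
      case True
      have *: "{real k * d<..real k * d + d} \<inter> {real l * d<..real l * d + d} = {}" if "k < l" for k l :: nat
      proof -
        have "(real k + 1) * d \<le> real l * d" using that d by (intro mult_right_mono) auto
        then have "real k * d + d \<le> real l * d" by (simp add: algebra_simps)
        then show ?thesis by auto
      qed
      have "k \<noteq> l" using True pq p q by simp
      then have "{real k * d<..real k * d + d} \<inter> {real l * d<..real l * d + d} = {}"
        using *[of k l] *[of l k] by (cases "k < l") (auto simp: Int_commute)
      then show ?thesis unfolding p q B_def by auto
    qed
  qed
  \<comment> \<open>All conditions on one bond form a single event of its point set, as independence
    of the family N requires.\<close>
  define E where "E i = {S \<in> locally_finite_sets. \<forall>p\<in>?J. card (S \<inter> B p) = of_bool (b i p)}" for i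
  have E: "E i \<in> sets point_space" for i
  proof -
    have "Measurable.pred point_space (\<lambda>S. \<forall>p\<in>?J. card (S \<inter> B p) = of_bool (b i p))"
      using Bp finite_thresholds
      by (intro pred_intros_finite finite_cartesian_product measurable_card_point_space) auto
    then show ?thesis by (simp add: E_def pred_def space_point_space)
  qed
  have NE: "N i -` E i \<inter> space M = {x \<in> space M. \<forall>p\<in>?J. card (N i x \<inter> B p) = of_bool (b i p)}" for i
    using N_locally_finite by (auto simp: E_def)
  have PE: "prob (N i -` E i \<inter> space M) = (\<Prod>p\<in>?J. indicator_poisson (measure lborel (B p)) (b i p))" for i
    unfolding NE using n Bp disj finite_thresholds thresholds_nonempty
    by (intro prob_counts) (auto simp: lessThan_empty_iff)
  have "{x \<in> space M. matches K (\<lambda>j. N j x) 0 d as} = (\<Inter>i\<in>bonds. N i -` E i \<inter> space M)"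
  proof -
    have "matches K (\<lambda>j. N j x) 0 d as \<longleftrightarrow> (\<forall>i\<in>bonds. \<forall>p\<in>?J. card (N i x \<inter> B p) = of_bool (b i p))" for x
      unfolding matches_def slab_outcome_def len B_def b_def by (simp add: Ball_def) blast
    moreover have "bonds \<noteq> {}" using L_less_R by simp
    ultimately show ?thesis unfolding NE by blast
  qed
  also have "prob \<dots> = (\<Prod>i\<in>bonds. prob (N i -` E i \<inter> space M))"
    using L_less_R E by (intro indep_varsD[OF N_indep]) auto
  also have "\<dots> = (\<Prod>i\<in>bonds. \<Prod>k<n. \<Prod>v\<in>?V. indicator_poisson (d * level_mass ?V v) (as ! k = Some (i, v)))"
    unfolding PE
  proof (rule prod.cong[OF refl])
    fix i
    have "indicator_poisson (measure lborel (B p)) (b i p) =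
        (case p of (k, v) \<Rightarrow> indicator_poisson (d * level_mass ?V v) (as ! k = Some (i, v)))" for p
      unfolding B_def b_def using measure_slab_level[OF finite_thresholds d] by (cases p) simp
    then show "(\<Prod>p\<in>?J. indicator_poisson (measure lborel (B p)) (b i p)) =
        (\<Prod>k<n. \<Prod>v\<in>?V. indicator_poisson (d * level_mass ?V v) (as ! k = Some (i, v)))"
      by (simp only: prod.cartesian_product)
  qed
  also have "\<dots> = (\<Prod>k<n. \<Prod>i\<in>bonds. \<Prod>v\<in>?V. indicator_poisson (d * level_mass ?V v) (as ! k = Some (i, v)))"
    by (rule prod.swap)
  also have "\<dots> = (\<Prod>k<n. outcome_weight bonds ?V d (as ! k))"
  proof (intro prod.cong refl prod_indicator_poisson finite_thresholds)
    fix k assume "k \<in> {..<n}"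
    then have "as ! k \<in> set as" using len by simp
    then show "as ! k \<in> outcomes bonds ?V" using as by (auto simp: histories_def)
  qed simp
  also have "\<dots> = history_weight K d as"
    by (simp add: history_weight_def prod.list_conv_set_nth len atLeast0LessThan)
  finally show ?thesis .
qed

lemma matches_unique:
  assumes "as \<in> histories K n" "as' \<in> histories K n" "matches K S t d as" "matches K S t d as'"
  shows "as = as'"
proof (rule nth_equalityI)
  show len: "length as = length as'" using assms by (simp add: histories_def)
  fix k assume k: "k < length as"
  have "as ! k \<in> outcomes bonds (thresholds K)" "as' ! k \<in> outcomes bonds (thresholds K)"
    using assms k len nth_mem[of k as] nth_mem[of k as'] by (auto simp: histories_def)
  moreover have "(as ! k = Some (i, v)) = (as' ! k = Some (i, v))" if "i \<in> bonds" "v \<in> thresholds K" for i v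
  proof -
    have "of_bool (as ! k = Some (i, v)) = (of_bool (as' ! k = Some (i, v)) :: nat)"
      using assms(3,4) k len that unfolding matches_def slab_outcome_def by metis
    then show ?thesis by (simp add: of_bool_eq_iff)
  qed
  ultimately show "as ! k = as' ! k" by (rule outcomes_eqI)
qed

lemma no_history_event:
  "{x \<in> space M. \<not> (\<exists>as\<in>histories K n. matches K (\<lambda>j. N j x) 0 d as)} =
    space M - (\<Union>as\<in>histories K n. {x \<in> space M. matches K (\<lambda>j. N j x) 0 d as})"
  "(\<Union>as\<in>histories K n. {x \<in> space M. matches K (\<lambda>j. N j x) 0 d as}) \<in> events"
  by auto (intro sets.finite_UN finite_histories, auto)

lemma prob_no_history:
  assumes n: "0 < n" and d: "0 \<le> d"
  shows "prob {x \<in> space M. \<not> (\<exists>as\<in>histories K n. matches K (\<lambda>j. N j x) 0 d as)} =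
    1 - ((1 + d * (real (card bonds) * sum (level_mass (thresholds K)) (thresholds K))) *
      empty_weight bonds (thresholds K) d) ^ n"
proof -
  let ?E = "\<lambda>as. {x \<in> space M. matches K (\<lambda>j. N j x) 0 d as}"
  have "prob (\<Union>as\<in>histories K n. ?E as) = (\<Sum>as\<in>histories K n. prob (?E as))"
  proof (intro finite_measure_finite_Union finite_histories)
    show "disjoint_family_on ?E (histories K n)"
      using matches_unique by (fastforce simp: disjoint_family_on_def)
  qed auto
  also have "\<dots> = (\<Sum>as\<in>histories K n. history_weight K d as)"
    using n d by (intro sum.cong refl prob_matches)
  also have "\<dots> = ((1 + d * (real (card bonds) * sum (level_mass (thresholds K)) (thresholds K))) *
      empty_weight bonds (thresholds K) d) ^ n"
    unfolding sum_history_weight by (subst sum_outcome_weight) (auto simp: finite_thresholds)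
  finally have P: "prob (\<Union>as\<in>histories K n. ?E as) = \<dots>" .
  then show ?thesis
    unfolding no_history_event(1) by (subst prob_compl[OF no_history_event(2)]) simp
qed

text \<open>With c the mean number of relevant points up to time t, the probability that each of n
  slabs has at most one is (1 + c / n) ^ n exp (- c), which tends to 1.\<close>

lemma no_history_small:
  assumes t: "0 \<le> t" and e: "0 < e"
  shows "\<exists>n>0. prob {x \<in> space M. \<not> (\<exists>as\<in>histories K n. matches K (\<lambda>j. N j x) 0 (t / real n) as)} < e"
proof -
  define c where "c = t * (real (card bonds) * sum (level_mass (thresholds K)) (thresholds K))"
  have "(\<lambda>n. 1 - (1 + c / real n) ^ n * exp (- c)) \<longlonglongrightarrow> 1 - exp c * exp (- c)"
    by (intro tendsto_intros tendsto_exp_limit_sequentially)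
  then have "(\<lambda>n. 1 - (1 + c / real n) ^ n * exp (- c)) \<longlonglongrightarrow> 0" by (simp add: mult_exp_exp)
  then have "eventually (\<lambda>n. 1 - (1 + c / real n) ^ n * exp (- c) < e) sequentially"
    using e by (rule order_tendstoD(2))
  then have "eventually (\<lambda>n. 0 < n \<and> 1 - (1 + c / real n) ^ n * exp (- c) < e) sequentially"
    by (intro eventually_conj eventually_gt_at_top)
  then obtain n :: nat where n: "0 < n" "1 - (1 + c / real n) ^ n * exp (- c) < e"
    by (auto simp: eventually_sequentially)
  have c: "t / real n * (real (card bonds) * sum (level_mass (thresholds K)) (thresholds K)) = c / real n"
    by (simp add: c_def)
  have ew: "empty_weight bonds (thresholds K) (t / real n) ^ n = exp (- c)"
    unfolding empty_weight_def c using n by (simp add: exp_of_nat_mult[symmetric])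
  have "prob {x \<in> space M. \<not> (\<exists>as\<in>histories K n. matches K (\<lambda>j. N j x) 0 (t / real n) as)} =
      1 - ((1 + t / real n * (real (card bonds) * sum (level_mass (thresholds K)) (thresholds K))) *
      empty_weight bonds (thresholds K) (t / real n)) ^ n"
    using n t by (intro prob_no_history) auto
  also have "\<dots> = 1 - (1 + c / real n) ^ n * exp (- c)"
    unfolding power_mult_distrib ew c ..
  finally have "prob {x \<in> space M. \<not> (\<exists>as\<in>histories K n. matches K (\<lambda>j. N j x) 0 (t / real n) as)} < e"
    using n(2) by simp
  with n(1) show ?thesis by blast
qed

text \<open>Borel-Cantelli with failure probabilities below (1/2) ^ K. The number of slabs is chosen
  after K because the relevant points depend on the thresholds.\<close>

lemma slab_numbers:
  assumes t: "0 \<le> t"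
  obtains n where "\<And>K. 0 < n K"
    "AE x in M. eventually (\<lambda>K. \<exists>as\<in>histories K (n K). matches K (\<lambda>j. N j x) 0 (t / real (n K)) as) sequentially"
proof -
  have "\<forall>K. \<exists>n>0. prob {x \<in> space M. \<not> (\<exists>as\<in>histories K n. matches K (\<lambda>j. N j x) 0 (t / real n) as)} < (1/2) ^ K"
    using no_history_small[OF t] by simp
  from choice[OF this] obtain n where nP: "\<And>K. 0 < n K \<and>
      prob {x \<in> space M. \<not> (\<exists>as\<in>histories K (n K). matches K (\<lambda>j. N j x) 0 (t / real (n K)) as)} < (1/2) ^ K"
    by blast
  then have n: "\<And>K. 0 < n K" by blast
  let ?A = "\<lambda>K. {x \<in> space M. \<not> (\<exists>as\<in>histories K (n K). matches K (\<lambda>j. N j x) 0 (t / real (n K)) as)}"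
  have "AE x in M. eventually (\<lambda>K. x \<in> space M - ?A K) sequentially"
  proof (rule borel_cantelli_AE1)
    show "?A K \<in> events" for K
      unfolding no_history_event(1) by (intro sets.compl_sets no_history_event(2))
    show "emeasure M (?A K) < \<infinity>" for K by (simp add: less_top[symmetric])
    show "summable (\<lambda>K. prob (?A K))"
    proof (rule summable_comparison_test'[where g="\<lambda>K. (1/2) ^ K" and N=0])
      show "norm (prob (?A K)) \<le> (1/2) ^ K" for K
        using nP[of K] by (simp add: less_imp_le)
    qed simp
  qed
  then have "AE x in M. eventually (\<lambda>K. \<exists>as\<in>histories K (n K). matches K (\<lambda>j. N j x) 0 (t / real (n K)) as) sequentially"
  proof eventually_elim
    case (elim x)
    then show ?case by eventually_elim blast
  qed
  with n show ?thesis by (rule that)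
qed

end

section \<open>Passage to the limit\<close>

context rate_function
begin

text \<open>Heights increase with the window, so the limit over all windows is a supremum, and a
  cofinal sequence of windows around i reaches it. Fatou's lemma needs such a sequence.\<close>

lemma limit_heights_tendsto:
  assumes S: "\<And>i. S i \<in> locally_finite_sets" and t: "0 \<le> t"
  shows "(\<lambda>m::nat. ereal (of_int (monotone_heights r S (i - int m) (i + 1 + int m) \<omega> t i)))
    \<longlonglongrightarrow> limit_heights r S \<omega> t i"
proof -
  define f where "f L R = ereal (of_int (monotone_heights r S L R \<omega> t i))" for L R
  have mono: "f L R \<le> f L' R'" if "L' \<le> L" "R \<le> R'" for L R L' R'
    unfolding f_def
    using monotone_path_mono_interval[OF is_monotone_path_monotone_heights[OF r_mono S]
      is_monotone_path_monotone_heights[OF r_mono S] that t] by simp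
  \<comment> \<open>Starting from sites i and i + 1, so that i is an interior bond of every window
    in the sequence.\<close>
  let ?X = "\<lambda>m::nat. f (i - int m) (i + 1 + int m)"
  define l where "l = (SUP m. ?X m)"
  have lim: "?X \<longlonglongrightarrow> l"
    unfolding l_def by (intro LIMSEQ_SUP incseq_SucI mono) auto
  have "((\<lambda>(L, R). f L R) \<longlongrightarrow> l) (at_bot \<times>\<^sub>F at_top)"
  proof (rule order_tendstoI)
    fix a assume "a < l"
    then obtain m where m: "a < ?X m" unfolding l_def less_SUP_iff by blast
    have "eventually (\<lambda>p. fst p \<le> i - int m \<and> i + 1 + int m \<le> snd p) (at_bot \<times>\<^sub>F at_top)"
      by (intro eventually_prodI eventually_le_at_bot eventually_ge_at_top)
    then show "eventually (\<lambda>p. a < (case p of (L, R) \<Rightarrow> f L R)) (at_bot \<times>\<^sub>F at_top)"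
    proof eventually_elim
      case (elim p)
      then have "?X m \<le> f (fst p) (snd p)" by (intro mono) auto
      with m show ?case by (simp add: case_prod_beta')
    qed
  next
    fix a assume a: "l < a"
    have "f L R \<le> l" for L R
    proof -
      have "f L R \<le> ?X (nat (max (i - L) (R - i)))" by (intro mono) auto
      also have "\<dots> \<le> l" unfolding l_def by (rule SUP_upper) simp
      finally show ?thesis .
    qed
    with a show "eventually (\<lambda>p. (case p of (L, R) \<Rightarrow> f L R) < a) (at_bot \<times>\<^sub>F at_top)"
      by (intro always_eventually) (auto intro: le_less_trans)
  qed
  then have "Lim (at_bot \<times>\<^sub>F at_top) (\<lambda>(L, R). f L R) = l"
    by (intro tendsto_Lim) (simp_all add: prod_filter_eq_bot)
  with lim show ?thesis by (simp add: limit_heights_def f_def)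
qed

lemma monotone_heights_0:
  assumes "\<And>i. S i \<in> locally_finite_sets"
  shows "monotone_heights r S L R \<omega> 0 = heights \<omega>"
  using is_monotone_path_monotone_heights[where N=S and L=L and R=R and \<omega>=\<omega>, OF r_mono assms]
  by (simp add: is_monotone_path_def)

lemma limit_heights_0:
  assumes S: "\<And>i. S i \<in> locally_finite_sets"
  shows "limit_heights r S \<omega> 0 i = ereal (of_int (heights \<omega> i))"
  using limit_heights_tendsto[where S=S and i=i and \<omega>=\<omega>, OF S order_refl]
  unfolding monotone_heights_0[of S, OF S] LIMSEQ_const_iff by simp

lemma height_difference_tendsto:
  assumes S: "\<And>i. S i \<in> locally_finite_sets" and t: "0 \<le> t"
  shows "(\<lambda>m::nat. ennreal (of_int (monotone_heights r S (i - int m) (i + 1 + int m) \<omega> t i - heights \<omega> i)))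
    \<longlonglongrightarrow> e2ennreal (limit_heights r S \<omega> t i - limit_heights r S \<omega> 0 i)"
proof -
  let ?c = "ereal (of_int (heights \<omega> i))"
  have "(\<lambda>m::nat. ereal (of_int (monotone_heights r S (i - int m) (i + 1 + int m) \<omega> t i)) - ?c)
      \<longlonglongrightarrow> limit_heights r S \<omega> t i - ?c"
    by (intro tendsto_diff_ereal_general limit_heights_tendsto[OF S t] tendsto_const) auto
  from tendsto_e2ennrealI[OF this] show ?thesis
    by (simp add: limit_heights_0[of S, OF S])
qed

end

section \<open>Measurability of the jump counts\<close>

context coupled_processes
begin

lemma measurable_alive:
  assumes "\<And>p. (\<lambda>c. s c p) \<in> measurable X config_space"
  shows "Measurable.pred X (\<lambda>c. alive K (s c))"
proof -
  have eq: "alive K (s c) \<longleftrightarrow> (\<forall>p\<in>{Lower, Monotone, Middle, Upper}. bounded_on L R K (increments (s c p)))" for c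
    unfolding alive_def
  proof (intro iffI ballI allI)
    fix p
    assume "\<forall>p\<in>{Lower, Monotone, Middle, Upper}. bounded_on L R K (increments (s c p))"
    then show "bounded_on L R K (increments (s c p))" by (cases p) simp_all
  qed blast
  have "Measurable.pred X (\<lambda>c. bounded_on L R K (increments (s c p)))" for p
    by (rule measurable_compose[OF measurable_compose[OF assms measurable_increments] measurable_bounded_on])
  then show ?thesis unfolding eq by (intro pred_intros_finite finite.intros)
qed

lemma measurable_jumped:
  assumes "\<And>p. (\<lambda>c. s c p) \<in> measurable X config_space"
  shows "Measurable.pred X (\<lambda>c. jumped p j a (s c))"
proof (cases "\<exists>v. a = Some (j, v)")
  case True
  then obtain v where v: "a = Some (j, v)" by blast
  have "(\<lambda>c. rate p j (increments (s c p))) \<in> measurable X (count_space UNIV)"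
    by (rule measurable_compose[OF measurable_compose[OF assms measurable_increments] measurable_rate])
  from measurable_compose[OF this, of "\<lambda>x. v \<le> x" "count_space UNIV"]
  show ?thesis by (simp add: jumped_def v)
qed (simp add: jumped_def)

lemma measurable_step:
  assumes s: "\<And>p. (\<lambda>c. s c p) \<in> measurable X config_space"
  shows "(\<lambda>c. step a (s c) p) \<in> measurable X config_space"
proof (rule measurable_config_spaceI)
  fix j
  have "(\<lambda>c. s c p j) \<in> measurable X (count_space UNIV)"
    by (rule measurable_compose[OF s measurable_config_coord])
  moreover have "(\<lambda>c. of_bool (jumped p j a (s c)) :: int) \<in> measurable X (count_space UNIV)"
    using measurable_compose[OF measurable_jumped[OF s], of of_bool "count_space UNIV"] by simp
  ultimately show "(\<lambda>c. step a (s c) p j) \<in> measurable X (count_space UNIV)"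
    unfolding step_apply by (rule measurable_int_op[where F="(+)"])
qed

lemma measurable_jumps:
  assumes "\<And>p. (\<lambda>c. s c p) \<in> measurable X config_space"
  shows "(\<lambda>c. of_nat (jumps K p j (s c) as) :: ennreal) \<in> borel_measurable X"
  using assms
proof (induction as arbitrary: s)
  case (Cons a as)
  have IH: "(\<lambda>c. of_nat (jumps K p j (step a (s c)) as) :: ennreal) \<in> borel_measurable X"
    by (intro Cons.IH measurable_step Cons.prems)
  have [measurable]: "Measurable.pred X (\<lambda>c. alive K (s c))" "Measurable.pred X (\<lambda>c. jumped p j a (s c))"
    using Cons.prems by (auto intro: measurable_alive measurable_jumped)
  have "(\<lambda>c. if alive K (s c) then (if jumped p j a (s c) then 1 else 0) +
      of_nat (jumps K p j (step a (s c)) as) else 0 :: ennreal) \<in> borel_measurable X"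
    using IH by measurable
  moreover have "of_nat (jumps K p j (s c) (a # as)) = (if alive K (s c) then (if jumped p j a (s c) then 1 else 0) +
      of_nat (jumps K p j (step a (s c)) as) else 0 :: ennreal)" for c
    by simp
  ultimately show ?case by simp
qed simp

lemma measurable_initial_state:
  "(\<lambda>x. initial_state x p) \<in> measurable (config_space \<Otimes>\<^sub>M config_space \<Otimes>\<^sub>M config_space) config_space"
proof -
  have "(\<lambda>x. initial_state x p) = heights \<circ> (\<lambda>x. case p of Lower \<Rightarrow> fst x | Monotone \<Rightarrow> fst (snd x)
      | Middle \<Rightarrow> fst (snd x) | Upper \<Rightarrow> snd (snd x))"
    by (rule ext, clarify) (cases p; simp)
  moreover have "(\<lambda>x. case p of Lower \<Rightarrow> fst x | Monotone \<Rightarrow> fst (snd x)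
      | Middle \<Rightarrow> fst (snd x) | Upper \<Rightarrow> snd (snd x)) \<in>
      measurable (config_space \<Otimes>\<^sub>M config_space \<Otimes>\<^sub>M config_space) config_space"
    by (cases p) auto
  ultimately show ?thesis by (simp only:) (rule measurable_comp[OF _ measurable_heights])
qed

lemma measurable_expected_jumps:
  "(\<lambda>x. expected_jumps K d n j (initial_state x)) \<in>
    borel_measurable (config_space \<Otimes>\<^sub>M config_space \<Otimes>\<^sub>M config_space)"
  unfolding expected_jumps_def
  by (intro borel_measurable_sum borel_measurable_times_ennreal borel_measurable_const
    measurable_jumps measurable_initial_state)

end

section \<open>From the discrete chains to the monotone process\<close>

context poisson_coupling
begin

text \<open>At most one history matches, so this is the count along it, or 0 if some slab has
  several points. The finite sum is measurable and can be integrated term by term.\<close>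

definition slab_jumps ::
    "nat \<Rightarrow> nat \<Rightarrow> real \<Rightarrow> int \<Rightarrow> config \<times> config \<times> config \<Rightarrow> (int \<Rightarrow> (real \<times> real) set) \<Rightarrow> ennreal" where
  "slab_jumps K n d j c S = (\<Sum>as\<in>histories K n.
    indicator {S. matches K S 0 d as} S * of_nat (jumps K Monotone j (initial_state c) as))"

lemma slab_jumps_eq:
  assumes as: "as \<in> histories K n" and m: "matches K S 0 d as"
  shows "slab_jumps K n d j c S = of_nat (jumps K Monotone j (initial_state c) as)"
proof -
  have "slab_jumps K n d j c S =
      (\<Sum>as'\<in>histories K n. if as' = as then of_nat (jumps K Monotone j (initial_state c) as) else 0)"
    unfolding slab_jumps_def
  proof (rule sum.cong[OF refl])
    fix as' assume as': "as' \<in> histories K n"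
    show "indicator {S. matches K S 0 d as'} S * of_nat (jumps K Monotone j (initial_state c) as') =
        (if as' = as then of_nat (jumps K Monotone j (initial_state c) as) else (0 :: ennreal))"
    proof (cases "as' = as")
      case False
      have "\<not> matches K S 0 d as'"
      proof
        assume "matches K S 0 d as'"
        from matches_unique[OF as' as this m] False show False by contradiction
      qed
      with False show ?thesis by simp
    qed (simp add: m)
  qed
  then show ?thesis using as finite_histories by simp
qed

lemma measurable_slab_jumps:
  assumes f: "f \<in> measurable X (config_space \<Otimes>\<^sub>M config_space \<Otimes>\<^sub>M config_space)"
    and g: "g \<in> measurable X (PiM UNIV (\<lambda>_. point_space))"
  shows "(\<lambda>x. slab_jumps K n d j (f x) (g x)) \<in> borel_measurable X"
proof -
  have "(\<lambda>x. indicator {S. matches K S 0 d as} (g x) :: ennreal) \<in> borel_measurable X" for as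
  proof -
    have [measurable]: "Measurable.pred X (\<lambda>x. matches K (g x) 0 d as)"
      using measurable_compose[OF g measurable_matches] .
    have "(\<lambda>x. if matches K (g x) 0 d as then 1 else 0 :: ennreal) \<in> borel_measurable X" by measurable
    then show ?thesis by (simp add: indicator_def)
  qed
  then show ?thesis
    unfolding slab_jumps_def
    by (intro borel_measurable_sum borel_measurable_times_ennreal measurable_jumps
      measurable_compose[OF f measurable_initial_state])
qed

lemma nn_integral_slab_jumps:
  assumes n: "0 < n" and d: "0 \<le> d"
  shows "(\<integral>\<^sup>+x. slab_jumps K n d j c (\<lambda>i. N i x) \<partial>M) = expected_jumps K d n j (initial_state c)"
proof -
  have ev: "(\<integral>\<^sup>+x. indicator {S. matches K S 0 d as} (\<lambda>i. N i x) \<partial>M) = ennreal (history_weight K d as)"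
    if "as \<in> histories K n" for as
  proof -
    have "(\<integral>\<^sup>+x. indicator {S. matches K S 0 d as} (\<lambda>i. N i x) \<partial>M) =
        (\<integral>\<^sup>+x. indicator {x \<in> space M. matches K (\<lambda>j. N j x) 0 d as} x \<partial>M)"
      by (intro nn_integral_cong) (auto simp: indicator_def)
    also have "\<dots> = emeasure M {x \<in> space M. matches K (\<lambda>j. N j x) 0 d as}"
      by (intro nn_integral_indicator) measurable
    also have "\<dots> = ennreal (history_weight K d as)"
      by (simp add: emeasure_eq_measure prob_matches[OF that n d])
    finally show ?thesis .
  qed
  have m: "(\<lambda>x. indicator {S. matches K S 0 d as} (\<lambda>i. N i x) :: ennreal) \<in> borel_measurable M" for as
  proof -
    have "(\<lambda>x. if matches K (\<lambda>j. N j x) 0 d as then 1 else 0 :: ennreal) \<in> borel_measurable M" by measurable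
    then show ?thesis by (simp add: indicator_def)
  qed
  show ?thesis
    unfolding slab_jumps_def expected_jumps_def using m
    by (simp add: nn_integral_sum nn_integral_multc ev)
qed

text \<open>Beyond the cut-off for this sample and the last bad index the count is exact. The lower
  limit is used because it is defined and measurable everywhere.\<close>

lemma slab_jumps_limit:
  assumes t: "0 < t" and x: "x \<in> space M"
    and ev: "eventually (\<lambda>K. \<exists>as\<in>histories K (n K). matches K (\<lambda>j. N j x) 0 (t / real (n K)) as) sequentially"
    and n: "\<And>K. 0 < n K"
  shows "liminf (\<lambda>K. slab_jumps K (n K) (t / real (n K)) j (\<eta>, \<zeta>, \<xi>) (\<lambda>j. N j x)) =
    ennreal (of_int (monotone_heights r (\<lambda>j. N j x) L R \<zeta> t j - heights \<zeta> j))" (is "_ = ?v")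
proof -
  obtain K\<^sub>0 where K\<^sub>0: "\<And>K n as. K\<^sub>0 \<le> K \<Longrightarrow> 0 < n \<Longrightarrow> as \<in> histories K n \<Longrightarrow>
      matches K (\<lambda>j. N j x) 0 (t / real n) as \<Longrightarrow>
      int (jumps K Monotone j (initial_state (\<eta>, \<zeta>, \<xi>)) as) =
        monotone_heights r (\<lambda>j. N j x) L R \<zeta> t j - heights \<zeta> j"
    using jumps_eq_monotone_heights[where S="\<lambda>j. N j x" and j=j and \<eta>=\<eta> and \<zeta>=\<zeta> and \<xi>=\<xi>, OF N_locally_finite[OF x] t] by blast
  have "eventually (\<lambda>K. slab_jumps K (n K) (t / real (n K)) j (\<eta>, \<zeta>, \<xi>) (\<lambda>j. N j x) = ?v) sequentially"
    using ev eventually_ge_at_top[of K\<^sub>0]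
  proof eventually_elim
    case (elim K)
    then obtain as where as: "as \<in> histories K (n K)" "matches K (\<lambda>j. N j x) 0 (t / real (n K)) as" by blast
    have "real (jumps K Monotone j (initial_state (\<eta>, \<zeta>, \<xi>)) as) =
        of_int (monotone_heights r (\<lambda>j. N j x) L R \<zeta> t j - heights \<zeta> j)"
      using K\<^sub>0[OF elim(2) n as] by (metis of_int_of_nat_eq)
    then show ?case
      unfolding slab_jumps_eq[OF as] ennreal_of_nat_eq_real_of_nat by simp
  qed
  then have "(\<lambda>K. slab_jumps K (n K) (t / real (n K)) j (\<eta>, \<zeta>, \<xi>) (\<lambda>j. N j x)) \<longlonglongrightarrow> ?v"
    by (rule tendsto_eventually)
  then show ?thesis by (intro lim_imp_Liminf) simp_all
qed

text \<open>
  \<open>F\<close> is a measurable version of the height increment; the independence of \<open>\<omega>\<close> and the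
  point processes lets the coupled triple replace \<open>\<omega>\<close> under the integral.
\<close>

lemma finite_volume_bound:
  assumes t: "0 < t" and j: "L \<le> j" "j < R" and \<omega>: "\<omega> \<in> measurable M config_space"
    and indep: "indep_set {\<omega> -` A \<inter> space M | A. A \<in> sets config_space}
      {(\<lambda>x j. N j x) -` B \<inter> space M | B. B \<in> sets (PiM UNIV (\<lambda>_. point_space))}"
    and \<kappa>: "prob_space \<kappa>" "sets \<kappa> = sets (config_space \<Otimes>\<^sub>M config_space \<Otimes>\<^sub>M config_space)"
    and lower: "distr \<kappa> config_space (\<lambda>(\<eta>, \<zeta>, \<xi>). \<eta>) = product_state r \<theta>\<^sub>1"
    and middle: "distr \<kappa> config_space (\<lambda>(\<eta>, \<zeta>, \<xi>). \<zeta>) = distr M config_space \<omega>"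
    and upper: "distr \<kappa> config_space (\<lambda>(\<eta>, \<zeta>, \<xi>). \<xi>) = product_state r \<theta>\<^sub>2"
    and AE: "AE (\<eta>, \<zeta>, \<xi>) in \<kappa>. \<forall>i. \<eta> i \<le> \<zeta> i \<and> \<zeta> i \<le> \<xi> i"
  shows "\<exists>F\<in>borel_measurable M.
    (AE x in M. F x = ennreal (of_int (monotone_heights r (\<lambda>j. N j x) L R (\<omega> x) t j - heights (\<omega> x) j))) \<and>
    (\<integral>\<^sup>+x. F x \<partial>M) \<le> ennreal (t * (exp \<theta>\<^sub>2 + exp (- \<theta>\<^sub>1)))"
proof -
  let ?P = "PiM UNIV (\<lambda>_::int. point_space)" and ?N = "\<lambda>x j. N j x"
  have t0: "0 \<le> t" using t by simp
  obtain n where n: "\<And>K. 0 < n K"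
    and ev: "AE x in M. eventually (\<lambda>K. \<exists>as\<in>histories K (n K). matches K (?N x) 0 (t / real (n K)) as) sequentially"
    using slab_numbers[OF t0] by blast
  define G where "G c S = liminf (\<lambda>K. slab_jumps K (n K) (t / real (n K)) j c S)" for c S
  have mG: "(\<lambda>x. G (f x) (g x)) \<in> borel_measurable X"
    if "f \<in> measurable X (config_space \<Otimes>\<^sub>M config_space \<Otimes>\<^sub>M config_space)" "g \<in> measurable X ?P" for f g and X :: "'x measure"
    unfolding G_def by (intro borel_measurable_liminf measurable_slab_jumps that)
  \<comment> \<open>One null set serves all triples, since the slab condition does not involve the
    initial state, and the value depends on \<zeta> alone.\<close>
  have GN: "AE x in M. \<forall>\<eta> \<zeta> \<xi>. G (\<eta>, \<zeta>, \<xi>) (?N x) =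
      ennreal (of_int (monotone_heights r (?N x) L R \<zeta> t j - heights \<zeta> j))"
    using ev AE_space
  proof eventually_elim
    case (elim x)
    then show ?case unfolding G_def using slab_jumps_limit[where n=n, OF t elim(2) elim(1) n] by blast
  qed
  \<comment> \<open>No coupling lives on M itself, so \<omega> fills all three places; by
    \<open>GN\<close> this does not change the value.\<close>
  define F where "F x = G (\<omega> x, \<omega> x, \<omega> x) (?N x)" for x
  have mF: "F \<in> borel_measurable M"
    unfolding F_def using \<omega> by (intro mG N_PiM_measurable) auto
  have F_eq: "AE x in M. F x = ennreal (of_int (monotone_heights r (?N x) L R (\<omega> x) t j - heights (\<omega> x) j))"
    using GN unfolding F_def by eventually_elim blast
  interpret PN: prob_space "distr M ?P ?N" by (rule prob_space_distr[OF N_PiM_measurable])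
  let ?g = "\<lambda>(\<zeta>, S). G (\<zeta>, \<zeta>, \<zeta>) S"
  have mg: "?g \<in> borel_measurable (config_space \<Otimes>\<^sub>M ?P)"
  proof -
    have "(\<lambda>p. (fst p, fst p, fst p)) \<in> measurable (config_space \<Otimes>\<^sub>M ?P) (config_space \<Otimes>\<^sub>M config_space \<Otimes>\<^sub>M config_space)"
      by measurable
    from mG[OF this measurable_snd] show ?thesis by (simp add: case_prod_beta')
  qed
  have dist: "distr M config_space \<omega> \<Otimes>\<^sub>M distr M ?P ?N = distr M (config_space \<Otimes>\<^sub>M ?P) (\<lambda>x. (\<omega> x, ?N x))"
    by (rule distr_pair_indep_set[OF \<omega> N_PiM_measurable indep])
  have mpair: "(\<lambda>x. (\<omega> x, ?N x)) \<in> measurable M (config_space \<Otimes>\<^sub>M ?P)"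
    using \<omega> N_PiM_measurable by (rule measurable_Pair)
  define H where "H \<zeta> = (\<integral>\<^sup>+x. G (\<zeta>, \<zeta>, \<zeta>) (?N x) \<partial>M)" for \<zeta>
  have H_eq: "H \<zeta> = (\<integral>\<^sup>+S. ?g (\<zeta>, S) \<partial>distr M ?P ?N)" for \<zeta>
    unfolding H_def using measurable_compose_Pair1[OF _ mg, of \<zeta>] N_PiM_measurable
    by (subst nn_integral_distr) auto
  have mg': "?g \<in> borel_measurable (config_space \<Otimes>\<^sub>M distr M ?P ?N)"
    using mg by (simp cong: measurable_cong_sets)
  have mH: "H \<in> borel_measurable config_space"
    unfolding H_eq[abs_def] by (rule PN.borel_measurable_nn_integral_fst[OF mg'])
  have mid: "(\<lambda>(\<eta>, \<zeta>, \<xi>). \<zeta>) \<in> measurable \<kappa> config_space"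
    unfolding measurable_cong_sets[OF \<kappa>(2) refl] by measurable
  have "(\<integral>\<^sup>+x. F x \<partial>M) = (\<integral>\<^sup>+p. ?g p \<partial>distr M (config_space \<Otimes>\<^sub>M ?P) (\<lambda>x. (\<omega> x, ?N x)))"
    unfolding F_def using mg by (subst nn_integral_distr[OF mpair]) auto
  also have "\<dots> = (\<integral>\<^sup>+p. ?g p \<partial>(distr M config_space \<omega> \<Otimes>\<^sub>M distr M ?P ?N))"
    unfolding dist ..
  also have "\<dots> = (\<integral>\<^sup>+\<zeta>. (\<integral>\<^sup>+S. ?g (\<zeta>, S) \<partial>distr M ?P ?N) \<partial>distr M config_space \<omega>)"
    using mg by (intro PN.nn_integral_fst[symmetric]) (simp cong: measurable_cong_sets)
  \<comment> \<open>The law of \<omega> is now read as the middle marginal of \<kappa>, which brings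
    in \<eta> and \<xi>.\<close>
  also have "\<dots> = (\<integral>\<^sup>+\<zeta>. H \<zeta> \<partial>distr \<kappa> config_space (\<lambda>(\<eta>, \<zeta>, \<xi>). \<zeta>))"
    unfolding middle H_eq ..
  also have "\<dots> = (\<integral>\<^sup>+c. H (fst (snd c)) \<partial>\<kappa>)"
    using mH mid by (subst nn_integral_distr) (auto simp: case_prod_beta')
  also have "\<dots> \<le> (\<integral>\<^sup>+c. liminf (\<lambda>K. expected_jumps K (t / real (n K)) (n K) j (initial_state c)) \<partial>\<kappa>)"
  proof (rule nn_integral_mono)
    fix c :: "config \<times> config \<times> config"
    obtain \<eta> \<zeta> \<xi> where c: "c = (\<eta>, \<zeta>, \<xi>)" by (cases c)
    have "H (fst (snd c)) = (\<integral>\<^sup>+x. liminf (\<lambda>K. slab_jumps K (n K) (t / real (n K)) j c (?N x)) \<partial>M)"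
      unfolding H_def G_def[symmetric] c using GN by (intro nn_integral_cong_AE) auto
    \<comment> \<open>Fatou over the point processes with the triple frozen; a second application
      below treats the triple.\<close>
    also have "\<dots> \<le> liminf (\<lambda>K. \<integral>\<^sup>+x. slab_jumps K (n K) (t / real (n K)) j c (?N x) \<partial>M)"
      by (intro nn_integral_liminf measurable_slab_jumps N_PiM_measurable) (simp add: space_pair_measure)
    also have "\<dots> = liminf (\<lambda>K. expected_jumps K (t / real (n K)) (n K) j (initial_state c))"
      using t0 by (simp add: nn_integral_slab_jumps[OF n])
    finally show "H (fst (snd c)) \<le> liminf (\<lambda>K. expected_jumps K (t / real (n K)) (n K) j (initial_state c))" .
  qed
  also have "\<dots> \<le> liminf (\<lambda>K. \<integral>\<^sup>+c. expected_jumps K (t / real (n K)) (n K) j (initial_state c) \<partial>\<kappa>)"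
    using measurable_expected_jumps \<kappa>(2)
    by (intro nn_integral_liminf) (simp cong: measurable_cong_sets)
  also have "\<dots> \<le> liminf (\<lambda>K. ennreal (t * (exp \<theta>\<^sub>2 + exp (- \<theta>\<^sub>1))))"
  proof (intro Liminf_mono always_eventually allI)
    fix K
    have "(\<integral>\<^sup>+c. expected_jumps K (t / real (n K)) (n K) j (initial_state c) \<partial>\<kappa>) \<le>
        ennreal (real (n K) * (t / real (n K)) * (exp \<theta>\<^sub>2 + exp (- \<theta>\<^sub>1)))"
      using t0 by (intro nn_integral_expected_jumps_le j \<kappa>(2) lower upper AE) simp
    then show "(\<integral>\<^sup>+c. expected_jumps K (t / real (n K)) (n K) j (initial_state c) \<partial>\<kappa>) \<le>
        ennreal (t * (exp \<theta>\<^sub>2 + exp (- \<theta>\<^sub>1)))"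
      using n[of K] by simp
  qed
  also have "\<dots> = ennreal (t * (exp \<theta>\<^sub>2 + exp (- \<theta>\<^sub>1)))"
    by (rule Liminf_const) simp
  finally show ?thesis using mF F_eq by blast
qed

end

theorem theorem2p3:
  fixes r :: "int \<Rightarrow> real"
    and M :: "'a measure"
    and N :: "int \<Rightarrow> 'a \<Rightarrow> (real \<times> real) set"
    and \<omega> :: "'a \<Rightarrow> config"
    and \<pi> :: "config measure"
    and \<theta>\<^sub>1 \<theta>\<^sub>2 t :: real
    and i :: int
  assumes r_pos: "\<And>z. 0 < r z"
    and r_strict_mono: "strict_mono r"
    and r_symm: "\<And>z. r z * r (1 - z) = 1"
    and r_lim: "filterlim r at_top at_top"
    and r_exp_bound: "\<exists>\<beta>>0. \<forall>z>0. r z < exp (\<beta> * of_int z)"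
    and M: "prob_space M"
    and N_poisson: "\<And>j. poisson_point_process M (N j)"
    and N_indep: "prob_space.indep_vars M (\<lambda>_. point_space) N UNIV"
    and \<omega>_measurable: "\<omega> \<in> measurable M config_space"
    and \<omega>_distr: "distr M config_space \<omega> = \<pi>"
    and \<omega>_N_indep: "prob_space.indep_set M
          {\<omega> -` A \<inter> space M | A. A \<in> sets config_space}
          {(\<lambda>x j. N j x) -` B \<inter> space M | B. B \<in> sets (PiM UNIV (\<lambda>_. point_space))}"
    and \<theta>: "\<theta>\<^sub>1 < \<theta>\<^sub>2"
    and \<pi>_good: "good_measure r \<theta>\<^sub>1 \<theta>\<^sub>2 \<pi>"
    and t: "0 \<le> t"
  shows "(\<integral>\<^sup>+x. e2ennreal (limit_heights r (\<lambda>j. N j x) (\<omega> x) t i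
                      - limit_heights r (\<lambda>j. N j x) (\<omega> x) 0 i) \<partial>M)
          \<le> ennreal (t * (exp \<theta>\<^sub>2 + exp (- \<theta>\<^sub>1)))"
proof -
  interpret rate_function r
    by (standard; fact)
  interpret prob_space M by (fact M)
  interpret point_processes M N by (standard; fact)
  from \<pi>_good obtain \<kappa> where \<kappa>: "prob_space \<kappa>"
      "sets \<kappa> = sets (config_space \<Otimes>\<^sub>M config_space \<Otimes>\<^sub>M config_space)"
      "distr \<kappa> config_space (\<lambda>(\<eta>, \<zeta>, \<xi>). \<eta>) = product_state r \<theta>\<^sub>1"
      "distr \<kappa> config_space (\<lambda>(\<eta>, \<zeta>, \<xi>). \<zeta>) = distr M config_space \<omega>"
      "distr \<kappa> config_space (\<lambda>(\<eta>, \<zeta>, \<xi>). \<xi>) = product_state r \<theta>\<^sub>2"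
      "AE (\<eta>, \<zeta>, \<xi>) in \<kappa>. \<forall>i. \<eta> i \<le> \<zeta> i \<and> \<zeta> i \<le> \<xi> i"
    unfolding good_measure_def \<omega>_distr by blast
  let ?N = "\<lambda>x j. N j x"
  let ?h = "\<lambda>m x. ennreal (of_int (monotone_heights r (?N x) (i - int m) (i + 1 + int m) (\<omega> x) t i - heights (\<omega> x) i))"
  let ?b = "ennreal (t * (exp \<theta>\<^sub>2 + exp (- \<theta>\<^sub>1)))"
  show ?thesis
  proof (cases "t = 0")
    \<comment> \<open>Slabs have positive length in the finite-volume bound, so time 0 is
      separate.\<close>
    case True
    have "(\<integral>\<^sup>+x. e2ennreal (limit_heights r (?N x) (\<omega> x) t i - limit_heights r (?N x) (\<omega> x) 0 i) \<partial>M) =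
        (\<integral>\<^sup>+x. 0 \<partial>M)"
      unfolding True
    proof (rule nn_integral_cong)
      fix x assume "x \<in> space M"
      from limit_heights_0[of "?N x", OF N_locally_finite[OF this]]
      show "e2ennreal (limit_heights r (?N x) (\<omega> x) 0 i - limit_heights r (?N x) (\<omega> x) 0 i) = 0" by simp
    qed
    then show ?thesis by simp
  next
    case False
    with t have t: "0 < t" by simp
    \<comment> \<open>Measurable versions of the increments in finite windows, so that Fatou's lemma
      never needs measurability of the path itself.\<close>
    have "\<exists>F\<in>borel_measurable M. (AE x in M. F x = ?h m x) \<and> (\<integral>\<^sup>+x. F x \<partial>M) \<le> ?b" for m :: nat
    proof -
      interpret poisson_coupling r "i - int m" "i + 1 + int m" \<theta>\<^sub>1 \<theta>\<^sub>2 M N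
        by standard (use \<theta> in auto)
      show ?thesis
        by (rule finite_volume_bound[OF t _ _ \<omega>_measurable \<omega>_N_indep \<kappa>]) auto
    qed
    then have "\<forall>m. \<exists>F. F \<in> borel_measurable M \<and> (AE x in M. F x = ?h m x) \<and> (\<integral>\<^sup>+x. F x \<partial>M) \<le> ?b"
      by blast
    from choice[OF this] obtain F where F: "\<And>m. F m \<in> borel_measurable M" "\<And>m. AE x in M. F m x = ?h m x"
      "\<And>m. (\<integral>\<^sup>+x. F m x \<partial>M) \<le> ?b"
      by blast
    have "AE x in M. \<forall>m. F m x = ?h m x" unfolding AE_all_countable using F(2) by blast
    then have "AE x in M. e2ennreal (limit_heights r (?N x) (\<omega> x) t i - limit_heights r (?N x) (\<omega> x) 0 i) =
        liminf (\<lambda>m. F m x)"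
      using AE_space
    proof eventually_elim
      case (elim x)
      have "(\<lambda>m. F m x) \<longlonglongrightarrow> e2ennreal (limit_heights r (?N x) (\<omega> x) t i - limit_heights r (?N x) (\<omega> x) 0 i)"
        using height_difference_tendsto[of "?N x" t i "\<omega> x", OF N_locally_finite[OF elim(2)]] elim(1) t by simp
      then show ?case by (intro lim_imp_Liminf[symmetric]) simp_all
    qed
    \<comment> \<open>The integrand is only identified almost everywhere with a measurable function,
      which suffices for the integral.\<close>
    then have "(\<integral>\<^sup>+x. e2ennreal (limit_heights r (?N x) (\<omega> x) t i - limit_heights r (?N x) (\<omega> x) 0 i) \<partial>M) =
        (\<integral>\<^sup>+x. liminf (\<lambda>m. F m x) \<partial>M)"
      by (rule nn_integral_cong_AE)
    also have "\<dots> \<le> liminf (\<lambda>m. \<integral>\<^sup>+x. F m x \<partial>M)"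
      by (intro nn_integral_liminf F(1))
    also have "\<dots> \<le> liminf (\<lambda>m::nat. ?b)"
      by (intro Liminf_mono always_eventually allI F(3))
    also have "\<dots> = ?b" by (rule Liminf_const) simp
    finally show ?thesis .
  qed
qed

end
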